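(* Every distributive $\langle\vee,0\rangle$-semilattice of size at most $\aleph_1$ is isomorphic to the $\langle\vee,0\rangle$-semilattice $\mathrm{NSub_c}\,G$ of all finitely generated normal subgroups of some group $G$ which is a direct limit of members of $\mathcal{F}$.
   Context: A $\langle\vee,0\rangle$-semilattice $S$ is distributive if for all $a,b,c\in S$ with $c\leq a\vee b$ there are $a'\leq a$ and $b'\leq b$ in $S$ such that $c=a'\vee b'$. For a group $G$, $\mathrm{NSub_c}\,G$ is the $\langle\vee,0\rangle$-semilattice of all normal subgroups of $G$ that are finitely generated as normal subgroups (i.e., the compact elements of the normal subgroup lattice of $G$). $\mathcal{F}$ denotes the class of all finite products of alternating groups of the form $\mathfrak{A}_n$, for $n\geq 5$. Direct limits are direct limits of directed systems of groups and group homomorphisms. *)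

theory Defs
  imports "HOL-Algebra.Lattice" "HOL-Algebra.Product_Groups" "HOL-Algebra.Sym_Groups"
begin

unbundle cardinal_syntax

section \<open>Distributive join-semilattices with zero\<close>

locale distributive_semilattice0 =
  upper_semilattice S + weak_partial_order_bottom S for S (structure) +
  assumes distributive:
    "\<lbrakk>a \<in> carrier S; b \<in> carrier S; c \<in> carrier S; c \<sqsubseteq> a \<squnion> b\<rbrakk>
      \<Longrightarrow> \<exists>a'\<in>carrier S. \<exists>b'\<in>carrier S. a' \<sqsubseteq> a \<and> b' \<sqsubseteq> b \<and> c = a' \<squnion> b'"

definition semilattice0_iso ::
    "('a, 'c) gorder_scheme \<Rightarrow> ('b, 'd) gorder_scheme \<Rightarrow> ('a \<Rightarrow> 'b) set" where
  "semilattice0_iso S T =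
    {h. bij_betw h (carrier S) (carrier T) \<and>
        (\<forall>x\<in>carrier S. \<forall>y\<in>carrier S. h (x \<squnion>\<^bsub>S\<^esub> y) = h x \<squnion>\<^bsub>T\<^esub> h y) \<and>
        h \<bottom>\<^bsub>S\<^esub> = \<bottom>\<^bsub>T\<^esub>}"


section \<open>Finitely generated normal subgroups\<close>

definition normal_closure :: "('a, 'b) monoid_scheme \<Rightarrow> 'a set \<Rightarrow> 'a set" where
  "normal_closure G A = \<Inter> {N. N \<lhd> G \<and> A \<subseteq> N}"

definition NSubc :: "('a, 'b) monoid_scheme \<Rightarrow> 'a set gorder" where
  "NSubc G = \<lparr>carrier = {normal_closure G A | A. finite A \<and> A \<subseteq> carrier G},
              eq = (=), le = (\<subseteq>)\<rparr>"

context group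
begin

lemma normal_normal_closure:
  assumes "A \<subseteq> carrier G"
  shows "normal_closure G A \<lhd> G"
proof -
  have top: "carrier G \<lhd> G"
    by (simp add: normal_inv_iff subgroup_self)
  have "subgroup (\<Inter> {N. N \<lhd> G \<and> A \<subseteq> N}) G"
    by (rule subgroups_Inter) (use top assms in \<open>auto simp: normal_inv_iff\<close>)
  then show ?thesis
    unfolding normal_closure_def normal_inv_iff by auto
qed

lemma subset_normal_closure: "A \<subseteq> normal_closure G A"
  by (auto simp: normal_closure_def)

lemma normal_closure_least: "N \<lhd> G \<Longrightarrow> A \<subseteq> N \<Longrightarrow> normal_closure G A \<subseteq> N"
  by (auto simp: normal_closure_def)

lemma least_join_NSubc:
  assumes "finite A" "A \<subseteq> carrier G" "finite B" "B \<subseteq> carrier G"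
  shows "least (NSubc G) (normal_closure G (A \<union> B))
           (Upper (NSubc G) {normal_closure G A, normal_closure G B})"
proof -
  have 1: "normal_closure G A \<subseteq> normal_closure G (A \<union> B)"
      "normal_closure G B \<subseteq> normal_closure G (A \<union> B)"
    using normal_normal_closure[of "A \<union> B"] subset_normal_closure[of "A \<union> B"] assms
    by (meson le_sup_iff normal_closure_least)+
  have 2: "normal_closure G (A \<union> B) \<subseteq> normal_closure G C"
    if "normal_closure G A \<subseteq> normal_closure G C" "normal_closure G B \<subseteq> normal_closure G C"
      "C \<subseteq> carrier G" for C
    using that subset_normal_closure[of A] subset_normal_closure[of B]
    by (intro normal_closure_least normal_normal_closure) auto
  show ?thesis
    unfolding least_def
  proof (intro conjI ballI)
    show "normal_closure G (A \<union> B)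
        \<in> Upper (NSubc G) {normal_closure G A, normal_closure G B}"
      using 1 assms by (auto simp: Upper_def NSubc_def intro!: exI[of _ "A \<union> B"])
    show "normal_closure G (A \<union> B) \<sqsubseteq>\<^bsub>NSubc G\<^esub> u"
      if u: "u \<in> Upper (NSubc G) {normal_closure G A, normal_closure G B}" for u
    proof -
      obtain C where C: "finite C" "C \<subseteq> carrier G" "u = normal_closure G C"
        using u by (auto simp: Upper_def NSubc_def)
      have "normal_closure G A \<in> carrier (NSubc G)" "normal_closure G B \<in> carrier (NSubc G)"
        using assms by (auto simp: NSubc_def)
      then have "normal_closure G A \<subseteq> u" "normal_closure G B \<subseteq> u"
        using u by (auto simp: Upper_def NSubc_def)
      then show ?thesis
        using 2[of C] C by (simp add: NSubc_def)
    qed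
  qed (auto simp: Upper_def)
qed

lemma partial_order_NSubc: "partial_order (NSubc G)"
  by unfold_locales (auto simp: NSubc_def)

lemma upper_semilattice_NSubc: "upper_semilattice (NSubc G)"
proof -
  interpret P: partial_order "NSubc G" by (rule partial_order_NSubc)
  show ?thesis
  proof
    fix x y assume "x \<in> carrier (NSubc G)" "y \<in> carrier (NSubc G)"
    then obtain A B where "finite A" "A \<subseteq> carrier G" "finite B" "B \<subseteq> carrier G"
      "x = normal_closure G A" "y = normal_closure G B"
      by (auto simp: NSubc_def)
    then show "\<exists>s. least (NSubc G) s (Upper (NSubc G) {x, y})"
      using least_join_NSubc by blast
  qed
qed

lemma join_NSubc:
  assumes "finite A" "A \<subseteq> carrier G" "finite B" "B \<subseteq> carrier G"
  shows "normal_closure G A \<squnion>\<^bsub>NSubc G\<^esub> normal_closure G B = normal_closure G (A \<union> B)"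
proof -
  interpret P: upper_semilattice "NSubc G" by (rule upper_semilattice_NSubc)
  note l = least_join_NSubc[OF assms]
  show ?thesis
    unfolding join_def sup_def by (rule some_equality) (use l P.least_unique in blast)+
qed

lemma bottom_NSubc: "\<bottom>\<^bsub>NSubc G\<^esub> = {\<one>}"
proof -
  interpret P: partial_order "NSubc G" by (rule partial_order_NSubc)
  have e: "normal_closure G {} = {\<one>}"
  proof
    show "normal_closure G {} \<subseteq> {\<one>}"
      by (rule normal_closure_least) (auto simp: one_is_normal)
    show "{\<one>} \<subseteq> normal_closure G {}"
      using normal_normal_closure[of "{}"] normal_imp_subgroup subgroup.one_closed by blast
  qed
  have l: "least (NSubc G) {\<one>} (carrier (NSubc G))"
    unfolding least_def
    using e normal_normal_closure[THEN normal_imp_subgroup, THEN subgroup.one_closed]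
    by (auto simp: NSubc_def intro!: exI[of _ "{}"])
  show ?thesis
    unfolding bottom_def by (rule some_equality) (use l P.least_unique in blast)+
qed

end


section \<open>Finite products of alternating groups\<close>

text \<open>The class is closed under isomorphism; the empty product (\<open>k = 0\<close>) is the trivial group.\<close>

definition alternating_products :: "'a monoid set" where
  "alternating_products =
    {H. group H \<and> (\<exists>(k::nat) n. (\<forall>j<k. 5 \<le> n j) \<and> H \<cong> product_group {..<k} (\<lambda>j. alt_group (n j)))}"


section \<open>Direct limits of groups\<close>

locale directed_group_system = partial_order I
  for I :: "('i, 'c) gorder_scheme" (structure) +
  fixes H :: "'i \<Rightarrow> ('g, 'd) monoid_scheme"
    and \<phi> :: "'i \<Rightarrow> 'i \<Rightarrow> 'g \<Rightarrow> 'g"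
  assumes nonempty: "carrier I \<noteq> {}"
    and directed: "\<lbrakk>i \<in> carrier I; j \<in> carrier I\<rbrakk> \<Longrightarrow> \<exists>k\<in>carrier I. i \<sqsubseteq> k \<and> j \<sqsubseteq> k"
    and group_H: "i \<in> carrier I \<Longrightarrow> group (H i)"
    and hom_\<phi>: "\<lbrakk>i \<in> carrier I; j \<in> carrier I; i \<sqsubseteq> j\<rbrakk> \<Longrightarrow> \<phi> i j \<in> hom (H i) (H j)"
    and \<phi>_id: "\<lbrakk>i \<in> carrier I; x \<in> carrier (H i)\<rbrakk> \<Longrightarrow> \<phi> i i x = x"
    and \<phi>_comp: "\<lbrakk>i \<in> carrier I; j \<in> carrier I; k \<in> carrier I; i \<sqsubseteq> j; j \<sqsubseteq> k; x \<in> carrier (H i)\<rbrakk>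
      \<Longrightarrow> \<phi> j k (\<phi> i j x) = \<phi> i k x"

text \<open>The direct limit is the disjoint union of the groups modulo eventual equality.\<close>

definition eventually_equal ::
    "('i, 'c) gorder_scheme \<Rightarrow> ('i \<Rightarrow> ('g, 'd) monoid_scheme) \<Rightarrow> ('i \<Rightarrow> 'i \<Rightarrow> 'g \<Rightarrow> 'g)
      \<Rightarrow> (('i \<times> 'g) \<times> ('i \<times> 'g)) set" where
  "eventually_equal I H \<phi> =
    {((i, x), (j, y)) | i x j y.
       i \<in> carrier I \<and> x \<in> carrier (H i) \<and> j \<in> carrier I \<and> y \<in> carrier (H j) \<and>
       (\<exists>k\<in>carrier I. i \<sqsubseteq>\<^bsub>I\<^esub> k \<and> j \<sqsubseteq>\<^bsub>I\<^esub> k \<and> \<phi> i k x = \<phi> j k y)}"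

text \<open>In \<open>mult\<close> and \<open>one\<close> below, all the pairs listed represent the same class, so that the image
  of the set of these pairs is that class: two elements are multiplied at any common upper
  index of any two of their representatives.\<close>

definition direct_limit ::
    "('i, 'c) gorder_scheme \<Rightarrow> ('i \<Rightarrow> ('g, 'd) monoid_scheme) \<Rightarrow> ('i \<Rightarrow> 'i \<Rightarrow> 'g \<Rightarrow> 'g)
      \<Rightarrow> ('i \<times> 'g) set monoid" where
  "direct_limit I H \<phi> =
    \<lparr>carrier = (SIGMA i:carrier I. carrier (H i)) // eventually_equal I H \<phi>,
     monoid.mult = (\<lambda>P Q. eventually_equal I H \<phi> ``
       {(k, \<phi> i k x \<otimes>\<^bsub>H k\<^esub> \<phi> j k y) | i x j y k.
          (i, x) \<in> P \<and> (j, y) \<in> Q \<and> k \<in> carrier I \<and> i \<sqsubseteq>\<^bsub>I\<^esub> k \<and> j \<sqsubseteq>\<^bsub>I\<^esub> k}),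
     one = eventually_equal I H \<phi> `` {(i, \<one>\<^bsub>H i\<^esub>) | i. i \<in> carrier I}\<rparr>"

context directed_group_system
begin

abbreviation cls :: "'i \<Rightarrow> 'g \<Rightarrow> ('i \<times> 'g) set" where
  "cls i x \<equiv> eventually_equal I H \<phi> `` {(i, x)}"

lemma \<phi>_closed:
  "\<lbrakk>i \<in> carrier I; j \<in> carrier I; i \<sqsubseteq> j; x \<in> carrier (H i)\<rbrakk> \<Longrightarrow> \<phi> i j x \<in> carrier (H j)"
  using hom_\<phi> by (auto simp: hom_def)

lemma \<phi>_mult:
  "\<lbrakk>i \<in> carrier I; j \<in> carrier I; i \<sqsubseteq> j; x \<in> carrier (H i); y \<in> carrier (H i)\<rbrakk>
    \<Longrightarrow> \<phi> i j (x \<otimes>\<^bsub>H i\<^esub> y) = \<phi> i j x \<otimes>\<^bsub>H j\<^esub> \<phi> i j y"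
  using hom_\<phi> by (auto simp: hom_def)

lemma \<phi>_one: "\<lbrakk>i \<in> carrier I; j \<in> carrier I; i \<sqsubseteq> j\<rbrakk> \<Longrightarrow> \<phi> i j \<one>\<^bsub>H i\<^esub> = \<one>\<^bsub>H j\<^esub>"
  using hom_one[OF hom_\<phi>] group_H by blast

lemma equiv_eventually_equal:
  "equiv (SIGMA i:carrier I. carrier (H i)) (eventually_equal I H \<phi>)"
proof (rule equivI)
  show "eventually_equal I H \<phi> \<subseteq> (SIGMA i:carrier I. carrier (H i)) \<times> (SIGMA i:carrier I. carrier (H i))"
    by (auto simp: eventually_equal_def)
  show "refl_on (SIGMA i:carrier I. carrier (H i)) (eventually_equal I H \<phi>)"
    by (auto simp: eventually_equal_def refl_on_def)
  show "sym (eventually_equal I H \<phi>)"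
    by (auto simp: eventually_equal_def sym_def)
  show "trans (eventually_equal I H \<phi>)"
  proof (rule transI)
    fix p q r assume "(p, q) \<in> eventually_equal I H \<phi>" "(q, r) \<in> eventually_equal I H \<phi>"
    then obtain i x j y l z k m where
      *: "p = (i, x)" "q = (j, y)" "r = (l, z)" "i \<in> carrier I" "j \<in> carrier I" "l \<in> carrier I"
        "x \<in> carrier (H i)" "y \<in> carrier (H j)" "z \<in> carrier (H l)"
        "k \<in> carrier I" "i \<sqsubseteq> k" "j \<sqsubseteq> k" "\<phi> i k x = \<phi> j k y"
        "m \<in> carrier I" "j \<sqsubseteq> m" "l \<sqsubseteq> m" "\<phi> j m y = \<phi> l m z"
      by (auto simp: eventually_equal_def)
    obtain n where n: "n \<in> carrier I" "k \<sqsubseteq> n" "m \<sqsubseteq> n"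
      using directed * by blast
    have le: "i \<sqsubseteq> n" "l \<sqsubseteq> n"
      using le_trans[of i k n] le_trans[of l m n] * n by auto
    have "\<phi> i n x = \<phi> k n (\<phi> j k y)"
      using \<phi>_comp[of i k n x] * n by simp
    also have "\<dots> = \<phi> m n (\<phi> j m y)"
      using \<phi>_comp[of j k n y] \<phi>_comp[of j m n y] * n by simp
    also have "\<dots> = \<phi> l n z"
      using \<phi>_comp[of l m n z] * n by simp
    finally show "(p, r) \<in> eventually_equal I H \<phi>"
      using * n le by (auto simp: eventually_equal_def)
  qed
qed

lemma cls_eq_iff:
  assumes "i \<in> carrier I" "x \<in> carrier (H i)" "j \<in> carrier I" "y \<in> carrier (H j)"
  shows "cls i x = cls j y \<longleftrightarrow> (\<exists>k\<in>carrier I. i \<sqsubseteq> k \<and> j \<sqsubseteq> k \<and> \<phi> i k x = \<phi> j k y)"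
  using eq_equiv_class_iff[OF equiv_eventually_equal, of "(i, x)" "(j, y)"] assms
  by (auto simp: eventually_equal_def)

lemma cls_\<phi>:
  assumes "i \<in> carrier I" "j \<in> carrier I" "i \<sqsubseteq> j" "x \<in> carrier (H i)"
  shows "cls j (\<phi> i j x) = cls i x"
  using assms \<phi>_id[of j "\<phi> i j x"] \<phi>_closed[of i j x]
  by (subst cls_eq_iff) (auto intro!: bexI[of _ j])

lemma cls_closed:
  "\<lbrakk>i \<in> carrier I; x \<in> carrier (H i)\<rbrakk> \<Longrightarrow> cls i x \<in> carrier (direct_limit I H \<phi>)"
  by (auto simp: direct_limit_def intro!: quotientI)

lemma in_cls_self: "\<lbrakk>i \<in> carrier I; x \<in> carrier (H i)\<rbrakk> \<Longrightarrow> (i, x) \<in> cls i x"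
  by (auto simp: eventually_equal_def)

lemma in_clsD:
  "(j, y) \<in> cls i x \<Longrightarrow> j \<in> carrier I \<and> y \<in> carrier (H j) \<and> cls j y = cls i x"
  using equiv_class_eq[OF equiv_eventually_equal, of "(i, x)" "(j, y)"]
  by (auto simp: eventually_equal_def)

lemma Image_same:
  assumes "\<And>p. p \<in> A \<Longrightarrow> r `` {p} = C" "A \<noteq> {}"
  shows "r `` A = C"
  using assms by blast

lemma one_direct_limit: "i \<in> carrier I \<Longrightarrow> \<one>\<^bsub>direct_limit I H \<phi>\<^esub> = cls i \<one>\<^bsub>H i\<^esub>"
proof -
  assume i: "i \<in> carrier I"
  have "cls j \<one>\<^bsub>H j\<^esub> = cls i \<one>\<^bsub>H i\<^esub>" if j: "j \<in> carrier I" for j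
  proof -
    obtain k where "k \<in> carrier I" "i \<sqsubseteq> k" "j \<sqsubseteq> k" using directed i j by blast
    then show ?thesis
      using cls_\<phi>[of i k] cls_\<phi>[of j k] \<phi>_one i j group_H
      by (metis group.is_monoid monoid.one_closed)
  qed
  then have "eventually_equal I H \<phi> `` {p} = cls i \<one>\<^bsub>H i\<^esub>"
    if "p \<in> {(i, \<one>\<^bsub>H i\<^esub>) | i. i \<in> carrier I}" for p
    using that by blast
  moreover have "{(i, \<one>\<^bsub>H i\<^esub>) | i. i \<in> carrier I} \<noteq> {}"
    using i by blast
  ultimately show ?thesis
    unfolding direct_limit_def monoid.simps by (rule Image_same)
qed

lemma mult_direct_limit:
  assumes "i \<in> carrier I" "x \<in> carrier (H i)" "y \<in> carrier (H i)"
  shows "cls i x \<otimes>\<^bsub>direct_limit I H \<phi>\<^esub> cls i y = cls i (x \<otimes>\<^bsub>H i\<^esub> y)"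
proof -
  have *: "cls k (\<phi> j k u \<otimes>\<^bsub>H k\<^esub> \<phi> l k v) = cls i (x \<otimes>\<^bsub>H i\<^esub> y)"
    if u: "(j, u) \<in> cls i x" and v: "(l, v) \<in> cls i y"
      and k: "k \<in> carrier I" "j \<sqsubseteq> k" "l \<sqsubseteq> k" for j u l v k
  proof -
    note u' = in_clsD[OF u] and v' = in_clsD[OF v]
    note c = \<phi>_closed[of j k u] \<phi>_closed[of l k v]
    have "cls k (\<phi> j k u) = cls i x" "cls k (\<phi> l k v) = cls i y"
      using cls_\<phi>[of j k u] cls_\<phi>[of l k v] u' v' k by auto
    then obtain m n where m: "m \<in> carrier I" "k \<sqsubseteq> m" "i \<sqsubseteq> m" "\<phi> k m (\<phi> j k u) = \<phi> i m x"
        and n: "n \<in> carrier I" "k \<sqsubseteq> n" "i \<sqsubseteq> n" "\<phi> k n (\<phi> l k v) = \<phi> i n y"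
      using c u' v' k assms by (auto simp: cls_eq_iff)
    obtain p where p: "p \<in> carrier I" "m \<sqsubseteq> p" "n \<sqsubseteq> p" using directed m n by blast
    have le: "k \<sqsubseteq> p" "i \<sqsubseteq> p"
      using le_trans[of k m p] le_trans[of i m p] m n p k assms by auto
    have "\<phi> k p (\<phi> j k u) = \<phi> i p x"
      using \<phi>_comp[of k m p "\<phi> j k u"] \<phi>_comp[of i m p x] c u' k m p assms by simp
    moreover have "\<phi> k p (\<phi> l k v) = \<phi> i p y"
      using \<phi>_comp[of k n p "\<phi> l k v"] \<phi>_comp[of i n p y] c v' k n p assms by simp
    moreover have cl: "\<phi> j k u \<otimes>\<^bsub>H k\<^esub> \<phi> l k v \<in> carrier (H k)" "x \<otimes>\<^bsub>H i\<^esub> y \<in> carrier (H i)"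
      using c u' v' k assms group_H by (auto intro!: monoid.m_closed group.is_monoid)
    ultimately show ?thesis
      using le p k c u' v' assms
      by (subst cls_eq_iff) (auto intro!: bexI[of _ p] simp: \<phi>_mult)
  qed
  show ?thesis
    unfolding direct_limit_def monoid.simps
  proof (rule Image_same)
    show "{(k, \<phi> j k u \<otimes>\<^bsub>H k\<^esub> \<phi> l k v) | j u l v k.
          (j, u) \<in> cls i x \<and> (l, v) \<in> cls i y \<and> k \<in> carrier I \<and> j \<sqsubseteq> k \<and> l \<sqsubseteq> k} \<noteq> {}"
      using in_cls_self[of i x] in_cls_self[of i y] assms le_refl[of i] by blast
  next
    fix p
    assume "p \<in> {(k, \<phi> j k u \<otimes>\<^bsub>H k\<^esub> \<phi> l k v) | j u l v k.
        (j, u) \<in> cls i x \<and> (l, v) \<in> cls i y \<and> k \<in> carrier I \<and> j \<sqsubseteq> k \<and> l \<sqsubseteq> k}"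
    then obtain j u l v k where "p = (k, \<phi> j k u \<otimes>\<^bsub>H k\<^esub> \<phi> l k v)"
      "(j, u) \<in> cls i x" "(l, v) \<in> cls i y" "k \<in> carrier I" "j \<sqsubseteq> k" "l \<sqsubseteq> k"
      by blast
    then show "eventually_equal I H \<phi> `` {p} = cls i (x \<otimes>\<^bsub>H i\<^esub> y)"
      using * by metis
  qed
qed

lemma carrier_direct_limitE:
  assumes "P \<in> carrier (direct_limit I H \<phi>)"
  obtains i x where "i \<in> carrier I" "x \<in> carrier (H i)" "P = cls i x"
  using assms by (auto simp: direct_limit_def quotient_def)

lemma carrier_direct_limit_above:
  assumes "P \<in> carrier (direct_limit I H \<phi>)" "i \<in> carrier I"
  obtains j where "j \<in> carrier I" "i \<sqsubseteq> j"
    "\<And>k. k \<in> carrier I \<Longrightarrow> j \<sqsubseteq> k \<Longrightarrow> \<exists>x\<in>carrier (H k). P = cls k x"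
proof -
  obtain l x where l: "l \<in> carrier I" "x \<in> carrier (H l)" "P = cls l x"
    using assms(1) by (rule carrier_direct_limitE)
  obtain j where j: "j \<in> carrier I" "i \<sqsubseteq> j" "l \<sqsubseteq> j" using directed l assms by blast
  have "\<exists>x\<in>carrier (H k). P = cls k x" if "k \<in> carrier I" "j \<sqsubseteq> k" for k
    using cls_\<phi>[of l k x] \<phi>_closed[of l k x] le_trans[of l j k] l j that by auto
  with j that show ?thesis by blast
qed

lemma common_index:
  assumes "P \<in> carrier (direct_limit I H \<phi>)" "Q \<in> carrier (direct_limit I H \<phi>)"
    "R \<in> carrier (direct_limit I H \<phi>)"
  obtains i x y z where "i \<in> carrier I" "x \<in> carrier (H i)" "y \<in> carrier (H i)"
    "z \<in> carrier (H i)" "P = cls i x" "Q = cls i y" "R = cls i z"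
proof -
  obtain i0 where i0: "i0 \<in> carrier I" using nonempty by blast
  obtain i where i: "i \<in> carrier I"
    "\<And>k. k \<in> carrier I \<Longrightarrow> i \<sqsubseteq> k \<Longrightarrow> \<exists>x\<in>carrier (H k). P = cls k x"
    using carrier_direct_limit_above[OF assms(1) i0] by metis
  obtain j where j: "j \<in> carrier I" "i \<sqsubseteq> j"
    "\<And>k. k \<in> carrier I \<Longrightarrow> j \<sqsubseteq> k \<Longrightarrow> \<exists>x\<in>carrier (H k). Q = cls k x"
    using carrier_direct_limit_above[OF assms(2) i(1)] by metis
  obtain k where k: "k \<in> carrier I" "j \<sqsubseteq> k"
    "\<And>m. m \<in> carrier I \<Longrightarrow> k \<sqsubseteq> m \<Longrightarrow> \<exists>x\<in>carrier (H m). R = cls m x"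
    using carrier_direct_limit_above[OF assms(3) j(1)] by metis
  have "i \<sqsubseteq> k" using le_trans[of i j k] i j k by auto
  then show ?thesis
    using that i(2)[of k] j(3)[of k] k(3)[of k] k by blast
qed

lemma group_direct_limit: "group (direct_limit I H \<phi>)"
proof (rule groupI)
  obtain i0 where i0: "i0 \<in> carrier I" using nonempty by blast
  show "\<one>\<^bsub>direct_limit I H \<phi>\<^esub> \<in> carrier (direct_limit I H \<phi>)"
    using one_direct_limit[OF i0] cls_closed[OF i0] group_H[OF i0]
    by (simp add: group.is_monoid monoid.one_closed)
next
  fix P Q assume PQ: "P \<in> carrier (direct_limit I H \<phi>)" "Q \<in> carrier (direct_limit I H \<phi>)"
  then obtain i x y where "i \<in> carrier I" "x \<in> carrier (H i)" "y \<in> carrier (H i)"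
    "P = cls i x" "Q = cls i y"
    using common_index[OF PQ PQ(1)] by metis
  then show "P \<otimes>\<^bsub>direct_limit I H \<phi>\<^esub> Q \<in> carrier (direct_limit I H \<phi>)"
    using group_H by (simp add: mult_direct_limit cls_closed group.is_monoid monoid.m_closed)
next
  fix P Q R assume PQR: "P \<in> carrier (direct_limit I H \<phi>)" "Q \<in> carrier (direct_limit I H \<phi>)"
    "R \<in> carrier (direct_limit I H \<phi>)"
  then obtain i x y z where "i \<in> carrier I" "x \<in> carrier (H i)" "y \<in> carrier (H i)"
    "z \<in> carrier (H i)" "P = cls i x" "Q = cls i y" "R = cls i z"
    using common_index[OF PQR] by metis
  then show "P \<otimes>\<^bsub>direct_limit I H \<phi>\<^esub> Q \<otimes>\<^bsub>direct_limit I H \<phi>\<^esub> R =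
      P \<otimes>\<^bsub>direct_limit I H \<phi>\<^esub> (Q \<otimes>\<^bsub>direct_limit I H \<phi>\<^esub> R)"
    using group_H by (simp add: mult_direct_limit group.is_monoid monoid.m_closed monoid.m_assoc)
next
  fix P assume "P \<in> carrier (direct_limit I H \<phi>)"
  then obtain i x where i: "i \<in> carrier I" "x \<in> carrier (H i)" "P = cls i x"
    by (rule carrier_direct_limitE)
  then interpret Hi: group "H i" by (simp add: group_H)
  show "\<one>\<^bsub>direct_limit I H \<phi>\<^esub> \<otimes>\<^bsub>direct_limit I H \<phi>\<^esub> P = P"
    using i by (simp add: one_direct_limit mult_direct_limit)
  show "\<exists>Q\<in>carrier (direct_limit I H \<phi>). Q \<otimes>\<^bsub>direct_limit I H \<phi>\<^esub> P = \<one>\<^bsub>direct_limit I H \<phi>\<^esub>"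
    using i by (intro bexI[of _ "cls i (inv\<^bsub>H i\<^esub> x)"])
      (simp_all add: one_direct_limit mult_direct_limit cls_closed)
qed

end

text \<open>HOL cannot quantify existentially over types, so the carriers below have to be found in fixed
  types. The type \<^typ>\<open>nat set\<close> has the cardinality of the continuum, hence at least
  \<open>\<aleph>\<^sub>1\<close>, and this is no loss of generality: in any directed system whose limit has
  a semilattice of finitely generated normal subgroups of size at most \<open>\<aleph>\<^sub>1\<close>, a
  Loewenheim-Skolem argument gives a directed subsystem of at most \<open>\<aleph>\<^sub>1\<close> finite
  groups whose limit has the same semilattice. Each member of the class is a finite group and hence
  has an isomorphic copy in the type of the products themselves.\<close>

definition direct_limit_of_alternating_products :: "(nat set) monoid \<Rightarrow> bool" where
  "direct_limit_of_alternating_products G \<longleftrightarrow>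
    group G \<and>
    (\<exists>(I :: nat set gorder) (H :: nat set \<Rightarrow> (nat \<Rightarrow> nat \<Rightarrow> nat) monoid) \<phi>.
       directed_group_system I H \<phi> \<and> (\<forall>i\<in>carrier I. H i \<in> alternating_products) \<and>
       G \<cong> direct_limit I H \<phi>)"

end

theory Submission
  imports Defs "HOL-Algebra.Weak_Morphisms" "HOL-Library.Countable_Set_Type"
begin

text \<open>Let \<open>S\<close> be the given semilattice. An \<open>S\<close>-valued norm on a group is a map \<open>\<nu>\<close> for which all the
  sets \<open>{x. \<nu> x \<sqsubseteq> a}\<close> are normal subgroups and only the neutral element has norm \<open>\<bottom>\<close>. The
  theorem follows from the existence of a group with a surjective norm such that
  \<open>\<nu> z \<sqsubseteq> \<nu> x \<squnion> \<nu> y\<close> already forces \<open>z\<close> into the normal closure of \<open>{x, y}\<close>, and such that every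
  finite subset lies in a finite product of alternating groups (such groups are called saturated
  below): then \<open>a \<mapsto> {x. \<nu> x \<sqsubseteq> a}\<close> is an isomorphism onto the finitely generated normal subgroups
  (\<open>NSubc_iso_of_saturated\<close>), and the group is the direct limit of its finite subgroups from the
  class (\<open>direct_limit_of_locally_alternating\<close>).

  The basic normed groups are the products \<open>Q\<close> of alternating groups of degree at least 8 in
  which each factor carries a nonzero label from \<open>S\<close>; the norm of an element is the join of the
  labels over its support. As the factors are simple and not abelian, an element lies in a
  normal subgroup \<open>N\<close> of \<open>Q\<close> as soon as its support is covered by supports of elements of \<open>N\<close>.

  The heart of the proof is that two finite normed groups \<open>P1\<close> and \<open>P2\<close> over a common \<open>P0\<close> embed
  into one such product, compatibly with the norms and with \<open>P0\<close> (\<open>normed_amalgamation\<close>). Let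
  \<open>V\<close> be the finite set of all norms involved. By distributivity, there are labels \<open>t X\<close>, for
  the complements \<open>X\<close> in \<open>V\<close> of ideals of \<open>S\<close>, such that each \<open>v \<in> V\<close> is the join of the \<open>t X\<close>
  with \<open>v \<in> X\<close> (\<open>ideal_complement_labels\<close>). For a fixed \<open>X\<close> the elements whose norm is not in
  \<open>X\<close> form normal subgroups of \<open>P1\<close> and \<open>P2\<close> that meet \<open>P0\<close> in the same subgroup. The two
  quotients act by left translation on suitable finite sets, and these can be identified so that
  the actions agree on \<open>P0\<close>; this amalgamates the quotients in one alternating group. Taking the
  product over all \<open>X\<close> with \<open>t X \<noteq> \<bottom>\<close>, an element of norm \<open>v\<close> has nontrivial component exactly
  in the factors with \<open>v \<in> X\<close>, so its norm in the product is again \<open>v\<close>. Moreover an inequality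
  between norms becomes an inclusion between supports, so that the required membership in a
  normal closure holds in the product.

  A countable saturated group is the union of an increasing sequence of finite subgroups \<open>P n\<close>.
  Forming \<open>Q (n + 1)\<close> as an amalgam of \<open>P (n + 1)\<close> and \<open>Q n\<close> over \<open>P n\<close> yields a sequence whose
  union is a larger countable saturated group which has any prescribed element of \<open>S\<close> among its
  norms (\<open>saturated_extension\<close>). Finally, \<open>S\<close> has a well-order in which proper initial segments
  are countable. A maximal chain of saturated groups that take on values along this well-order
  has a saturated union, and the union must take on every value: if not, it would be countable
  and could be extended (\<open>saturated_onto\<close>). The bound \<open>\<aleph>\<^sub>1\<close> is used here: amalgamating two
  groups at a time is enough because all the intermediate groups are countable.\<close>

section \<open>Normal subgroups of alternating groups\<close>

lemma three_cycle_in_alt_group: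
  assumes "distinct [a, b, c]" "{a, b, c} \<subseteq> {1..n}"
  shows "cycle_of_list [a, b, c] \<in> carrier (alt_group n)"
  using three_cycles_incl[of n] assms by fastforce

lemma three_cycle_apply:
  assumes "distinct [a, b, c]"
  shows "cycle_of_list [a, b, c] x = (if x = a then b else if x = b then c else if x = c then a else x)"
  using assms by (auto simp: transpose_def)

lemma ex_two_outside:
  assumes "finite A" "card A + 2 \<le> n"
  obtains u v where "u \<in> {1..n} - A" "v \<in> {1..n} - A" "u \<noteq> (v::nat)"
proof -
  have "2 \<le> card ({1..n} - A)"
    using diff_card_le_card_Diff[of A "{1..n}"] assms by simp
  then obtain T where "T \<subseteq> {1..n} - A" "card T = 2"
    using obtain_subset_with_card_n by metis
  then show ?thesis
    using that by (auto simp: card_2_iff)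
qed

text \<open>If \<open>g\<close> moves \<open>x\<close>, then a 3-cycle that contains \<open>g x\<close> but not \<open>x\<close> does not commute with \<open>g\<close>.\<close>

lemma alt_group_noncommuting_three_cycle:
  assumes "5 \<le> n" "g \<in> carrier (alt_group n)" "g \<noteq> id"
  obtains a b c where "distinct [a, b, c]" "{a, b, c} \<subseteq> {1..n}"
    "g \<circ> cycle_of_list [a, b, c] \<noteq> cycle_of_list [a, b, c] \<circ> g"
proof -
  have g: "g permutes {1..n}"
    using assms by (simp add: alt_group_carrier)
  obtain x where x: "g x \<noteq> x" using assms(3) by (auto simp: fun_eq_iff)
  then have x': "x \<in> {1..n}" "g x \<in> {1..n}"
    using g by (auto simp: permutes_def permutes_in_image[OF g])
  obtain u v where uv: "u \<in> {1..n} - {x, g x}" "v \<in> {1..n} - {x, g x}" "u \<noteq> v"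
    by (rule ex_two_outside[of "{x, g x}" n]) (use x assms(1) in auto)
  have "(g \<circ> cycle_of_list [g x, u, v]) x \<noteq> (cycle_of_list [g x, u, v] \<circ> g) x"
    using x uv by (auto simp: transpose_def)
  then show ?thesis
    using that[of "g x" u v] uv x' by (metis Diff_iff distinct_length_2_or_more distinct_singleton insert_iff insert_subset empty_subsetI)
qed

lemma (in group) commutator_in_normal:
  assumes "N \<lhd> G" "x \<in> N" "c \<in> carrier G"
  shows "x \<otimes> c \<otimes> inv x \<otimes> inv c \<in> N"
proof -
  interpret N: normal N G by fact
  have x: "x \<in> carrier G" using assms(2) by (rule N.mem_carrier)
  have "c \<otimes> inv x \<otimes> inv c \<in> N"
    using assms N.inv_op_closed2 by simp
  then have "x \<otimes> (c \<otimes> inv x \<otimes> inv c) \<in> N"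
    using assms by simp
  then show ?thesis using x assms by (simp add: m_assoc)
qed

text \<open>If \<open>g\<close> moves \<open>x\<close> and fixes \<open>y\<close> and \<open>z\<close>, then the commutator of \<open>g\<close> with the cycle
  \<open>(x y z)\<close> is the cycle \<open>(x g(x) y)\<close>.\<close>

lemma three_cycle_from_two_fixed_points:
  assumes N: "N \<lhd> alt_group n" and g: "g \<in> N" "g x \<noteq> x" "g y = y" "g z = z"
    and yz: "y \<noteq> z" "y \<in> {1..n}" "z \<in> {1..n}"
  shows "cycle_of_list [x, g x, y] \<in> N"
proof -
  interpret A: group "alt_group n" by (rule alt_group_is_group)
  interpret N: normal N "alt_group n" by fact
  have gA: "g \<in> carrier (alt_group n)" using g(1) by (rule N.mem_carrier)
  then have gp: "g permutes {1..n}" by (simp add: alt_group_carrier)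
  have x: "x \<in> {1..n}" using g(2) gp by (auto simp: permutes_def)
  have d: "distinct [x, y, z]" using g yz by auto
  have dg: "g x \<noteq> y" "g x \<noteq> z"
    using g gp by (metis permutes_inj injD)+
  define c where "c = cycle_of_list [x, y, z]"
  have c: "c \<in> carrier (alt_group n)"
    unfolding c_def using three_cycle_in_alt_group[OF d] x yz by simp
  have cinv: "inv\<^bsub>alt_group n\<^esub> c = cycle_of_list [z, y, x]"
  proof (rule A.inv_equality)
    show "cycle_of_list [z, y, x] \<in> carrier (alt_group n)"
      by (rule three_cycle_in_alt_group) (use d x yz in auto)
    show "cycle_of_list [z, y, x] \<otimes>\<^bsub>alt_group n\<^esub> c = \<one>\<^bsub>alt_group n\<^esub>"
      unfolding c_def alt_group_mult alt_group_one
      by (rule ext) (use d in \<open>simp add: three_cycle_apply del: cycle_of_list.simps\<close>)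
  qed (use c in auto)
  have conj: "g \<circ> c \<circ> inv' g = cycle_of_list [g x, y, z]"
    using conjugation_of_cycle[OF d permutes_bij[OF gp]] g unfolding c_def by simp
  have "g \<otimes>\<^bsub>alt_group n\<^esub> c \<otimes>\<^bsub>alt_group n\<^esub> inv\<^bsub>alt_group n\<^esub> g \<otimes>\<^bsub>alt_group n\<^esub> inv\<^bsub>alt_group n\<^esub> c
      = cycle_of_list [g x, y, z] \<circ> cycle_of_list [z, y, x]"
    using conj by (simp only: alt_group_mult alt_group_inv_equality[OF gA] cinv)
  also have "\<dots> = cycle_of_list [x, g x, y]"
    by (rule ext) (use d dg g in \<open>simp add: three_cycle_apply del: cycle_of_list.simps\<close>)
  finally show ?thesis
    using A.commutator_in_normal[OF N g(1) c] by simp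
qed

lemma ex_permutation_of_triples:
  assumes d: "distinct [a, b, c]" "distinct [a', b', c']"
    and A: "{a, b, c} \<subseteq> A" "{a', b', c'} \<subseteq> A"
  obtains s where "s permutes A" "s a = a'" "s b = b'" "s c = c'"
proof -
  define s1 where "s1 = transpose a a'"
  define s2 where "s2 = transpose (s1 b) b' \<circ> s1"
  define s3 where "s3 = transpose (s2 c) c' \<circ> s2"
  have s1: "s1 permutes A" "s1 a = a'"
    using A by (auto simp: s1_def permutes_swap_id)
  have b: "s1 b \<in> A" "s1 b \<noteq> a'"
    using A d s1 permutes_in_image[OF s1(1)] injD[OF permutes_inj[OF s1(1)], of a b] by auto
  have s2: "s2 permutes A" "s2 a = a'" "s2 b = b'"
    using A s1 b d unfolding s2_def
    by (auto intro!: permutes_compose permutes_swap_id simp: transpose_def)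
  have c: "s2 c \<in> A" "s2 c \<noteq> a'" "s2 c \<noteq> b'"
    using A d s2 permutes_in_image[OF s2(1)] injD[OF permutes_inj[OF s2(1)], of a c]
      injD[OF permutes_inj[OF s2(1)], of b c] by auto
  have s3: "s3 permutes A" "s3 a = a'" "s3 b = b'" "s3 c = c'"
    using A s2 c d unfolding s3_def
    by (auto intro!: permutes_compose permutes_swap_id simp: transpose_def)
  then show ?thesis by (rule that)
qed

lemma ex_even_permutation_of_triples:
  assumes d: "distinct [a, b, c]" "distinct [a', b', c']"
    and n: "{a, b, c} \<subseteq> {1..n}" "{a', b', c'} \<subseteq> {1..n}" "5 \<le> n"
  obtains s where "s \<in> carrier (alt_group n)" "s a = a'" "s b = b'" "s c = c'"
proof -
  obtain s3 where s3: "s3 permutes {1..n}" "s3 a = a'" "s3 b = b'" "s3 c = c'"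
    using ex_permutation_of_triples[OF d n(1,2)] .
  obtain u v where uv: "u \<in> {1..n} - {a, b, c}" "v \<in> {1..n} - {a, b, c}" "u \<noteq> v"
    by (rule ex_two_outside[of "{a, b, c}" n]) (use d n(3) in auto)
  show ?thesis
  proof (cases "evenperm s3")
    case True
    then show ?thesis using that[of s3] s3 by (simp add: alt_group_carrier)
  next
    \<comment> \<open>A transposition away from the triple corrects the sign.\<close>
    case False
    define s where "s = s3 \<circ> transpose u v"
    have "s permutes {1..n}"
      unfolding s_def using uv s3 by (intro permutes_compose permutes_swap_id) auto
    moreover have "evenperm s"
      using False s3 uv unfolding s_def
      by (subst evenperm_comp)
        (auto simp: evenperm_swap permutation_swap_id intro: permutes_imp_permutation)
    moreover have "s a = a'" "s b = b'" "s c = c'"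
      using uv s3(2-4) unfolding s_def by (metis Diff_iff comp_apply insertCI transpose_apply_other)+
    ultimately show ?thesis
      using that[of s] by (simp add: alt_group_carrier)
  qed
qed

text \<open>The commutator of \<open>g\<close> with a 3-cycle is a product of two 3-cycles and thus moves at most six
  points. The bound 8 on the degree leaves two fixed points, from which a 3-cycle is obtained by
  one more commutator. All 3-cycles are conjugate and they generate the group.\<close>

lemma normal_alt_group_eq_carrier:
  assumes n: "8 \<le> n" and N: "N \<lhd> alt_group n" and g: "g \<in> N" "g \<noteq> id"
  shows "N = carrier (alt_group n)"
proof -
  interpret A: group "alt_group n" by (rule alt_group_is_group)
  interpret N: normal N "alt_group n" by fact
  have gA: "g \<in> carrier (alt_group n)" using g(1) by (rule N.mem_carrier)
  then have gp: "g permutes {1..n}" by (simp add: alt_group_carrier)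
  obtain a b c where abc: "distinct [a, b, c]" "{a, b, c} \<subseteq> {1..n}"
    "g \<circ> cycle_of_list [a, b, c] \<noteq> cycle_of_list [a, b, c] \<circ> g"
    using alt_group_noncommuting_three_cycle[OF _ gA g(2)] n by auto
  define s where "s = cycle_of_list [a, b, c]"
  have s: "s \<in> carrier (alt_group n)"
    unfolding s_def using three_cycle_in_alt_group abc by blast
  define h where "h = g \<circ> s \<circ> inv' g \<circ> inv' s"
  have h: "h \<in> N"
    using A.commutator_in_normal[OF N g(1) s]
    by (simp add: h_def alt_group_mult alt_group_inv_equality gA s)
  have h': "h = cycle_of_list [g a, g b, g c] \<circ> inv' s"
    unfolding h_def using conjugation_of_cycle[OF abc(1) permutes_bij[OF gp]]
    by (simp add: s_def)
  have "h \<noteq> id"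
  proof
    assume "h = id"
    then have "h \<circ> s \<circ> g = s \<circ> g" by simp
    moreover have "inv' s \<circ> s = id" "inv' g \<circ> g = id"
      using s gp permutes_inv_o by (auto simp: alt_group_carrier)
    then have "h \<circ> s \<circ> g = g \<circ> s"
      unfolding h_def by (metis comp_assoc comp_id)
    ultimately show False using abc(3) by (simp add: s_def)
  qed
  then obtain x where x: "h x \<noteq> x" by (auto simp: fun_eq_iff)
  have hfix: "h y = y" if "y \<notin> {a, b, c, g a, g b, g c}" for y
  proof -
    have "s y = y" using that id_outside_supp[of y "[a, b, c]"] by (simp add: s_def)
    then have "inv' s y = y"
      using s by (metis alt_group_carrier permutes_inverses(2))
    then show ?thesis
      using that id_outside_supp[of y "[g a, g b, g c]"] unfolding h' by simp
  qed
  \<comment> \<open>The commutator \<open>h\<close> is the product of the 3-cycles on \<open>g a, g b, g c\<close> and on \<open>a, b, c\<close>.\<close>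
  have "card {a, b, c, g a, g b, g c} + 2 \<le> n"
    using card_length[of "[a, b, c, g a, g b, g c]"] n by simp
  then obtain y z where yz: "y \<in> {1..n} - {a, b, c, g a, g b, g c}"
      "z \<in> {1..n} - {a, b, c, g a, g b, g c}" "y \<noteq> z"
    by (metis ex_two_outside finite.emptyI finite_insert)
  have t: "cycle_of_list [x, h x, y] \<in> N"
    using three_cycle_from_two_fixed_points[OF N h x, of y z] hfix yz by auto
  have hp: "h permutes {1..n}" using h N.subset by (auto simp: alt_group_carrier)
  have "x \<in> {1..n}" using x hp by (auto simp: permutes_def)
  moreover have "h x \<in> {1..n}" using permutes_in_image[OF hp] \<open>x \<in> {1..n}\<close> by blast
  moreover have "x \<noteq> y" "h x \<noteq> y"
    using x hfix[of y] yz hp by (auto dest: injD[OF permutes_inj])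
  ultimately have xy: "distinct [x, h x, y]" "{x, h x, y} \<subseteq> {1..n}"
    using x yz by auto
  have "three_cycles n \<subseteq> N"
  proof clarify
    fix cs :: "nat list" assume cs: "cycle cs" "length cs = 3" "set cs \<subseteq> {1..n}"
    obtain p q r where pqr: "cs = [p, q, r]"
      using stupid_lemma[OF cs(2)] by blast
    obtain t where t': "t \<in> carrier (alt_group n)" "t x = p" "t (h x) = q" "t y = r"
      using ex_even_permutation_of_triples[OF xy(1) _ xy(2), of p q r] cs n unfolding pqr by auto
    have "t \<circ> cycle_of_list [x, h x, y] \<circ> inv' t = cycle_of_list cs"
      using conjugation_of_cycle[OF xy(1), of t] t'(2-4) permutes_bij t'(1)
      unfolding pqr alt_group_carrier by (metis list.simps(8,9))
    then show "cycle_of_list cs \<in> N"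
      using N.inv_op_closed2[OF t'(1) t]
      by (simp add: alt_group_mult alt_group_inv_equality t'(1))
  qed
  then show ?thesis
    using A.generate_subgroup_incl[OF _ N.is_subgroup] N.subset
    unfolding alt_group_carrier_as_three_cycles by blast
qed

section \<open>Joins over complements of ideals\<close>

context distributive_semilattice0
begin

text \<open>Joining with \<open>\<bottom>\<close> makes the join of the empty set equal to \<open>\<bottom>\<close>.\<close>

definition fjoin :: "'a set \<Rightarrow> 'a" where
  "fjoin A = \<Squnion> (insert \<bottom> A)"

lemma fjoin_least:
  assumes "finite A" "A \<subseteq> carrier S"
  shows "least S (fjoin A) (Upper S (insert \<bottom> A))"
  unfolding fjoin_def using assms by (intro finite_sup_least) auto

lemma fjoin_closed [simp]: "finite A \<Longrightarrow> A \<subseteq> carrier S \<Longrightarrow> fjoin A \<in> carrier S"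
  using fjoin_least least_closed by blast

lemma fjoin_le_iff:
  assumes "finite A" "A \<subseteq> carrier S" "b \<in> carrier S"
  shows "fjoin A \<sqsubseteq> b \<longleftrightarrow> (\<forall>a\<in>A. a \<sqsubseteq> b)"
proof
  assume "fjoin A \<sqsubseteq> b"
  then show "\<forall>a\<in>A. a \<sqsubseteq> b"
    using least_Upper_above[OF fjoin_least[OF assms(1,2)]] assms
    by (meson bottom_closed fjoin_closed insert_subset le_trans subsetD subset_insertI)
next
  assume "\<forall>a\<in>A. a \<sqsubseteq> b"
  then show "fjoin A \<sqsubseteq> b"
    using assms bottom_lower by (intro least_le[OF fjoin_least]) (auto intro!: Upper_memI)
qed

lemma join_le_iff:
  assumes "a \<in> carrier S" "b \<in> carrier S" "c \<in> carrier S"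
  shows "a \<squnion> b \<sqsubseteq> c \<longleftrightarrow> a \<sqsubseteq> c \<and> b \<sqsubseteq> c"
  using assms by (meson join_closed join_le join_left join_right le_trans)

lemma eq_if_same_upper_bounds:
  assumes "a \<in> carrier S" "b \<in> carrier S" "\<And>c. c \<in> carrier S \<Longrightarrow> a \<sqsubseteq> c \<longleftrightarrow> b \<sqsubseteq> c"
  shows "a = b"
  using assms by (meson le_antisym le_refl)

lemma le_fjoin: "finite A \<Longrightarrow> A \<subseteq> carrier S \<Longrightarrow> a \<in> A \<Longrightarrow> a \<sqsubseteq> fjoin A"
  using fjoin_le_iff[of A "fjoin A"] by auto

lemma fjoin_doubleton: "a \<in> carrier S \<Longrightarrow> b \<in> carrier S \<Longrightarrow> fjoin {a, b} = a \<squnion> b"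
  by (rule eq_if_same_upper_bounds) (auto simp: fjoin_le_iff join_le_iff)

lemma le_bottom_iff: "a \<in> carrier S \<Longrightarrow> a \<sqsubseteq> \<bottom> \<longleftrightarrow> a = \<bottom>"
  using bottom_lower le_antisym by auto

lemma fjoin_empty [simp]: "fjoin {} = \<bottom>"
  using fjoin_le_iff[of "{}" \<bottom>] by (simp add: le_bottom_iff)

lemma fjoin_insert:
  assumes "finite A" "insert a A \<subseteq> carrier S"
  shows "fjoin (insert a A) = a \<squnion> fjoin A"
  using assms by (intro eq_if_same_upper_bounds) (auto simp: fjoin_le_iff join_le_iff)

lemma fjoin_refinement:
  assumes "finite A" "A \<subseteq> carrier S" "u \<in> carrier S" "u \<sqsubseteq> fjoin A"
  obtains w where "\<And>a. a \<in> A \<Longrightarrow> w a \<in> carrier S" "\<And>a. a \<in> A \<Longrightarrow> w a \<sqsubseteq> a" "u = fjoin (w ` A)"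
proof -
  have "\<exists>w. (\<forall>a\<in>A. w a \<in> carrier S \<and> w a \<sqsubseteq> a) \<and> u = fjoin (w ` A)"
    using assms
  proof (induction A arbitrary: u rule: finite_induct)
    case empty
    then show ?case by (simp add: le_bottom_iff)
  next
    case (insert a A)
    then obtain a' u' where u: "a' \<in> carrier S" "u' \<in> carrier S" "a' \<sqsubseteq> a" "u' \<sqsubseteq> fjoin A"
      "u = a' \<squnion> u'"
      using distributive[of a "fjoin A" u] by (auto simp: fjoin_insert)
    then obtain w where w: "\<forall>a\<in>A. w a \<in> carrier S \<and> w a \<sqsubseteq> a" "u' = fjoin (w ` A)"
      using insert.IH[of u'] insert.prems by blast
    have "(w(a := a')) ` insert a A = insert a' (w ` A)"
      using insert.hyps by auto
    then have "u = fjoin ((w(a := a')) ` insert a A)"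
      using u w insert.hyps by (auto simp: fjoin_insert image_subset_iff)
    then show ?case
      using u w by (intro exI[of _ "w(a := a')"]) auto
  qed
  then show ?thesis using that by blast
qed

text \<open>The condition says that \<open>V - X\<close> is the intersection of \<open>V\<close> with the ideal that it generates in
  the semilattice. The instance \<open>A = {}\<close> excludes \<open>\<bottom>\<close> from \<open>X\<close>.\<close>

definition ideal_complement :: "'a set \<Rightarrow> 'a set \<Rightarrow> bool" where
  "ideal_complement V X \<longleftrightarrow> X \<subseteq> V \<and> (\<forall>x\<in>X. \<forall>A\<subseteq>V. x \<sqsubseteq> fjoin A \<longrightarrow> A \<inter> X \<noteq> {})"

text \<open>If \<open>X0\<close> is not the complement of an ideal, then some \<open>x \<in> X0\<close> is below the join of a set \<open>A\<close>
  disjoint from \<open>X0\<close>. In this case \<open>u\<close> is below that join as well, so it splits into pieces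
  below the elements of \<open>A\<close>, and each piece is treated with the larger set \<open>insert a X0\<close>. As \<open>V\<close>
  is finite, the process ends in complements of ideals. The statement describes \<open>u\<close> as a join by
  its upper bounds.\<close>

lemma ideal_complement_decomposition:
  assumes V: "finite V" "V \<subseteq> carrier S"
    and X0: "X0 \<subseteq> V" "u \<in> carrier S" "\<And>x. x \<in> X0 \<Longrightarrow> u \<sqsubseteq> x"
  shows "\<exists>t. (\<forall>X. t X \<in> carrier S \<and> (ideal_complement V X \<longrightarrow> (\<forall>x\<in>X. t X \<sqsubseteq> x))) \<and>
    (\<forall>b\<in>carrier S. u \<sqsubseteq> b \<longleftrightarrow> (\<forall>X. ideal_complement V X \<longrightarrow> X0 \<subseteq> X \<longrightarrow> t X \<sqsubseteq> b))"
  using X0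
proof (induction "card (V - X0)" arbitrary: X0 u rule: less_induct)
  case less
  show ?case
  proof (cases "ideal_complement V X0")
    case True
    have "\<bottom> \<sqsubseteq> x" if "ideal_complement V X" "x \<in> X" for x X
      using that V bottom_lower by (auto simp: ideal_complement_def)
    then show ?thesis
      using less.prems True bottom_lower
      by (intro exI[of _ "\<lambda>X. if X = X0 then u else \<bottom>"]) auto
  next
    case False
    then obtain x A where A: "x \<in> X0" "A \<subseteq> V" "x \<sqsubseteq> fjoin A" "A \<inter> X0 = {}"
      using less.prems by (auto simp: ideal_complement_def)
    have fA: "finite A" "A \<subseteq> carrier S" using A V by (auto intro: finite_subset)
    have "u \<sqsubseteq> fjoin A"
      using less.prems A fA V le_trans[of u x "fjoin A"] by auto
    then obtain w where w: "\<And>a. a \<in> A \<Longrightarrow> w a \<in> carrier S" "\<And>a. a \<in> A \<Longrightarrow> w a \<sqsubseteq> a"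
      "u = fjoin (w ` A)"
      using fjoin_refinement[OF fA] less.prems by metis
    have fw: "finite (w ` A)" "w ` A \<subseteq> carrier S" using w fA by auto
    have "\<exists>t. (\<forall>X. t X \<in> carrier S \<and> (ideal_complement V X \<longrightarrow> (\<forall>x\<in>X. t X \<sqsubseteq> x))) \<and>
      (\<forall>b\<in>carrier S. w a \<sqsubseteq> b \<longleftrightarrow> (\<forall>X. ideal_complement V X \<longrightarrow> insert a X0 \<subseteq> X \<longrightarrow> t X \<sqsubseteq> b))"
      if a: "a \<in> A" for a
    proof (rule less.hyps)
      show "card (V - insert a X0) < card (V - X0)"
        using a A V by (intro psubset_card_mono) auto
      have "w a \<sqsubseteq> u" using le_fjoin[OF fw] w a by auto
      then show "w a \<sqsubseteq> y" if "y \<in> insert a X0" for y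
        using that w a less.prems V le_trans[of "w a" u y] by blast
    qed (use a w A less.prems in auto)
    then obtain t where t: "\<And>a X. a \<in> A \<Longrightarrow> t a X \<in> carrier S"
      "\<And>a X x. a \<in> A \<Longrightarrow> ideal_complement V X \<Longrightarrow> x \<in> X \<Longrightarrow> t a X \<sqsubseteq> x"
      "\<And>a b. a \<in> A \<Longrightarrow> b \<in> carrier S \<Longrightarrow>
        w a \<sqsubseteq> b \<longleftrightarrow> (\<forall>X. ideal_complement V X \<longrightarrow> insert a X0 \<subseteq> X \<longrightarrow> t a X \<sqsubseteq> b)"
      by metis
    define T where "T X = fjoin ((\<lambda>a. t a X) ` (A \<inter> X))" for X
    have T: "T X \<in> carrier S" "b \<in> carrier S \<Longrightarrow> T X \<sqsubseteq> b \<longleftrightarrow> (\<forall>a\<in>A\<inter>X. t a X \<sqsubseteq> b)" for X b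
      unfolding T_def using t(1) fA by (auto simp: fjoin_le_iff image_subset_iff intro!: fjoin_closed)
    have "u \<sqsubseteq> b \<longleftrightarrow> (\<forall>X. ideal_complement V X \<longrightarrow> X0 \<subseteq> X \<longrightarrow> T X \<sqsubseteq> b)"
      if b: "b \<in> carrier S" for b
    proof -
      have "u \<sqsubseteq> b \<longleftrightarrow> (\<forall>a\<in>A. w a \<sqsubseteq> b)"
        using w(3) fjoin_le_iff[OF fw b] by auto
      also have "\<dots> \<longleftrightarrow> (\<forall>a\<in>A. \<forall>X. ideal_complement V X \<longrightarrow> insert a X0 \<subseteq> X \<longrightarrow> t a X \<sqsubseteq> b)"
        using t(3) b by simp
      also have "\<dots> \<longleftrightarrow> (\<forall>X. ideal_complement V X \<longrightarrow> X0 \<subseteq> X \<longrightarrow> T X \<sqsubseteq> b)"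
        by (auto simp: T(2)[OF b])
      finally show ?thesis .
    qed
    moreover have "T X \<sqsubseteq> y" if "ideal_complement V X" "y \<in> X" for X y
    proof -
      have "y \<in> carrier S" using that V by (auto simp: ideal_complement_def)
      then show ?thesis using T(2)[of y X] t(2) that by auto
    qed
    ultimately show ?thesis
      using T(1) by (intro exI[of _ T]) blast
  qed
qed

text \<open>The decompositions of the single elements of \<open>V\<close> are superimposed. This preserves all the
  equations because in each of them the label of \<open>X\<close> is below every element of \<open>X\<close>.\<close>

lemma ideal_complement_labels:
  assumes V: "finite V" "V \<subseteq> carrier S"
  obtains t where "\<And>X. t X \<in> carrier S"
    "\<And>v b. v \<in> V \<Longrightarrow> b \<in> carrier S \<Longrightarrow>
      v \<sqsubseteq> b \<longleftrightarrow> (\<forall>X. ideal_complement V X \<longrightarrow> v \<in> X \<longrightarrow> t X \<sqsubseteq> b)"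
proof -
  have "\<exists>t. (\<forall>X. t X \<in> carrier S \<and> (ideal_complement V X \<longrightarrow> (\<forall>x\<in>X. t X \<sqsubseteq> x))) \<and>
    (\<forall>b\<in>carrier S. v \<sqsubseteq> b \<longleftrightarrow> (\<forall>X. ideal_complement V X \<longrightarrow> {v} \<subseteq> X \<longrightarrow> t X \<sqsubseteq> b))"
    if "v \<in> V" for v
    by (rule ideal_complement_decomposition) (use V that in auto)
  then obtain t where t: "\<And>v X. v \<in> V \<Longrightarrow> t v X \<in> carrier S"
    "\<And>v X x. v \<in> V \<Longrightarrow> ideal_complement V X \<Longrightarrow> x \<in> X \<Longrightarrow> t v X \<sqsubseteq> x"
    "\<And>v b. v \<in> V \<Longrightarrow> b \<in> carrier S \<Longrightarrow>
      v \<sqsubseteq> b \<longleftrightarrow> (\<forall>X. ideal_complement V X \<longrightarrow> v \<in> X \<longrightarrow> t v X \<sqsubseteq> b)"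
    by (metis empty_subsetI insert_subset)
  define T where "T X = fjoin ((\<lambda>v. t v X) ` V)" for X
  have T: "T X \<in> carrier S" "b \<in> carrier S \<Longrightarrow> T X \<sqsubseteq> b \<longleftrightarrow> (\<forall>v\<in>V. t v X \<sqsubseteq> b)" for X b
    unfolding T_def using t(1) V by (auto simp: fjoin_le_iff image_subset_iff intro!: fjoin_closed)
  have "v \<sqsubseteq> b \<longleftrightarrow> (\<forall>X. ideal_complement V X \<longrightarrow> v \<in> X \<longrightarrow> T X \<sqsubseteq> b)"
    if v: "v \<in> V" and b: "b \<in> carrier S" for v b
  proof
    assume "v \<sqsubseteq> b"
    moreover have "T X \<sqsubseteq> v" if "ideal_complement V X" "v \<in> X" for X
      using that V v by (auto simp: T(2) t(2))
    ultimately show "\<forall>X. ideal_complement V X \<longrightarrow> v \<in> X \<longrightarrow> T X \<sqsubseteq> b"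
      using le_trans[of _ v b] T(1) v b V by auto
  next
    assume "\<forall>X. ideal_complement V X \<longrightarrow> v \<in> X \<longrightarrow> T X \<sqsubseteq> b"
    then show "v \<sqsubseteq> b"
      using v by (auto simp: T(2)[OF b] t(3)[OF v b])
  qed
  then show ?thesis using that T(1) by blast
qed

end

section \<open>Norms with values in a semilattice\<close>

context distributive_semilattice0
begin

text \<open>Equivalently, the sets \<open>{x. \<nu> x \<sqsubseteq> a}\<close> are normal subgroups, and the one for \<open>\<bottom>\<close> is trivial.\<close>

definition normed :: "('g, 'm) monoid_scheme \<Rightarrow> ('g \<Rightarrow> 'a) \<Rightarrow> bool" where
  "normed G \<nu> \<longleftrightarrow> group G \<and> (\<forall>x\<in>carrier G. \<nu> x \<in> carrier S) \<and>
    (\<forall>x\<in>carrier G. \<nu> x = \<bottom> \<longleftrightarrow> x = \<one>\<^bsub>G\<^esub>) \<and>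
    (\<forall>x\<in>carrier G. \<forall>y\<in>carrier G. \<nu> (x \<otimes>\<^bsub>G\<^esub> y) \<sqsubseteq> \<nu> x \<squnion> \<nu> y) \<and>
    (\<forall>x\<in>carrier G. \<nu> (inv\<^bsub>G\<^esub> x) \<sqsubseteq> \<nu> x) \<and>
    (\<forall>x\<in>carrier G. \<forall>y\<in>carrier G. \<nu> (y \<otimes>\<^bsub>G\<^esub> x \<otimes>\<^bsub>G\<^esub> inv\<^bsub>G\<^esub> y) \<sqsubseteq> \<nu> x)"

lemma normedD:
  assumes "normed G \<nu>"
  shows "group G" "\<And>x. x \<in> carrier G \<Longrightarrow> \<nu> x \<in> carrier S"
    "\<And>x. x \<in> carrier G \<Longrightarrow> \<nu> x = \<bottom> \<longleftrightarrow> x = \<one>\<^bsub>G\<^esub>"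
    "\<And>x y. x \<in> carrier G \<Longrightarrow> y \<in> carrier G \<Longrightarrow> \<nu> (x \<otimes>\<^bsub>G\<^esub> y) \<sqsubseteq> \<nu> x \<squnion> \<nu> y"
    "\<And>x. x \<in> carrier G \<Longrightarrow> \<nu> (inv\<^bsub>G\<^esub> x) \<sqsubseteq> \<nu> x"
    "\<And>x y. x \<in> carrier G \<Longrightarrow> y \<in> carrier G \<Longrightarrow> \<nu> (y \<otimes>\<^bsub>G\<^esub> x \<otimes>\<^bsub>G\<^esub> inv\<^bsub>G\<^esub> y) \<sqsubseteq> \<nu> x"
  using assms unfolding normed_def by blast+

lemma normed_one: "normed G \<nu> \<Longrightarrow> \<nu> \<one>\<^bsub>G\<^esub> = \<bottom>"
  using normedD(1,3) group.is_monoid monoid.one_closed by metis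

text \<open>These are the elements with norm in an ideal.\<close>

lemma normal_subgroup_of_ideal_complement:
  assumes G: "normed G \<nu>" and V: "finite V" "V \<subseteq> carrier S" "\<nu> ` carrier G \<subseteq> V"
    and X: "ideal_complement V X"
  shows "{x \<in> carrier G. \<nu> x \<notin> X} \<lhd> G"
proof -
  interpret group G by (rule normedD(1)[OF G])
  have X1: "a \<notin> X" if "a \<sqsubseteq> b" "b \<in> V" "b \<notin> X" for a b
  proof
    assume "a \<in> X"
    then have "a \<in> carrier S" using X V by (auto simp: ideal_complement_def)
    then have "a \<sqsubseteq> fjoin {b}"
      using that V le_trans[of a b "fjoin {b}"] le_fjoin[of "{b}" b] by auto
    then have "{b} \<inter> X \<noteq> {}" using X that \<open>a \<in> X\<close> unfolding ideal_complement_def by blast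
    then show False using that by blast
  qed
  have X2: "a \<notin> X" if "a \<sqsubseteq> b \<squnion> c" "b \<in> V" "b \<notin> X" "c \<in> V" "c \<notin> X" for a b c
  proof
    assume "a \<in> X"
    moreover have "a \<sqsubseteq> fjoin {b, c}" using that V fjoin_doubleton[of b c] by (auto simp: subset_iff)
    ultimately have "{b, c} \<inter> X \<noteq> {}"
      using X that unfolding ideal_complement_def by (metis empty_subsetI insert_subset)
    then show False using that by blast
  qed
  have V': "\<nu> x \<in> V" if "x \<in> carrier G" for x using V that by blast
  have X0: "\<bottom> \<notin> X"
    using X unfolding ideal_complement_def by (metis Int_empty_left bottom_closed empty_subsetI fjoin_empty le_refl)
  have sub: "subgroup {x \<in> carrier G. \<nu> x \<notin> X} G"
  proof (rule subgroupI)
    show "{x \<in> carrier G. \<nu> x \<notin> X} \<noteq> {}"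
      using X0 normed_one[OF G] one_closed by force
    show "inv\<^bsub>G\<^esub> x \<in> {x \<in> carrier G. \<nu> x \<notin> X}" if "x \<in> {x \<in> carrier G. \<nu> x \<notin> X}" for x
      using that X1[OF normedD(5)[OF G]] V' by simp
    show "x \<otimes>\<^bsub>G\<^esub> y \<in> {x \<in> carrier G. \<nu> x \<notin> X}"
      if "x \<in> {x \<in> carrier G. \<nu> x \<notin> X}" "y \<in> {x \<in> carrier G. \<nu> x \<notin> X}" for x y
      using that X2[OF normedD(4)[OF G]] V' by simp
  qed auto
  show ?thesis
    unfolding normal_inv_iff using sub X1[OF normedD(6)[OF G]] V' by simp
qed

text \<open>Norm-preserving homomorphisms are embeddings, as only the neutral element has norm \<open>\<bottom>\<close>.\<close>

lemma normed_hom_inj: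
  assumes "normed G \<nu>" "normed H \<mu>" "f \<in> hom G H" "\<And>x. x \<in> carrier G \<Longrightarrow> \<mu> (f x) = \<nu> x"
  shows "inj_on f (carrier G)"
proof -
  interpret group_hom G H f
    using normedD(1)[OF assms(1)] normedD(1)[OF assms(2)] assms(3)
    by (auto simp: group_hom_def group_hom_axioms_def)
  have "x = \<one>\<^bsub>G\<^esub>" if "x \<in> carrier G" "f x = \<one>\<^bsub>H\<^esub>" for x
    using that assms(4)[of x] normedD(3)[OF assms(1)] normed_one[OF assms(2)] by auto
  then show ?thesis by (simp add: inj_on_one_iff)
qed

lemma normed_subgroup:
  assumes "normed G \<nu>" "subgroup P G"
  shows "normed (G\<lparr>carrier := P\<rparr>) \<nu>"
proof -
  interpret group G by (rule normedD(1)[OF assms(1)])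
  have "x \<in> carrier G" if "x \<in> P" for x using that by (rule subgroup.mem_carrier[OF assms(2)])
  then show ?thesis
    using normedD[OF assms(1)] subgroup_imp_group[OF assms(2)] assms(2)
    unfolding normed_def by (auto simp: m_inv_consistent)
qed

end

section \<open>Products of alternating groups\<close>

abbreviation alt_product :: "nat \<Rightarrow> (nat \<Rightarrow> nat) \<Rightarrow> (nat \<Rightarrow> nat \<Rightarrow> nat) monoid" where
  "alt_product k n \<equiv> product_group {..<k} (\<lambda>j. alt_group (n j))"

lemma group_alt_product: "group (alt_product k n)"
  by (simp add: alt_group_is_group)

lemma finite_alt_product: "finite (carrier (alt_product k n))"
  by (auto intro!: finite_PiE finite_subset[OF _ finite_permutations] simp: alt_group_carrier)

lemma alt_product_in_alternating_products:
  assumes "\<And>j. j < k \<Longrightarrow> 5 \<le> n j"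
  shows "alt_product k n \<in> alternating_products"
  unfolding alternating_products_def mem_Collect_eq
  using assms group_alt_product iso_set_refl[THEN is_isoI] by blast

text \<open>If \<open>w \<in> N\<close> has a nontrivial component at \<open>j\<close>, then its commutator with a suitable element of
  the \<open>j\<close>-th factor is a nontrivial element of that factor, so \<open>N\<close> contains the whole factor by
  simplicity. Hence \<open>N\<close> contains every component of \<open>z\<close>.\<close>

lemma normal_alt_product_memI:
  assumes n: "\<And>j. j < k \<Longrightarrow> 8 \<le> n j" and N: "N \<lhd> alt_product k n"
    and z: "z \<in> carrier (alt_product k n)"
    and supp: "\<And>j. j < k \<Longrightarrow> z j \<noteq> id \<Longrightarrow> \<exists>w\<in>N. w j \<noteq> id"
  shows "z \<in> N"
proof -
  let ?Q = "alt_product k n"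
  interpret Q: group ?Q by (rule group_alt_product)
  interpret N: normal N ?Q by fact
  define single where "single j p = (\<lambda>i\<in>{..<k}. if i = j then p else id)" for j :: nat and p :: "nat \<Rightarrow> nat"
  have id_alt: "id \<in> carrier (alt_group m)" for m
    using group.is_monoid[OF alt_group_is_group, THEN monoid.one_closed] by (simp add: alt_group_one)
  have single_closed: "single j p \<in> carrier ?Q" if "p \<in> carrier (alt_group (n j))" for j p
    using that id_alt by (auto simp: single_def)
  have single_mult: "single j p \<otimes>\<^bsub>?Q\<^esub> single j q = single j (p \<circ> q)" for j p q
    by (auto simp: single_def alt_group_mult)
  have single_inv: "inv\<^bsub>?Q\<^esub> (single j p) = single j (inv' p)" if p: "p \<in> carrier (alt_group (n j))" for j p
  proof (rule Q.inv_equality)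
    have "inv' p \<circ> p = id" using p permutes_inv_o(2) by (auto simp: alt_group_carrier)
    then show "single j (inv' p) \<otimes>\<^bsub>?Q\<^esub> single j p = \<one>\<^bsub>?Q\<^esub>"
      unfolding single_mult by (auto simp: single_def alt_group_one)
  qed (use p single_closed alt_group_inv_closed in auto)
  have all: "single j p \<in> N" if j: "j < k" and w: "w \<in> N" "w j \<noteq> id" and p: "p \<in> carrier (alt_group (n j))"
    for j w p
  proof -
    interpret A: group "alt_group (n j)" by (rule alt_group_is_group)
    define M where "M = {p \<in> carrier (alt_group (n j)). single j p \<in> N}"
    have wQ: "w \<in> carrier ?Q" using w(1) by (rule N.mem_carrier)
    then have wj: "w j \<in> carrier (alt_group (n j))" using j by auto
    have sub: "subgroup M (alt_group (n j))"
    proof (rule A.subgroupI)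
      have "single j id = \<one>\<^bsub>?Q\<^esub>" by (auto simp: single_def alt_group_one)
      then show "M \<noteq> {}" using id_alt N.one_closed by (force simp: M_def)
      show "inv\<^bsub>alt_group (n j)\<^esub> q \<in> M" if "q \<in> M" for q
        using that N.m_inv_closed[of "single j q"]
        by (auto simp: M_def single_inv alt_group_inv_equality alt_group_inv_closed simp del: N.m_inv_closed)
      show "q \<otimes>\<^bsub>alt_group (n j)\<^esub> r \<in> M" if "q \<in> M" "r \<in> M" for q r
        using that N.m_closed[of "single j q" "single j r"] A.m_closed[of q r]
        by (auto simp: M_def single_mult alt_group_mult simp del: N.m_closed mult_product_group)
    qed (auto simp: M_def)
    have "r \<circ> q \<circ> inv' r \<in> M" if "q \<in> M" "r \<in> carrier (alt_group (n j))" for q r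
    proof -
      have "r \<circ> q \<circ> inv' r \<in> carrier (alt_group (n j))"
        using that A.m_closed[of r q] A.m_closed[of "r \<circ> q" "inv' r"] alt_group_inv_closed
        by (auto simp: M_def alt_group_mult)
      moreover have "single j r \<otimes>\<^bsub>?Q\<^esub> single j q \<otimes>\<^bsub>?Q\<^esub> inv\<^bsub>?Q\<^esub> single j r \<in> N"
        using that single_closed by (intro N.inv_op_closed2) (auto simp: M_def)
      ultimately show ?thesis
        using that unfolding M_def by (simp only: single_inv single_mult) simp
    qed
    then have nM: "M \<lhd> alt_group (n j)"
      using sub by (auto simp: A.normal_inv_iff alt_group_mult alt_group_inv_equality)
    obtain a b c where abc: "distinct [a, b, c]" "{a, b, c} \<subseteq> {1..n j}"
      "w j \<circ> cycle_of_list [a, b, c] \<noteq> cycle_of_list [a, b, c] \<circ> w j"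
      using alt_group_noncommuting_three_cycle[OF _ wj w(2)] n[OF j] by auto
    define d where "d = cycle_of_list [a, b, c]"
    have d: "d \<in> carrier (alt_group (n j))" "w j \<circ> d \<noteq> d \<circ> w j"
      unfolding d_def using three_cycle_in_alt_group abc by blast+
    have cc: "w j \<circ> d \<circ> inv' (w j) \<circ> inv' d \<in> carrier (alt_group (n j))"
      using A.m_closed[of "w j" d] A.m_closed[of "w j \<circ> d" "inv' (w j)"]
        A.m_closed[of "w j \<circ> d \<circ> inv' (w j)" "inv' d"] alt_group_inv_closed wj d
      by (auto simp: alt_group_mult)
    have "w \<otimes>\<^bsub>?Q\<^esub> single j d \<otimes>\<^bsub>?Q\<^esub> inv\<^bsub>?Q\<^esub> w \<otimes>\<^bsub>?Q\<^esub> inv\<^bsub>?Q\<^esub> (single j d) \<in> N"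
      by (rule Q.commutator_in_normal[OF N w(1) single_closed[OF d(1)]])
    moreover have "w \<otimes>\<^bsub>?Q\<^esub> single j d \<otimes>\<^bsub>?Q\<^esub> inv\<^bsub>?Q\<^esub> w \<otimes>\<^bsub>?Q\<^esub> inv\<^bsub>?Q\<^esub> (single j d)
        = single j (w j \<circ> d \<circ> inv' (w j) \<circ> inv' d)"
    proof -
      have wi: "inv\<^bsub>?Q\<^esub> w = (\<lambda>i\<in>{..<k}. inv' (w i))"
        using wQ inv_product_group[of w "{..<k}" "\<lambda>j. alt_group (n j)"]
        by (auto simp: alt_group_is_group alt_group_inv_equality PiE_iff)
      have "w i \<circ> inv' (w i) = id" if "i < k" for i
        using wQ that permutes_inv_o(1)[of "w i" "{1..n i}"] by (auto simp: alt_group_carrier PiE_iff)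
      then show ?thesis
        unfolding single_inv[OF d(1)] wi
        by (auto simp: single_def alt_group_mult)
    qed
    ultimately have cM: "w j \<circ> d \<circ> inv' (w j) \<circ> inv' d \<in> M"
      using cc by (simp add: M_def)
    have "w j \<circ> d \<circ> inv' (w j) \<circ> inv' d \<noteq> id"
    proof
      assume e: "w j \<circ> d \<circ> inv' (w j) \<circ> inv' d = id"
      have "inv' d \<circ> d = id" "inv' (w j) \<circ> w j = id"
        using d wj permutes_inv_o(2) by (auto simp: alt_group_carrier)
      then have "w j \<circ> d \<circ> inv' (w j) \<circ> inv' d \<circ> (d \<circ> w j) = w j \<circ> d"
        by (metis comp_assoc comp_id)
      then show False using d(2) e by simp
    qed
    then have "M = carrier (alt_group (n j))"
      using normal_alt_group_eq_carrier[OF n[OF j] nM cM] by simp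
    then show ?thesis using p by (auto simp: M_def)
  qed
  have "(\<lambda>i\<in>{..<k}. if i < m then z i else id) \<in> N" if "m \<le> k" for m
    using that
  proof (induction m)
    case 0
    have "(\<lambda>i\<in>{..<k}. if i < 0 then z i else id) = \<one>\<^bsub>?Q\<^esub>" by (simp add: alt_group_one)
    then show ?case using N.one_closed by (simp only:)
  next
    case (Suc m)
    let ?y = "\<lambda>i\<in>{..<k}. if i < m then z i else id"
    have y: "?y \<in> N" by (rule Suc.IH) (use Suc.prems in simp)
    have zm: "z m \<in> carrier (alt_group (n m))"
      using z Suc.prems by (simp add: PiE_iff)
    have "single m (z m) \<in> N"
    proof (cases "z m = id")
      case True
      then have "single m (z m) = \<one>\<^bsub>?Q\<^esub>" by (auto simp: single_def alt_group_one)
      then show ?thesis using N.one_closed by simp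
    next
      case False
      then show ?thesis using supp[of m] all[of m _ "z m"] zm Suc.prems by (metis Suc_le_lessD)
    qed
    then have "?y \<otimes>\<^bsub>?Q\<^esub> single m (z m) \<in> N" using y by (rule N.m_closed[rotated])
    moreover have "?y \<otimes>\<^bsub>?Q\<^esub> single m (z m) = (\<lambda>i\<in>{..<k}. if i < Suc m then z i else id)"
      by (auto simp: single_def alt_group_mult less_Suc_eq)
    ultimately show ?case by (simp only:)
  qed
  from this[OF order.refl] have "(\<lambda>i\<in>{..<k}. if i < k then z i else id) \<in> N" .
  moreover have "(\<lambda>i\<in>{..<k}. if i < k then z i else id) = z"
    using z by (auto simp: PiE_iff extensional_def fun_eq_iff)
  ultimately show ?thesis by (simp only:)
qed

context distributive_semilattice0
begin

definition alt_norm :: "nat \<Rightarrow> (nat \<Rightarrow> 'a) \<Rightarrow> (nat \<Rightarrow> nat \<Rightarrow> nat) \<Rightarrow> 'a" where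
  "alt_norm k s q = fjoin (s ` {j. j < k \<and> q j \<noteq> id})"

lemma normed_alt_product:
  assumes s: "\<And>j. j < k \<Longrightarrow> s j \<in> carrier S" "\<And>j. j < k \<Longrightarrow> s j \<noteq> \<bottom>"
  shows "normed (alt_product k n) (alt_norm k s)"
proof -
  let ?Q = "alt_product k n"
  interpret Q: group ?Q by (rule group_alt_product)
  have closed: "alt_norm k s q \<in> carrier S" for q
    unfolding alt_norm_def using s by (intro fjoin_closed) auto
  have le: "alt_norm k s q \<sqsubseteq> b \<longleftrightarrow> (\<forall>j<k. q j \<noteq> id \<longrightarrow> s j \<sqsubseteq> b)" if "b \<in> carrier S" for q b
    unfolding alt_norm_def using s that by (subst fjoin_le_iff) auto
  have le_self: "s j \<sqsubseteq> alt_norm k s q" if "j < k" "q j \<noteq> id" for q j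
    unfolding alt_norm_def using s that by (intro le_fjoin) auto
  have inv: "(inv\<^bsub>?Q\<^esub> x) j = inv' (x j)" if "x \<in> carrier ?Q" "j < k" for x j
    using that inv_product_group[of x "{..<k}" "\<lambda>j. alt_group (n j)"]
    by (auto simp: alt_group_is_group alt_group_inv_equality PiE_iff)
  have io: "x j \<circ> inv' (x j) = id" if "x \<in> carrier ?Q" "j < k" for x j
    using that permutes_inv_o(1)[of "x j" "{1..n j}"] by (auto simp: alt_group_carrier PiE_iff)
  show ?thesis
    unfolding normed_def
  proof (intro conjI ballI)
    fix x assume x: "x \<in> carrier ?Q"
    show "alt_norm k s x = \<bottom> \<longleftrightarrow> x = \<one>\<^bsub>?Q\<^esub>"
    proof
      assume "alt_norm k s x = \<bottom>"
      then have "x j = id" if "j < k" for j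
        using le_self[OF that] s that le_bottom_iff by metis
      then show "x = \<one>\<^bsub>?Q\<^esub>"
        using x by (auto simp: alt_group_one PiE_iff extensional_def fun_eq_iff)
    qed (auto simp: alt_norm_def alt_group_one)
    show "alt_norm k s (inv\<^bsub>?Q\<^esub> x) \<sqsubseteq> alt_norm k s x"
    proof -
      have "s j \<sqsubseteq> alt_norm k s x" if "j < k" "inv' (x j) \<noteq> id" for j
        using le_self[of j x] that by (cases "x j = id") auto
      then show ?thesis
        using inv[OF x] by (auto simp: le closed)
    qed
    fix y assume y: "y \<in> carrier ?Q"
    show "alt_norm k s (x \<otimes>\<^bsub>?Q\<^esub> y) \<sqsubseteq> alt_norm k s x \<squnion> alt_norm k s y"
    proof -
      have "s j \<sqsubseteq> alt_norm k s x \<squnion> alt_norm k s y" if j: "j < k" and ne: "x j \<circ> y j \<noteq> id" for j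
      proof -
        have "x j \<noteq> id \<or> y j \<noteq> id" using ne by auto
        then show ?thesis
          using le_self[OF j] s(1)[OF j] closed join_left[OF closed closed, of x y] join_right[OF closed closed, of y x]
          by (meson join_closed le_trans)
      qed
      then show ?thesis by (auto simp: le closed alt_group_mult)
    qed
    show "alt_norm k s (y \<otimes>\<^bsub>?Q\<^esub> x \<otimes>\<^bsub>?Q\<^esub> inv\<^bsub>?Q\<^esub> y) \<sqsubseteq> alt_norm k s x"
    proof -
      have "s j \<sqsubseteq> alt_norm k s x" if "j < k" "y j \<circ> x j \<circ> inv' (y j) \<noteq> id" for j
        using io[OF y that(1)] le_self[of j x] that by (cases "x j = id") auto
      then show ?thesis
        by (auto simp: le closed alt_group_mult inv[OF y] simp del: inv_product_group)
    qed
  qed (use closed group_alt_product in auto)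
qed

end

section \<open>Amalgamation inside an alternating group\<close>

text \<open>Acting simultaneously on two copies of \<open>\<Omega>\<close> makes every permutation even, since the two halves
  of the action have the same sign.\<close>

lemma even_representation_of_permutations:
  fixes \<Omega> :: "'w set"
  assumes fin: "finite \<Omega>"
  obtains E where
    "\<And>p. p permutes \<Omega> \<Longrightarrow> E p \<in> carrier (alt_group (2 * card \<Omega>))"
    "\<And>p q. p permutes \<Omega> \<Longrightarrow> q permutes \<Omega> \<Longrightarrow> E (p \<circ> q) = E p \<circ> E q"
    "\<And>p. p permutes \<Omega> \<Longrightarrow> E p = id \<longleftrightarrow> p = id"
proof -
  let ?D = "\<Omega> \<times> (UNIV :: bool set)"
  define double where "double p = (\<lambda>(w :: 'w, e :: bool). (p w, e))" for p :: "'w \<Rightarrow> 'w"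
  have double_permutes: "double p permutes ?D" if "p permutes \<Omega>" for p
  proof (rule bij_imp_permutes)
    have "bij_betw (map_prod p id) ?D ?D"
      using permutes_imp_bij[OF that] bij_betw_id by (rule bij_betw_map_prod)
    then show "bij_betw (double p) ?D ?D"
      by (simp add: double_def map_prod_def)
    show "double p w = w" if "w \<notin> ?D" for w
      using that \<open>p permutes \<Omega>\<close> by (cases w) (auto simp: double_def permutes_not_in)
  qed
  have even: "evenperm (double p)" if p: "p permutes \<Omega>" for p
  proof -
    let ?m = "\<lambda>e. map_permutation \<Omega> (\<lambda>w. (w, e)) p"
    have inj: "inj_on (\<lambda>w. (w, e)) \<Omega>" for e :: bool by (auto simp: inj_on_def)
    have app: "?m e (w, e') = (if e' = e then p w else w, e')" for e e' :: bool and w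
    proof (cases "w \<in> \<Omega> \<and> e' = e")
      case True
      then show ?thesis using map_permutation_apply[OF inj, of w] by auto
    next
      case False
      then show ?thesis
        using permutes_not_in[OF p, of w] by (auto simp: map_permutation_def restrict_id_def)
    qed
    have "double p = ?m True \<circ> ?m False"
      by (auto simp: double_def app fun_eq_iff)
    moreover have "permutation (?m e)" for e :: bool
      using map_permutation_permutes[OF inj_on_imp_bij_betw[OF inj] p]
      by (rule permutes_imp_permutation[OF finite_imageI[OF fin]])
    ultimately show ?thesis
      using evenperm_map_permutation[OF inj p fin] by (simp add: evenperm_comp)
  qed
  have "card ?D = 2 * card \<Omega>" by (simp add: card_cartesian_product)
  then obtain \<beta> where \<beta>: "bij_betw \<beta> ?D {1..2 * card \<Omega>}"
    using ex_bij_betw_nat_finite_1[of ?D] fin by (metis bij_betw_inv finite_SigmaI finite_UNIV)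
  then have inj: "inj_on \<beta> ?D" by (rule bij_betw_imp_inj_on)
  show ?thesis
  proof (rule that[of "\<lambda>p. map_permutation ?D \<beta> (double p)"])
    fix p assume p: "p permutes \<Omega>"
    show "map_permutation ?D \<beta> (double p) \<in> carrier (alt_group (2 * card \<Omega>))"
      using map_permutation_permutes[OF \<beta> double_permutes[OF p]]
        evenperm_map_permutation[OF inj double_permutes[OF p]] even[OF p] fin
      by (simp add: alt_group_carrier)
    show "map_permutation ?D \<beta> (double p) = id \<longleftrightarrow> p = id"
    proof
      assume e: "map_permutation ?D \<beta> (double p) = id"
      have "p w = w" if w: "w \<in> \<Omega>" for w
      proof -
        have d: "double p (w, True) \<in> ?D" using double_permutes[OF p] w by (auto simp: permutes_in_image)
        have "\<beta> (double p (w, True)) = \<beta> (w, True)"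
          using map_permutation_apply[OF inj, of "(w, True)" "double p"] w e by simp
        then have "double p (w, True) = (w, True)"
          using inj_onD[OF inj _ d] w by blast
        then show ?thesis by (simp add: double_def)
      qed
      then show "p = id" using permutes_not_in[OF p] by (auto simp: fun_eq_iff)
    next
      assume "p = id"
      then have "double p = id" by (auto simp: double_def)
      then show "map_permutation ?D \<beta> (double p) = id" by (simp add: map_permutation_id'[OF inj])
    qed
    fix q assume q: "q permutes \<Omega>"
    have "double (p \<circ> q) = double p \<circ> double q" by (auto simp: double_def)
    then show "map_permutation ?D \<beta> (double (p \<circ> q)) = map_permutation ?D \<beta> (double p) \<circ> map_permutation ?D \<beta> (double q)"
      by (simp add: map_permutation_compose'[OF inj double_permutes[OF q]])
  qed
qed

lemma right_transversal:
  assumes "group H" "group P" and k: "k \<in> hom H P" "inj_on k (carrier H)"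
  obtains T where "T \<subseteq> carrier P" "T \<noteq> {}" "bij_betw (\<lambda>(h, t). k h \<otimes>\<^bsub>P\<^esub> t) (carrier H \<times> T) (carrier P)"
proof -
  interpret group_hom H P k using assms by (simp add: group_hom_def group_hom_axioms_def)
  let ?K = "k ` carrier H"
  have K: "subgroup ?K P" by (rule img_is_subgroup)
  then have K': "?K \<subseteq> carrier P" by (rule subgroup.subset)
  define \<tau> where "\<tau> x = (SOME y. y \<in> ?K #>\<^bsub>P\<^esub> x)" for x
  have \<tau>: "\<tau> x \<in> ?K #>\<^bsub>P\<^esub> x" if "x \<in> carrier P" for x
    unfolding \<tau>_def using H.rcos_self[OF that K] by (rule someI)
  have \<tau>_closed: "\<tau> x \<in> carrier P" if "x \<in> carrier P" for x
    using \<tau>[OF that] H.r_coset_subset_G[OF K' that] by blast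
  have \<tau>_eq: "\<tau> x = \<tau> y" if "y \<in> carrier P" "x \<in> ?K #>\<^bsub>P\<^esub> y" for x y
    using H.repr_independence[OF that(2,1) K] by (simp add: \<tau>_def)
  let ?T = "\<tau> ` carrier P"
  have coset: "k h \<otimes>\<^bsub>P\<^esub> x \<in> ?K #>\<^bsub>P\<^esub> x" if "h \<in> carrier H" for h x
    using that by (auto simp: r_coset_def)
  have "bij_betw (\<lambda>(h, t). k h \<otimes>\<^bsub>P\<^esub> t) (carrier H \<times> ?T) (carrier P)"
  proof (rule bij_betw_imageI)
    show "inj_on (\<lambda>(h, t). k h \<otimes>\<^bsub>P\<^esub> t) (carrier H \<times> ?T)"
    proof (rule inj_onI, clarsimp)
      fix h h' x y assume h: "h \<in> carrier H" "h' \<in> carrier H" "x \<in> carrier P" "y \<in> carrier P"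
        and e: "k h \<otimes>\<^bsub>P\<^esub> \<tau> x = k h' \<otimes>\<^bsub>P\<^esub> \<tau> y"
      have "\<tau> (k h \<otimes>\<^bsub>P\<^esub> \<tau> x) = \<tau> x" if "h \<in> carrier H" "x \<in> carrier P" for h x
        using \<tau>_eq[OF \<tau>_closed coset] \<tau>_eq[OF _ \<tau>] that by metis
      then have t: "\<tau> x = \<tau> y" using h e by metis
      then have "k h = k h'" using e h \<tau>_closed by simp
      then show "h = h' \<and> \<tau> x = \<tau> y" using t k h by (auto dest: inj_onD)
    qed
    show "(\<lambda>(h, t). k h \<otimes>\<^bsub>P\<^esub> t) ` (carrier H \<times> ?T) = carrier P"
    proof
      show "(\<lambda>(h, t). k h \<otimes>\<^bsub>P\<^esub> t) ` (carrier H \<times> ?T) \<subseteq> carrier P"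
      proof clarify
        fix h x assume "h \<in> carrier H" "x \<in> carrier P"
        then show "k h \<otimes>\<^bsub>P\<^esub> \<tau> x \<in> carrier P" using \<tau>_closed by simp
      qed
      show "carrier P \<subseteq> (\<lambda>(h, t). k h \<otimes>\<^bsub>P\<^esub> t) ` (carrier H \<times> ?T)"
      proof
        fix x assume x: "x \<in> carrier P"
        then have "x \<in> ?K #>\<^bsub>P\<^esub> \<tau> x"
          using H.repr_independence[OF \<tau>[OF x] x K] H.rcos_self[OF x K] by simp
        then obtain h where "h \<in> carrier H" "x = k h \<otimes>\<^bsub>P\<^esub> \<tau> x"
          by (auto simp: r_coset_def)
        then show "x \<in> (\<lambda>(h, t). k h \<otimes>\<^bsub>P\<^esub> t) ` (carrier H \<times> ?T)"
          using x by (intro image_eqI[of _ _ "(h, \<tau> x)"]) auto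
      qed
    qed
  qed
  moreover have "?T \<subseteq> carrier P" using \<tau>_closed by auto
  moreover have "?T \<noteq> {}" by auto
  ultimately show ?thesis using that by blast
qed

text \<open>The second components in \<open>C\<close> only multiply the number of copies of the regular representation.\<close>

definition left_translation :: "('g, 'm) monoid_scheme \<Rightarrow> 'c set \<Rightarrow> 'g \<Rightarrow> 'g \<times> 'c \<Rightarrow> 'g \<times> 'c" where
  "left_translation P C p = (\<lambda>(x, c). if x \<in> carrier P \<and> c \<in> C then (p \<otimes>\<^bsub>P\<^esub> x, c) else (x, c))"

text \<open>The last statement is the defining property of the action on \<open>\<Omega>\<close>, where \<open>d\<close> identifies \<open>\<Omega>\<close>
  with a disjoint union of copies of the group.\<close>

lemma left_translation_representation:
  assumes "group P" "C \<noteq> {}" and d: "bij_betw d \<Omega> (carrier P \<times> C)"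
  defines "\<rho> \<equiv> \<lambda>p. map_permutation (carrier P \<times> C) (inv_into \<Omega> d) (left_translation P C p)"
  shows "\<And>p. p \<in> carrier P \<Longrightarrow> \<rho> p permutes \<Omega>"
    "\<And>p q. p \<in> carrier P \<Longrightarrow> q \<in> carrier P \<Longrightarrow> \<rho> (p \<otimes>\<^bsub>P\<^esub> q) = \<rho> p \<circ> \<rho> q"
    "\<And>p. p \<in> carrier P \<Longrightarrow> \<rho> p = id \<longleftrightarrow> p = \<one>\<^bsub>P\<^esub>"
    "\<And>p w w'. p \<in> carrier P \<Longrightarrow> w \<in> \<Omega> \<Longrightarrow> w' \<in> \<Omega> \<Longrightarrow>
      d w' = (p \<otimes>\<^bsub>P\<^esub> fst (d w), snd (d w)) \<Longrightarrow> \<rho> p w = w'"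
proof -
  interpret P: group P by fact
  have d': "bij_betw (inv_into \<Omega> d) (carrier P \<times> C) \<Omega>" using d by (rule bij_betw_inv_into)
  note inj = bij_betw_imp_inj_on[OF d']
  have perm: "left_translation P C p permutes (carrier P \<times> C)" if p: "p \<in> carrier P" for p
  proof (rule bij_imp_permutes)
    show "bij_betw (left_translation P C p) (carrier P \<times> C) (carrier P \<times> C)"
      by (rule bij_betw_byWitness[where f' = "left_translation P C (inv\<^bsub>P\<^esub> p)"])
        (use p in \<open>auto simp: left_translation_def P.m_assoc[symmetric]\<close>)
    show "left_translation P C p w = w" if "w \<notin> carrier P \<times> C" for w
      using that by (cases w) (auto simp: left_translation_def)
  qed
  have app: "\<rho> p w = w'"
    if "p \<in> carrier P" "w \<in> \<Omega>" "w' \<in> \<Omega>" "d w' = (p \<otimes>\<^bsub>P\<^esub> fst (d w), snd (d w))" for p w w'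
  proof -
    have dw: "d w \<in> carrier P \<times> C" using d that by (auto simp: bij_betw_def)
    then have "\<rho> p (inv_into \<Omega> d (d w)) = inv_into \<Omega> d (left_translation P C p (d w))"
      unfolding \<rho>_def by (rule map_permutation_apply[OF inj])
    moreover have "left_translation P C p (d w) = d w'"
      using that dw by (auto simp: left_translation_def split: prod.splits)
    ultimately show ?thesis
      using bij_betw_inv_into_left[OF d that(2)] bij_betw_inv_into_left[OF d that(3)] by metis
  qed
  show perm\<rho>: "\<rho> p permutes \<Omega>" if "p \<in> carrier P" for p
    unfolding \<rho>_def by (rule map_permutation_permutes[OF d' perm[OF that]])
  show "\<rho> (p \<otimes>\<^bsub>P\<^esub> q) = \<rho> p \<circ> \<rho> q" if "p \<in> carrier P" "q \<in> carrier P" for p q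
  proof -
    have "left_translation P C (p \<otimes>\<^bsub>P\<^esub> q) = left_translation P C p \<circ> left_translation P C q"
      using that by (auto simp: left_translation_def P.m_assoc)
    then show ?thesis
      unfolding \<rho>_def using map_permutation_compose'[OF inj perm[OF that(2)]] by simp
  qed
  show "\<rho> p = id \<longleftrightarrow> p = \<one>\<^bsub>P\<^esub>" if p: "p \<in> carrier P" for p
  proof
    assume "p = \<one>\<^bsub>P\<^esub>"
    then have "left_translation P C p = id" by (auto simp: left_translation_def fun_eq_iff)
    then show "\<rho> p = id" unfolding \<rho>_def by (simp add: map_permutation_id'[OF inj])
  next
    assume e: "\<rho> p = id"
    obtain c where c: "c \<in> C" using assms by blast
    define w where "w = inv_into \<Omega> d (\<one>\<^bsub>P\<^esub>, c)"
    define w' where "w' = inv_into \<Omega> d (p, c)"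
    have w: "w \<in> \<Omega>" "w' \<in> \<Omega>" "d w = (\<one>\<^bsub>P\<^esub>, c)" "d w' = (p, c)"
      using c p d d' unfolding w_def w'_def
      by (auto simp: bij_betw_inv_into_right intro: bij_betw_apply)
    have "\<rho> p w = w'" using app[OF p w(1,2)] w p by simp
    then have "w' = w" using e by simp
    then show "p = \<one>\<^bsub>P\<^esub>" using w by simp
  qed
  show "\<And>p w w'. p \<in> carrier P \<Longrightarrow> w \<in> \<Omega> \<Longrightarrow> w' \<in> \<Omega> \<Longrightarrow>
      d w' = (p \<otimes>\<^bsub>P\<^esub> fst (d w), snd (d w)) \<Longrightarrow> \<rho> p w = w'"
    using app .
qed

text \<open>A right transversal \<open>T\<close> of the image of \<open>H\<close> in \<open>P\<close> identifies \<open>P\<close> with \<open>H \<times> T\<close> as a set on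
  which \<open>H\<close> acts from the left. Hence both groups act on \<open>H \<times> T1 \<times> T2\<close>, the first one ignoring
  \<open>T2\<close> and the second one ignoring \<open>T1\<close>, and both actions of \<open>H\<close> are translations of the first
  component. An additional factor with four elements makes the degree at least 8 after doubling.\<close>

lemma amalgamation_in_alt_group:
  fixes H :: "('h, 'm) monoid_scheme" and P1 :: "('p, 'm1) monoid_scheme"
    and P2 :: "('q, 'm2) monoid_scheme"
  assumes H: "group H" "finite (carrier H)"
    and P1: "group P1" "finite (carrier P1)" and P2: "group P2" "finite (carrier P2)"
    and k1: "k1 \<in> hom H P1" "inj_on k1 (carrier H)"
    and k2: "k2 \<in> hom H P2" "inj_on k2 (carrier H)"
  obtains m e1 e2 where "8 \<le> m" "e1 \<in> hom P1 (alt_group m)" "e2 \<in> hom P2 (alt_group m)"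
    "\<And>x. x \<in> carrier P1 \<Longrightarrow> e1 x = id \<longleftrightarrow> x = \<one>\<^bsub>P1\<^esub>"
    "\<And>x. x \<in> carrier P2 \<Longrightarrow> e2 x = id \<longleftrightarrow> x = \<one>\<^bsub>P2\<^esub>"
    "\<And>h. h \<in> carrier H \<Longrightarrow> e1 (k1 h) = e2 (k2 h)"
proof -
  interpret H: group H by fact
  interpret k1: group_hom H P1 k1 using assms by (simp add: group_hom_def group_hom_axioms_def)
  interpret k2: group_hom H P2 k2 using assms by (simp add: group_hom_def group_hom_axioms_def)
  obtain T1 where T1: "T1 \<subseteq> carrier P1" "T1 \<noteq> {}"
    "bij_betw (\<lambda>(h, t). k1 h \<otimes>\<^bsub>P1\<^esub> t) (carrier H \<times> T1) (carrier P1)"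
    using right_transversal[OF H(1) P1(1) k1] .
  obtain T2 where T2: "T2 \<subseteq> carrier P2" "T2 \<noteq> {}"
    "bij_betw (\<lambda>(h, t). k2 h \<otimes>\<^bsub>P2\<^esub> t) (carrier H \<times> T2) (carrier P2)"
    using right_transversal[OF H(1) P2(1) k2] .
  let ?I = "{..<4 :: nat}"
  let ?\<Omega> = "carrier H \<times> T1 \<times> T2 \<times> ?I"
  define d1 where "d1 = (\<lambda>(h, t1, t2 :: 'q, i :: nat). (k1 h \<otimes>\<^bsub>P1\<^esub> t1, t2, i))"
  define d2 where "d2 = (\<lambda>(h, t1 :: 'p, t2, i :: nat). (k2 h \<otimes>\<^bsub>P2\<^esub> t2, t1, i))"
  have im1: "(\<lambda>(h, t). k1 h \<otimes>\<^bsub>P1\<^esub> t) ` (carrier H \<times> T1) = carrier P1"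
    and inj1: "inj_on (\<lambda>(h, t). k1 h \<otimes>\<^bsub>P1\<^esub> t) (carrier H \<times> T1)"
    using T1(3) by (auto simp: bij_betw_def)
  have im2: "(\<lambda>(h, t). k2 h \<otimes>\<^bsub>P2\<^esub> t) ` (carrier H \<times> T2) = carrier P2"
    and inj2: "inj_on (\<lambda>(h, t). k2 h \<otimes>\<^bsub>P2\<^esub> t) (carrier H \<times> T2)"
    using T2(3) by (auto simp: bij_betw_def)
  have d1: "bij_betw d1 ?\<Omega> (carrier P1 \<times> T2 \<times> ?I)"
  proof (rule bij_betw_imageI)
    show "inj_on d1 ?\<Omega>"
      using inj1 unfolding d1_def inj_on_def by force
    show "d1 ` ?\<Omega> = carrier P1 \<times> T2 \<times> ?I"
      unfolding im1[symmetric] by (force simp: d1_def image_iff)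
  qed
  have d2: "bij_betw d2 ?\<Omega> (carrier P2 \<times> T1 \<times> ?I)"
  proof (rule bij_betw_imageI)
    show "inj_on d2 ?\<Omega>"
      using inj2 by (auto simp: d2_def inj_on_def)
    show "d2 ` ?\<Omega> = carrier P2 \<times> T1 \<times> ?I"
      unfolding im2[symmetric] by (force simp: d2_def image_iff)
  qed
  have ne: "T2 \<times> ?I \<noteq> {}" "T1 \<times> ?I \<noteq> {}" using T1(2) T2(2) by (auto simp: lessThan_empty_iff)
  define \<rho>1 where "\<rho>1 p = map_permutation (carrier P1 \<times> T2 \<times> ?I) (inv_into ?\<Omega> d1)
    (left_translation P1 (T2 \<times> ?I) p)" for p
  define \<rho>2 where "\<rho>2 p = map_permutation (carrier P2 \<times> T1 \<times> ?I) (inv_into ?\<Omega> d2)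
    (left_translation P2 (T1 \<times> ?I) p)" for p
  note r1 = left_translation_representation[OF P1(1) ne(1) d1, folded \<rho>1_def]
  note r2 = left_translation_representation[OF P2(1) ne(2) d2, folded \<rho>2_def]
  have agree: "\<rho>1 (k1 h) = \<rho>2 (k2 h)" if h: "h \<in> carrier H" for h
  proof
    fix w
    show "\<rho>1 (k1 h) w = \<rho>2 (k2 h) w"
    proof (cases "w \<in> ?\<Omega>")
      case True
      then obtain g t1 t2 i where w: "w = (g, t1, t2, i)" "g \<in> carrier H" "t1 \<in> T1" "t2 \<in> T2" "i \<in> ?I"
        by auto
      let ?w = "(h \<otimes>\<^bsub>H\<^esub> g, t1, t2, i)"
      have w': "?w \<in> ?\<Omega>" using w h by simp
      have c: "t1 \<in> carrier P1" "t2 \<in> carrier P2" using w T1 T2 by auto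
      have "\<rho>1 (k1 h) w = ?w"
        by (rule r1(4)[OF _ True w']) (use w h c in \<open>auto simp: d1_def k1.H.m_assoc\<close>)
      moreover have "\<rho>2 (k2 h) w = ?w"
        by (rule r2(4)[OF _ True w']) (use w h c in \<open>auto simp: d2_def k2.H.m_assoc\<close>)
      ultimately show ?thesis by simp
    next
      case False
      then show ?thesis
        using permutes_not_in[OF r1(1), of "k1 h" w] permutes_not_in[OF r2(1), of "k2 h" w] h by simp
    qed
  qed
  have fT: "finite T1" "finite T2"
    using T1 T2 P1 P2 finite_subset by blast+
  then have fin: "finite ?\<Omega>" using H by simp
  have pos: "0 < card (carrier H)" "0 < card T1" "0 < card T2"
    using H(2) fT T1 T2 H.one_closed by (auto simp: card_gt_0_iff)
  have "1 \<le> card (carrier H) * (card T1 * card T2)"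
    using pos by (simp add: Suc_le_eq)
  then have card: "8 \<le> 2 * card ?\<Omega>"
    by (simp add: card_cartesian_product)
  obtain E where E: "\<And>p. p permutes ?\<Omega> \<Longrightarrow> E p \<in> carrier (alt_group (2 * card ?\<Omega>))"
    "\<And>p q. p permutes ?\<Omega> \<Longrightarrow> q permutes ?\<Omega> \<Longrightarrow> E (p \<circ> q) = E p \<circ> E q"
    "\<And>p. p permutes ?\<Omega> \<Longrightarrow> E p = id \<longleftrightarrow> p = id"
    using even_representation_of_permutations[OF fin] by blast
  show ?thesis
  proof (rule that[OF card, of "\<lambda>p. E (\<rho>1 p)" "\<lambda>p. E (\<rho>2 p)"])
    show "(\<lambda>p. E (\<rho>1 p)) \<in> hom P1 (alt_group (2 * card ?\<Omega>))"
      using r1(1,2) E(1,2) by (auto simp: hom_def alt_group_mult)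
    show "(\<lambda>p. E (\<rho>2 p)) \<in> hom P2 (alt_group (2 * card ?\<Omega>))"
      using r2(1,2) E(1,2) by (auto simp: hom_def alt_group_mult)
  qed (use r1(1,3) r2(1,3) E(3) agree in simp_all)
qed

text \<open>Both \<open>N1\<close> and \<open>N2\<close> have the same preimage \<open>K\<close> in \<open>P0\<close>, so the quotient of \<open>P0\<close> by \<open>K\<close> embeds
  into both quotients, which are then amalgamated over it.\<close>

lemma amalgamation_with_kernels:
  assumes P0: "group P0" "finite (carrier P0)"
    and P1: "group P1" "finite (carrier P1)" and P2: "group P2" "finite (carrier P2)"
    and f1: "f1 \<in> hom P0 P1" and f2: "f2 \<in> hom P0 P2"
    and N: "N1 \<lhd> P1" "N2 \<lhd> P2" "\<And>x. x \<in> carrier P0 \<Longrightarrow> f1 x \<in> N1 \<longleftrightarrow> f2 x \<in> N2"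
  obtains m e1 e2 where "8 \<le> m" "e1 \<in> hom P1 (alt_group m)" "e2 \<in> hom P2 (alt_group m)"
    "\<And>x. x \<in> carrier P1 \<Longrightarrow> e1 x = id \<longleftrightarrow> x \<in> N1"
    "\<And>x. x \<in> carrier P2 \<Longrightarrow> e2 x = id \<longleftrightarrow> x \<in> N2"
    "\<And>x. x \<in> carrier P0 \<Longrightarrow> e1 (f1 x) = e2 (f2 x)"
proof -
  interpret P0: group P0 by fact
  interpret N1: normal N1 P1 by fact
  interpret N2: normal N2 P2 by fact
  define q1 where "q1 = (\<lambda>x. N1 #>\<^bsub>P1\<^esub> x)"
  define q2 where "q2 = (\<lambda>x. N2 #>\<^bsub>P2\<^esub> x)"
  have q1: "q1 \<in> hom P1 (P1 Mod N1)" "q2 \<in> hom P2 (P2 Mod N2)"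
    unfolding q1_def q2_def by (rule N1.r_coset_hom_Mod N2.r_coset_hom_Mod)+
  have q1_one: "q1 x = \<one>\<^bsub>P1 Mod N1\<^esub> \<longleftrightarrow> x \<in> N1" if "x \<in> carrier P1" for x
    using that N1.rcos_const N1.rcos_self[OF that N1.is_subgroup] by (auto simp: q1_def FactGroup_def)
  have q2_one: "q2 x = \<one>\<^bsub>P2 Mod N2\<^esub> \<longleftrightarrow> x \<in> N2" if "x \<in> carrier P2" for x
    using that N2.rcos_const N2.rcos_self[OF that N2.is_subgroup] by (auto simp: q2_def FactGroup_def)
  have f: "f1 x \<in> carrier P1" "f2 x \<in> carrier P2" if "x \<in> carrier P0" for x
    using that f1 f2 by (auto simp: hom_def)
  interpret h1: group_hom P0 "P1 Mod N1" "q1 \<circ> f1"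
    using hom_compose[OF f1 q1(1)] N1.factorgroup_is_group P0 by (simp add: group_hom_def group_hom_axioms_def)
  interpret h2: group_hom P0 "P2 Mod N2" "q2 \<circ> f2"
    using hom_compose[OF f2 q1(2)] N2.factorgroup_is_group P0 by (simp add: group_hom_def group_hom_axioms_def)
  define K where "K = kernel P0 (P1 Mod N1) (q1 \<circ> f1)"
  have K: "x \<in> K \<longleftrightarrow> x \<in> carrier P0 \<and> f1 x \<in> N1" for x
    unfolding K_def kernel_def using q1_one[OF f(1)] by auto
  have "x \<in> kernel P0 (P2 Mod N2) (q2 \<circ> f2) \<longleftrightarrow> x \<in> carrier P0 \<and> f2 x \<in> N2" for x
    unfolding kernel_def using q2_one[OF f(2)] by auto
  then have K2: "K = kernel P0 (P2 Mod N2) (q2 \<circ> f2)"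
    using K N(3) by blast
  have nK: "K \<lhd> P0" unfolding K_def by (rule h1.normal_kernel)
  interpret K: normal K P0 by fact
  have carr: "\<exists>x\<in>carrier P0. X = K #>\<^bsub>P0\<^esub> x" if "X \<in> carrier (P0 Mod K)" for X
    using that by (auto simp: FactGroup_def RCOSETS_def)
  obtain k1 where k1: "k1 \<in> hom (P0 Mod K) (P1 Mod N1)"
    "\<And>x. x \<in> carrier P0 \<Longrightarrow> k1 (K #>\<^bsub>P0\<^esub> x) = (q1 \<circ> f1) x"
    using h1.FactGroup_universal_kernel[OF nK] by (auto simp: K_def)
  obtain k2 where k2: "k2 \<in> hom (P0 Mod K) (P2 Mod N2)"
    "\<And>x. x \<in> carrier P0 \<Longrightarrow> k2 (K #>\<^bsub>P0\<^esub> x) = (q2 \<circ> f2) x"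
    using h2.FactGroup_universal_kernel[OF nK] by (auto simp: K2)
  have gK: "group (P0 Mod K)" by (rule K.factorgroup_is_group)
  interpret k1: group_hom "P0 Mod K" "P1 Mod N1" k1
    using gK k1 by (simp add: group_hom_def group_hom_axioms_def)
  interpret k2: group_hom "P0 Mod K" "P2 Mod N2" k2
    using gK k2 by (simp add: group_hom_def group_hom_axioms_def)
  have one: "K #>\<^bsub>P0\<^esub> x = \<one>\<^bsub>P0 Mod K\<^esub>" if "x \<in> K" for x
    using that K.rcos_const by (simp add: FactGroup_def)
  have i1: "inj_on k1 (carrier (P0 Mod K))"
  proof -
    have "X = \<one>\<^bsub>P0 Mod K\<^esub>" if X: "X \<in> carrier (P0 Mod K)" "k1 X = \<one>\<^bsub>P1 Mod N1\<^esub>" for X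
    proof -
      obtain x where x: "x \<in> carrier P0" "X = K #>\<^bsub>P0\<^esub> x" using carr X by blast
      then have "q1 (f1 x) = \<one>\<^bsub>P1 Mod N1\<^esub>" using X(2) k1(2)[OF x(1)] by simp
      then have "x \<in> K" using q1_one[OF f(1)[OF x(1)]] K x(1) by blast
      then show ?thesis using x one by simp
    qed
    then show ?thesis by (simp add: k1.inj_on_one_iff)
  qed
  have i2: "inj_on k2 (carrier (P0 Mod K))"
  proof -
    have "X = \<one>\<^bsub>P0 Mod K\<^esub>" if X: "X \<in> carrier (P0 Mod K)" "k2 X = \<one>\<^bsub>P2 Mod N2\<^esub>" for X
    proof -
      obtain x where x: "x \<in> carrier P0" "X = K #>\<^bsub>P0\<^esub> x" using carr X by blast
      then have "q2 (f2 x) = \<one>\<^bsub>P2 Mod N2\<^esub>" using X(2) k2(2)[OF x(1)] by simp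
      then have "x \<in> K" using q2_one[OF f(2)[OF x(1)]] K x(1) N(3) by blast
      then show ?thesis using x one by simp
    qed
    then show ?thesis by (simp add: k2.inj_on_one_iff)
  qed
  have fin: "finite (carrier (P0 Mod K))" and fin1: "finite (carrier (P1 Mod N1))"
    and fin2: "finite (carrier (P2 Mod N2))"
    using P0 P1 P2 by (simp_all add: FactGroup_def RCOSETS_def)
  obtain m e1 e2 where e: "8 \<le> m" "e1 \<in> hom (P1 Mod N1) (alt_group m)" "e2 \<in> hom (P2 Mod N2) (alt_group m)"
    "\<And>x. x \<in> carrier (P1 Mod N1) \<Longrightarrow> e1 x = id \<longleftrightarrow> x = \<one>\<^bsub>P1 Mod N1\<^esub>"
    "\<And>x. x \<in> carrier (P2 Mod N2) \<Longrightarrow> e2 x = id \<longleftrightarrow> x = \<one>\<^bsub>P2 Mod N2\<^esub>"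
    "\<And>h. h \<in> carrier (P0 Mod K) \<Longrightarrow> e1 (k1 h) = e2 (k2 h)"
    using amalgamation_in_alt_group[OF gK fin N1.factorgroup_is_group fin1
      N2.factorgroup_is_group fin2 k1(1) i1 k2(1) i2] by blast
  show ?thesis
  proof (rule that[OF e(1), of "e1 \<circ> q1" "e2 \<circ> q2"])
    show "e1 \<circ> q1 \<in> hom P1 (alt_group m)" "e2 \<circ> q2 \<in> hom P2 (alt_group m)"
      by (rule hom_compose[OF q1(1) e(2)], rule hom_compose[OF q1(2) e(3)])
    show "(e1 \<circ> q1) x = id \<longleftrightarrow> x \<in> N1" if "x \<in> carrier P1" for x
      using that e(4)[of "q1 x"] q1_one[of x] q1(1) by (auto simp: hom_def)
    show "(e2 \<circ> q2) x = id \<longleftrightarrow> x \<in> N2" if "x \<in> carrier P2" for x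
      using that e(5)[of "q2 x"] q2_one[of x] q1(2) by (auto simp: hom_def)
    show "(e1 \<circ> q1) (f1 x) = (e2 \<circ> q2) (f2 x)" if "x \<in> carrier P0" for x
      using that e(6)[of "K #>\<^bsub>P0\<^esub> x"] k1(2) k2(2) by (auto simp: FactGroup_def RCOSETS_def)
  qed
qed

section \<open>Amalgamation of normed groups\<close>

context distributive_semilattice0
begin

text \<open>The factors of \<open>Q\<close> are indexed by the complements of ideals with nonzero label. The element
  \<open>a\<close> is added to the set of norms so that it is a join of labels, too, and thus the norm of an
  element of \<open>Q\<close>.\<close>

lemma normed_amalgamation:
  assumes P0: "normed P0 \<nu>0" "finite (carrier P0)"
    and P1: "normed P1 \<nu>1" "finite (carrier P1)" and P2: "normed P2 \<nu>2" "finite (carrier P2)"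
    and f1: "f1 \<in> hom P0 P1" "\<And>x. x \<in> carrier P0 \<Longrightarrow> \<nu>1 (f1 x) = \<nu>0 x"
    and f2: "f2 \<in> hom P0 P2" "\<And>x. x \<in> carrier P0 \<Longrightarrow> \<nu>2 (f2 x) = \<nu>0 x"
    and a: "a \<in> carrier S"
  obtains Q :: "(nat \<Rightarrow> nat \<Rightarrow> nat) monoid" and \<mu> g1 g2 where
    "Q \<in> alternating_products" "finite (carrier Q)" "normed Q \<mu>"
    "g1 \<in> hom P1 Q" "\<And>x. x \<in> carrier P1 \<Longrightarrow> \<mu> (g1 x) = \<nu>1 x"
    "g2 \<in> hom P2 Q" "\<And>x. x \<in> carrier P2 \<Longrightarrow> \<mu> (g2 x) = \<nu>2 x"
    "\<And>x. x \<in> carrier P0 \<Longrightarrow> g1 (f1 x) = g2 (f2 x)"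
    "a \<in> \<mu> ` carrier Q"
    "\<And>x y z. x \<in> carrier P2 \<Longrightarrow> y \<in> carrier P2 \<Longrightarrow> z \<in> carrier P2 \<Longrightarrow> \<nu>2 z \<sqsubseteq> \<nu>2 x \<squnion> \<nu>2 y \<Longrightarrow>
      g2 z \<in> normal_closure Q {g2 x, g2 y}"
proof -
  define V where "V = insert a (\<nu>1 ` carrier P1 \<union> \<nu>2 ` carrier P2)"
  have V: "finite V" "V \<subseteq> carrier S" "\<nu>1 ` carrier P1 \<subseteq> V" "\<nu>2 ` carrier P2 \<subseteq> V" "a \<in> V"
    using P1(2) P2(2) a normedD(2)[OF P1(1)] normedD(2)[OF P2(1)] by (auto simp: V_def)
  obtain t where t: "\<And>X. t X \<in> carrier S"
    "\<And>v b. v \<in> V \<Longrightarrow> b \<in> carrier S \<Longrightarrow>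
      v \<sqsubseteq> b \<longleftrightarrow> (\<forall>X. ideal_complement V X \<longrightarrow> v \<in> X \<longrightarrow> t X \<sqsubseteq> b)"
    using ideal_complement_labels[OF V(1,2)] by blast
  define \<K> where "\<K> = {X. ideal_complement V X \<and> t X \<noteq> \<bottom>}"
  have "finite \<K>"
    by (rule finite_subset[of _ "Pow V"]) (use V in \<open>auto simp: \<K>_def ideal_complement_def\<close>)
  then obtain X where X: "bij_betw X {0..<card \<K>} \<K>"
    using ex_bij_betw_nat_finite by blast
  define k where "k = card \<K>"
  have X_compl: "ideal_complement V (X j)" "t (X j) \<noteq> \<bottom>" if "j < k" for j
    using X that by (auto simp: bij_betw_def \<K>_def k_def)
  have X_all: "\<exists>j<k. Y = X j" if "ideal_complement V Y" "t Y \<noteq> \<bottom>" for Y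
  proof -
    have "Y \<in> X ` {0..<card \<K>}" using X that by (simp add: bij_betw_def \<K>_def)
    then show ?thesis by (auto simp: k_def)
  qed
  have label: "v \<sqsubseteq> b \<longleftrightarrow> (\<forall>j<k. v \<in> X j \<longrightarrow> t (X j) \<sqsubseteq> b)" if "v \<in> V" "b \<in> carrier S" for v b
    unfolding t(2)[OF that] using X_compl X_all that by (metis bottom_lower)
  define amalgam where "amalgam j m e1 e2 \<longleftrightarrow>
    8 \<le> m \<and> e1 \<in> hom P1 (alt_group m) \<and> e2 \<in> hom P2 (alt_group m) \<and>
    (\<forall>x\<in>carrier P1. e1 x = id \<longleftrightarrow> \<nu>1 x \<notin> X j) \<and>
    (\<forall>x\<in>carrier P2. e2 x = id \<longleftrightarrow> \<nu>2 x \<notin> X j) \<and>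
    (\<forall>x\<in>carrier P0. e1 (f1 x) = e2 (f2 x))" for j m e1 e2
  have "\<exists>m e1 e2. amalgam j m e1 e2" if j: "j < k" for j
  proof -
    have f: "f1 x \<in> carrier P1" "f2 x \<in> carrier P2" if "x \<in> carrier P0" for x
      using that f1(1) f2(1) by (auto simp: hom_def)
    have 1: "{x \<in> carrier P1. \<nu>1 x \<notin> X j} \<lhd> P1"
      by (rule normal_subgroup_of_ideal_complement[OF P1(1) V(1,2,3) X_compl(1)[OF j]])
    have 2: "{x \<in> carrier P2. \<nu>2 x \<notin> X j} \<lhd> P2"
      by (rule normal_subgroup_of_ideal_complement[OF P2(1) V(1,2,4) X_compl(1)[OF j]])
    have 3: "f1 x \<in> {x \<in> carrier P1. \<nu>1 x \<notin> X j} \<longleftrightarrow> f2 x \<in> {x \<in> carrier P2. \<nu>2 x \<notin> X j}"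
      if "x \<in> carrier P0" for x
      using that f f1(2) f2(2) by simp
    obtain m e1 e2 where "8 \<le> m" "e1 \<in> hom P1 (alt_group m)" "e2 \<in> hom P2 (alt_group m)"
      "\<And>x. x \<in> carrier P1 \<Longrightarrow> e1 x = id \<longleftrightarrow> x \<in> {x \<in> carrier P1. \<nu>1 x \<notin> X j}"
      "\<And>x. x \<in> carrier P2 \<Longrightarrow> e2 x = id \<longleftrightarrow> x \<in> {x \<in> carrier P2. \<nu>2 x \<notin> X j}"
      "\<And>x. x \<in> carrier P0 \<Longrightarrow> e1 (f1 x) = e2 (f2 x)"
      using amalgamation_with_kernels[OF normedD(1)[OF P0(1)] P0(2) normedD(1)[OF P1(1)] P1(2)
        normedD(1)[OF P2(1)] P2(2) f1(1) f2(1) 1 2 3] by blast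
    then show ?thesis
      by (intro exI[of _ m] exI[of _ e1] exI[of _ e2]) (auto simp: amalgam_def)
  qed
  then obtain n e1 e2 where "\<And>j. j < k \<Longrightarrow> amalgam j (n j) (e1 j) (e2 j)"
    by metis
  then have e: "\<And>j. j < k \<Longrightarrow> 8 \<le> n j"
    "\<And>j. j < k \<Longrightarrow> e1 j \<in> hom P1 (alt_group (n j))" "\<And>j. j < k \<Longrightarrow> e2 j \<in> hom P2 (alt_group (n j))"
    "\<And>j x. j < k \<Longrightarrow> x \<in> carrier P1 \<Longrightarrow> e1 j x = id \<longleftrightarrow> \<nu>1 x \<notin> X j"
    "\<And>j x. j < k \<Longrightarrow> x \<in> carrier P2 \<Longrightarrow> e2 j x = id \<longleftrightarrow> \<nu>2 x \<notin> X j"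
    "\<And>j x. j < k \<Longrightarrow> x \<in> carrier P0 \<Longrightarrow> e1 j (f1 x) = e2 j (f2 x)"
    by (simp_all add: amalgam_def)
  define Q where "Q = alt_product k n"
  define \<mu> where "\<mu> = alt_norm k (\<lambda>j. t (X j))"
  define g1 where "g1 x = (\<lambda>j\<in>{..<k}. e1 j x)" for x
  define g2 where "g2 x = (\<lambda>j\<in>{..<k}. e2 j x)" for x
  have \<mu>_eq: "\<mu> q = v" if v: "v \<in> V" and q: "\<And>j. j < k \<Longrightarrow> q j = id \<longleftrightarrow> v \<notin> X j" for q v
  proof (rule eq_if_same_upper_bounds)
    have fin: "finite ((\<lambda>j. t (X j)) ` {j. j < k \<and> q j \<noteq> id})"
      "(\<lambda>j. t (X j)) ` {j. j < k \<and> q j \<noteq> id} \<subseteq> carrier S" using t(1) by auto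
    then show "\<mu> q \<in> carrier S" unfolding \<mu>_def alt_norm_def by (rule fjoin_closed)
    show "v \<in> carrier S" using v V by blast
    show "\<mu> q \<sqsubseteq> b \<longleftrightarrow> v \<sqsubseteq> b" if b: "b \<in> carrier S" for b
      unfolding \<mu>_def alt_norm_def fjoin_le_iff[OF fin b] label[OF v b] using q by auto
  qed
  have Q: "Q \<in> alternating_products" "finite (carrier Q)" "normed Q \<mu>"
  proof -
    have "5 \<le> n j" if "j < k" for j using e(1)[OF that] by simp
    then show "Q \<in> alternating_products"
      unfolding Q_def by (rule alt_product_in_alternating_products)
    show "finite (carrier Q)" unfolding Q_def by (rule finite_alt_product)
    show "normed Q \<mu>" unfolding Q_def \<mu>_def using t(1) X_compl(2) by (rule normed_alt_product)
  qed
  interpret Q: group Q by (rule normedD(1)[OF Q(3)])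
  have g1: "g1 \<in> hom P1 Q"
    unfolding Q_def g1_def using e(2) by (auto simp: hom_def Pi_iff)
  have g2: "g2 \<in> hom P2 Q"
    unfolding Q_def g2_def using e(3) by (auto simp: hom_def Pi_iff)
  show ?thesis
  proof (rule that[OF Q g1 _ g2])
    show "\<mu> (g1 x) = \<nu>1 x" if "x \<in> carrier P1" for x
      using that V by (intro \<mu>_eq) (auto simp: g1_def e)
    show "\<mu> (g2 x) = \<nu>2 x" if "x \<in> carrier P2" for x
      using that V by (intro \<mu>_eq) (auto simp: g2_def e)
    show "g1 (f1 x) = g2 (f2 x)" if "x \<in> carrier P0" for x
      using that by (auto simp: g1_def g2_def e)
    show "a \<in> \<mu> ` carrier Q"
    proof (rule image_eqI)
      define q where "q = (\<lambda>j\<in>{..<k}. if a \<in> X j then cycle_of_list [1, 2, 3 :: nat] else id)"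
      have c: "cycle_of_list [1, 2, 3 :: nat] \<in> carrier (alt_group (n j))" if "j < k" for j
        by (rule three_cycle_in_alt_group) (use e(1)[OF that] in auto)
      have "cycle_of_list [1, 2, 3 :: nat] 1 = 2" by (subst three_cycle_apply) auto
      then have "cycle_of_list [1, 2, 3 :: nat] \<noteq> id"
        by (auto simp del: cycle_of_list.simps)
      then show "a = \<mu> q"
        using V by (intro \<mu>_eq[symmetric]) (auto simp: q_def simp del: cycle_of_list.simps)
      have "id \<in> carrier (alt_group m)" for m by (simp add: alt_group_carrier permutes_id)
      then show "q \<in> carrier Q"
        using c by (auto simp: Q_def q_def simp del: cycle_of_list.simps)
    qed
    fix x y z assume xyz: "x \<in> carrier P2" "y \<in> carrier P2" "z \<in> carrier P2" "\<nu>2 z \<sqsubseteq> \<nu>2 x \<squnion> \<nu>2 y"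
    have "g2 x \<in> carrier Q" "g2 y \<in> carrier Q" "g2 z \<in> carrier Q"
      using g2 xyz by (auto simp: hom_def)
    then have N: "normal_closure Q {g2 x, g2 y} \<lhd> Q"
      by (intro Q.normal_normal_closure) auto
    show "g2 z \<in> normal_closure Q {g2 x, g2 y}"
    proof (rule normal_alt_product_memI[OF e(1) N[unfolded Q_def], folded Q_def])
      show "g2 z \<in> carrier Q" by fact
      fix j assume j: "j < k" "g2 z j \<noteq> id"
      have v: "\<nu>2 x \<in> V" "\<nu>2 y \<in> V" using V xyz by auto
      have "\<nu>2 z \<in> X j" using j e(5)[OF j(1) xyz(3)] by (simp add: g2_def)
      moreover have "\<nu>2 z \<sqsubseteq> fjoin {\<nu>2 x, \<nu>2 y}"
        using xyz v V fjoin_doubleton[of "\<nu>2 x" "\<nu>2 y"] by (auto simp: subset_iff)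
      ultimately have "{\<nu>2 x, \<nu>2 y} \<inter> X j \<noteq> {}"
        using X_compl(1)[OF j(1)] v unfolding ideal_complement_def by (metis empty_subsetI insert_subset)
      then have "g2 x j \<noteq> id \<or> g2 y j \<noteq> id"
        using j xyz e(5) by (auto simp: g2_def)
      then show "\<exists>w\<in>normal_closure Q {g2 x, g2 y}. w j \<noteq> id"
        using Q.subset_normal_closure[of "{g2 x, g2 y}"] by blast
    qed
  qed
qed

end

section \<open>Saturated groups, unions of chains and renaming\<close>

text \<open>The preimage of a normal subgroup is normal.\<close>

lemma normal_closure_hom_image:
  assumes "group G" "group H" "f \<in> hom G H" "A \<subseteq> carrier G" "x \<in> normal_closure G A"
  shows "f x \<in> normal_closure H (f ` A)"
proof -
  interpret f: group_hom G H f using assms by (simp add: group_hom_def group_hom_axioms_def)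
  have "f ` A \<subseteq> carrier H" using assms by auto
  then interpret N: normal "normal_closure H (f ` A)" H by (rule f.H.normal_normal_closure)
  let ?M = "{x \<in> carrier G. f x \<in> normal_closure H (f ` A)}"
  have "subgroup ?M G"
    by (rule f.G.subgroupI) auto
  moreover have "y \<otimes>\<^bsub>G\<^esub> x \<otimes>\<^bsub>G\<^esub> inv\<^bsub>G\<^esub> y \<in> ?M" if "x \<in> ?M" "y \<in> carrier G" for x y
    using that N.inv_op_closed2[of "f y" "f x"] by simp
  ultimately have "?M \<lhd> G" by (simp add: f.G.normal_inv_iff)
  moreover have "A \<subseteq> ?M" using assms f.H.subset_normal_closure[of "f ` A"] by auto
  ultimately have "normal_closure G A \<subseteq> ?M" by (rule f.G.normal_closure_least)
  then show ?thesis using assms by blast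
qed

lemma alternating_products_iso:
  assumes "G \<in> alternating_products" "f \<in> iso G H" "group H"
  shows "H \<in> alternating_products"
proof -
  have G: "group G" using assms by (simp add: alternating_products_def)
  then have "H \<cong> G" using group.iso_sym[OF G] assms(2) is_isoI by blast
  then show ?thesis
    using assms(1,3) iso_trans unfolding alternating_products_def by blast
qed

lemma alternating_subgroup_image:
  assumes "group G" "group H" "f \<in> hom G H" "inj_on f (carrier G)"
    and "subgroup P G" "G\<lparr>carrier := P\<rparr> \<in> alternating_products"
  shows "subgroup (f ` P) H" "H\<lparr>carrier := f ` P\<rparr> \<in> alternating_products"
proof -
  interpret f: group_hom G H f using assms by (simp add: group_hom_def group_hom_axioms_def)
  show sub: "subgroup (f ` P) H" using assms(5) by (rule f.subgroup_img_is_subgroup)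
  have "P \<subseteq> carrier G" using assms(5) by (rule subgroup.subset)
  then have "f \<in> iso (G\<lparr>carrier := P\<rparr>) (H\<lparr>carrier := f ` P\<rparr>)"
    using assms(4) by (auto simp: iso_def hom_def bij_betw_def subset_iff intro: inj_on_subset)
  then show "H\<lparr>carrier := f ` P\<rparr> \<in> alternating_products"
    using alternating_products_iso[OF assms(6)] f.H.subgroup_imp_group[OF sub] by blast
qed

definition locally_alternating :: "'g monoid \<Rightarrow> bool" where
  "locally_alternating G \<longleftrightarrow> (\<forall>A. finite A \<and> A \<subseteq> carrier G \<longrightarrow>
    (\<exists>P. A \<subseteq> P \<and> finite P \<and> subgroup P G \<and> G\<lparr>carrier := P\<rparr> \<in> alternating_products))"

context distributive_semilattice0
begin

text \<open>Two generators are used in order to describe joins: control by single elements does not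
  provide an element of norm \<open>\<nu> x \<squnion> \<nu> y\<close> in the normal closure of \<open>{x, y}\<close>.\<close>

definition norm_controlled :: "'g monoid \<Rightarrow> ('g \<Rightarrow> 'a) \<Rightarrow> bool" where
  "norm_controlled G \<nu> \<longleftrightarrow> (\<forall>x\<in>carrier G. \<forall>y\<in>carrier G. \<forall>z\<in>carrier G.
    \<nu> z \<sqsubseteq> \<nu> x \<squnion> \<nu> y \<longrightarrow> z \<in> normal_closure G {x, y})"

definition saturated :: "'g monoid \<Rightarrow> ('g \<Rightarrow> 'a) \<Rightarrow> bool" where
  "saturated G \<nu> \<longleftrightarrow> normed G \<nu> \<and> locally_alternating G \<and> norm_controlled G \<nu>"

definition norm_hom :: "('g, 'm) monoid_scheme \<Rightarrow> ('g \<Rightarrow> 'a) \<Rightarrow> ('h, 'n) monoid_scheme \<Rightarrow> ('h \<Rightarrow> 'a) \<Rightarrow> ('g \<Rightarrow> 'h) set" where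
  "norm_hom G \<nu> H \<mu> = {f \<in> hom G H. \<forall>x\<in>carrier G. \<mu> (f x) = \<nu> x}"

text \<open>Normed groups are paired here, so that chains of normed groups can be formed.\<close>

definition extends :: "'g monoid \<times> ('g \<Rightarrow> 'a) \<Rightarrow> 'g monoid \<times> ('g \<Rightarrow> 'a) \<Rightarrow> bool" where
  "extends p q \<longleftrightarrow> carrier (fst p) \<subseteq> carrier (fst q) \<and>
    (\<lambda>x. x) \<in> norm_hom (fst p) (snd p) (fst q) (snd q)"

lemma extends_iff:
  "extends p q \<longleftrightarrow> carrier (fst p) \<subseteq> carrier (fst q) \<and>
    (\<forall>x\<in>carrier (fst p). \<forall>y\<in>carrier (fst p). x \<otimes>\<^bsub>fst p\<^esub> y = x \<otimes>\<^bsub>fst q\<^esub> y) \<and>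
    (\<forall>x\<in>carrier (fst p). snd q x = snd p x)"
  by (auto simp: extends_def norm_hom_def hom_def)

lemma extends_refl: "extends p p"
  by (simp add: extends_iff)

lemma extends_trans:
  assumes "extends p q" "extends q r" shows "extends p r"
proof -
  have "x \<in> carrier (fst q)" if "x \<in> carrier (fst p)" for x
    using assms(1) that by (auto simp: extends_iff)
  then show ?thesis using assms unfolding extends_iff by auto
qed

lemma extends_image: "extends p q \<Longrightarrow> snd p ` carrier (fst p) \<subseteq> snd q ` carrier (fst q)"
  unfolding extends_iff by (metis image_mono image_cong)

lemma norm_hom_inj:
  "normed G \<nu> \<Longrightarrow> normed H \<mu> \<Longrightarrow> f \<in> norm_hom G \<nu> H \<mu> \<Longrightarrow> inj_on f (carrier G)"
  using normed_hom_inj unfolding norm_hom_def by blast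

lemma extends_group_hom:
  assumes "extends p q" "normed (fst p) (snd p)" "normed (fst q) (snd q)"
  shows "group_hom (fst p) (fst q) (\<lambda>x. x)"
  using assms normedD(1) by (auto simp: extends_def norm_hom_def group_hom_def group_hom_axioms_def)

text \<open>Products and norms are computed in an arbitrary member of the chain that contains the
  arguments; any two choices agree because the members are comparable.\<close>

lemma normed_chain_union:
  fixes C :: "('g monoid \<times> ('g \<Rightarrow> 'a)) set"
  assumes ne: "C \<noteq> {}" and normed: "\<And>p. p \<in> C \<Longrightarrow> normed (fst p) (snd p)"
    and chain: "\<And>p q. p \<in> C \<Longrightarrow> q \<in> C \<Longrightarrow> extends p q \<or> extends q p"
  obtains U where "normed (fst U) (snd U)" "carrier (fst U) = (\<Union>p\<in>C. carrier (fst p))"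
    "\<And>p. p \<in> C \<Longrightarrow> extends p U"
proof -
  define c where "c = (\<Union>p\<in>C. carrier (fst p))"
  define m where "m x y = (SOME z. \<exists>p\<in>C. x \<in> carrier (fst p) \<and> y \<in> carrier (fst p) \<and> z = x \<otimes>\<^bsub>fst p\<^esub> y)" for x y
  define \<nu> where "\<nu> x = (SOME a. \<exists>p\<in>C. x \<in> carrier (fst p) \<and> a = snd p x)" for x
  obtain p0 where p0: "p0 \<in> C" using ne by blast
  define G where "G = \<lparr>carrier = c, monoid.mult = m, one = \<one>\<^bsub>fst p0\<^esub>\<rparr>"
  have m: "m x y = x \<otimes>\<^bsub>fst p\<^esub> y" if p: "p \<in> C" "x \<in> carrier (fst p)" "y \<in> carrier (fst p)" for p x y
  proof -
    have "x \<otimes>\<^bsub>fst q\<^esub> y = x \<otimes>\<^bsub>fst p\<^esub> y" if "q \<in> C" "x \<in> carrier (fst q)" "y \<in> carrier (fst q)" for q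
      using chain[OF p(1) that(1)] p that by (auto simp: extends_iff)
    then show ?thesis unfolding m_def using p by (intro some_equality) blast+
  qed
  have \<nu>: "\<nu> x = snd p x" if p: "p \<in> C" "x \<in> carrier (fst p)" for p x
  proof -
    have "snd q x = snd p x" if "q \<in> C" "x \<in> carrier (fst q)" for q
      using chain[OF p(1) that(1)] p that by (auto simp: extends_iff)
    then show ?thesis unfolding \<nu>_def using p by (intro some_equality) blast+
  qed
  have one: "\<one>\<^bsub>fst p\<^esub> = \<one>\<^bsub>fst p0\<^esub>" if p: "p \<in> C" for p
    using chain[OF p p0] group_hom.hom_one[OF extends_group_hom] normed[OF p] normed[OF p0] by metis
  have common: "\<exists>p\<in>C. x \<in> carrier (fst p) \<and> y \<in> carrier (fst p)" if xy: "x \<in> c" "y \<in> c" for x y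
  proof -
    obtain p where "p \<in> C" "x \<in> carrier (fst p)" using xy(1) unfolding c_def by blast
    moreover obtain q where "q \<in> C" "y \<in> carrier (fst q)" using xy(2) unfolding c_def by blast
    ultimately show ?thesis using chain[of p q] by (auto simp: extends_iff)
  qed
  have common3: "\<exists>p\<in>C. x \<in> carrier (fst p) \<and> y \<in> carrier (fst p) \<and> z \<in> carrier (fst p)"
    if xyz: "x \<in> c" "y \<in> c" "z \<in> c" for x y z
  proof -
    obtain p q where "p \<in> C" "q \<in> C" "x \<in> carrier (fst p)" "y \<in> carrier (fst p)" "z \<in> carrier (fst q)"
      using common[OF xyz(1,2)] xyz(3) unfolding c_def by blast
    then show ?thesis using chain[of p q] by (auto simp: extends_iff)
  qed
  have carr: "x \<in> c" if "p \<in> C" "x \<in> carrier (fst p)" for p x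
    using that by (auto simp: c_def)
  have gr: "group (fst p)" if "p \<in> C" for p using normedD(1)[OF normed[OF that]] .
  have G: "group G"
  proof (rule groupI)
    show "\<one>\<^bsub>G\<^esub> \<in> carrier G"
      using carr[OF p0] gr[OF p0] by (simp add: G_def group.is_monoid)
    show "x \<otimes>\<^bsub>G\<^esub> y \<in> carrier G" if "x \<in> carrier G" "y \<in> carrier G" for x y
      using common[of x y] that m carr gr by (auto simp: G_def) (metis group.is_monoid monoid.m_closed)
    show "x \<otimes>\<^bsub>G\<^esub> y \<otimes>\<^bsub>G\<^esub> z = x \<otimes>\<^bsub>G\<^esub> (y \<otimes>\<^bsub>G\<^esub> z)"
      if xyz: "x \<in> carrier G" "y \<in> carrier G" "z \<in> carrier G" for x y z
    proof -
      obtain p where p: "p \<in> C" "x \<in> carrier (fst p)" "y \<in> carrier (fst p)" "z \<in> carrier (fst p)"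
        using common3[of x y z] xyz by (auto simp: G_def)
      interpret p: group "fst p" using gr p by blast
      show ?thesis using p by (simp add: G_def m p.m_assoc)
    qed
    show "\<one>\<^bsub>G\<^esub> \<otimes>\<^bsub>G\<^esub> x = x" if x: "x \<in> carrier G" for x
    proof -
      obtain p where p: "p \<in> C" "x \<in> carrier (fst p)" using x by (auto simp: G_def c_def)
      interpret p: group "fst p" using gr p by blast
      show ?thesis
        using p.l_one[OF p(2)] m[OF p(1) p.one_closed p(2)] one[OF p(1)] by (simp add: G_def)
    qed
    show "\<exists>y\<in>carrier G. y \<otimes>\<^bsub>G\<^esub> x = \<one>\<^bsub>G\<^esub>" if x: "x \<in> carrier G" for x
    proof -
      obtain p where p: "p \<in> C" "x \<in> carrier (fst p)" using x by (auto simp: G_def c_def)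
      interpret p: group "fst p" using gr p by blast
      show ?thesis
        using p m[OF p(1) p.inv_closed[OF p(2)] p(2)] one[OF p(1)] carr[OF p(1) p.inv_closed[OF p(2)]]
        by (intro bexI[of _ "inv\<^bsub>fst p\<^esub> x"]) (simp_all add: G_def)
    qed
  qed
  have hom: "group_hom (fst p) G (\<lambda>x. x)" if "p \<in> C" for p
    using that G gr carr m by (auto simp: group_hom_def group_hom_axioms_def hom_def G_def)
  have inv: "inv\<^bsub>G\<^esub> x = inv\<^bsub>fst p\<^esub> x" if "p \<in> C" "x \<in> carrier (fst p)" for p x
    using group_hom.hom_inv[OF hom[OF that(1)] that(2)] by simp
  have "normed G \<nu>"
    unfolding normed_def
  proof (intro conjI ballI)
    show "group G" by fact
    fix x assume "x \<in> carrier G"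
    then have x: "x \<in> c" by (simp add: G_def)
    then obtain p where p: "p \<in> C" "x \<in> carrier (fst p)" by (auto simp: c_def)
    note n = normedD[OF normed[OF p(1)]]
    interpret p: group "fst p" by (rule n(1))
    show "\<nu> x \<in> carrier S" "\<nu> x = \<bottom> \<longleftrightarrow> x = \<one>\<^bsub>G\<^esub>"
      using n(2,3)[OF p(2)] one[OF p(1)] by (simp_all add: \<nu>[OF p] G_def)
    show "\<nu> (inv\<^bsub>G\<^esub> x) \<sqsubseteq> \<nu> x"
      using n(5)[OF p(2)] p by (simp add: inv[OF p] \<nu>[OF p(1)])
    fix y assume "y \<in> carrier G"
    then have y: "y \<in> c" by (simp add: G_def)
    obtain q where q: "q \<in> C" "x \<in> carrier (fst q)" "y \<in> carrier (fst q)" using common[OF x y] by blast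
    note n = normedD[OF normed[OF q(1)]]
    interpret q: group "fst q" by (rule n(1))
    show "\<nu> (x \<otimes>\<^bsub>G\<^esub> y) \<sqsubseteq> \<nu> x \<squnion> \<nu> y"
      using n(4)[OF q(2,3)] q by (simp add: G_def m[OF q] \<nu>[OF q(1)])
    have "y \<otimes>\<^bsub>G\<^esub> x \<otimes>\<^bsub>G\<^esub> inv\<^bsub>G\<^esub> y = y \<otimes>\<^bsub>fst q\<^esub> x \<otimes>\<^bsub>fst q\<^esub> inv\<^bsub>fst q\<^esub> y"
      using q m[OF q(1)] by (simp add: inv[OF q(1,3)]) (simp add: G_def)
    then show "\<nu> (y \<otimes>\<^bsub>G\<^esub> x \<otimes>\<^bsub>G\<^esub> inv\<^bsub>G\<^esub> y) \<sqsubseteq> \<nu> x"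
      using n(6)[OF q(2,3)] q by (simp add: \<nu>[OF q(1)])
  qed
  moreover have "extends p (G, \<nu>)" if "p \<in> C" for p
    using carr[OF that] m[OF that] \<nu>[OF that] by (simp add: extends_iff G_def subset_iff)
  ultimately show ?thesis
    using that[of "(G, \<nu>)"] by (simp add: G_def c_def)
qed

lemma finite_subset_chain_union:
  assumes ne: "C \<noteq> {}" and chain: "\<And>p q. p \<in> C \<Longrightarrow> q \<in> C \<Longrightarrow> extends p q \<or> extends q p"
    and "finite A" "A \<subseteq> (\<Union>p\<in>C. carrier (fst p))"
  shows "\<exists>p\<in>C. A \<subseteq> carrier (fst p)"
  using assms(3,4)
proof (induction rule: finite_induct)
  case empty
  then show ?case using ne by auto
next
  case (insert x A)
  then obtain p q where pq: "p \<in> C" "q \<in> C" "A \<subseteq> carrier (fst p)" "x \<in> carrier (fst q)" by auto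
  then show ?case using chain[of p q] by (auto simp: extends_iff)
qed

text \<open>For two of the properties it is enough that they hold in some other member of the chain. This
  covers the sequence of amalgams, whose members need not be saturated.\<close>

lemma saturated_chain_union:
  assumes ne: "C \<noteq> {}" and chain: "\<And>p q. p \<in> C \<Longrightarrow> q \<in> C \<Longrightarrow> extends p q \<or> extends q p"
    and U: "normed (fst U) (snd U)" "carrier (fst U) = (\<Union>p\<in>C. carrier (fst p))"
      "\<And>p. p \<in> C \<Longrightarrow> extends p U"
    and normed: "\<And>p. p \<in> C \<Longrightarrow> normed (fst p) (snd p)"
    and alt: "\<And>p A. p \<in> C \<Longrightarrow> finite A \<Longrightarrow> A \<subseteq> carrier (fst p) \<Longrightarrow> \<exists>q\<in>C. \<exists>P. A \<subseteq> P \<and> finite P \<and>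
      subgroup P (fst q) \<and> (fst q)\<lparr>carrier := P\<rparr> \<in> alternating_products"
    and ctrl: "\<And>p x y z. p \<in> C \<Longrightarrow> x \<in> carrier (fst p) \<Longrightarrow> y \<in> carrier (fst p) \<Longrightarrow> z \<in> carrier (fst p) \<Longrightarrow>
      snd p z \<sqsubseteq> snd p x \<squnion> snd p y \<Longrightarrow> \<exists>q\<in>C. extends p q \<and> z \<in> normal_closure (fst q) {x, y}"
  shows "saturated (fst U) (snd U)"
  unfolding saturated_def
proof (intro conjI)
  show "normed (fst U) (snd U)" by fact
  show "locally_alternating (fst U)"
    unfolding locally_alternating_def
  proof (intro allI impI)
    fix A assume A: "finite A \<and> A \<subseteq> carrier (fst U)"
    then obtain p where "p \<in> C" "A \<subseteq> carrier (fst p)"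
      using finite_subset_chain_union[OF ne chain] U(2) by metis
    then obtain q P where q: "q \<in> C" "A \<subseteq> P" "finite P" "subgroup P (fst q)"
      "(fst q)\<lparr>carrier := P\<rparr> \<in> alternating_products"
      using alt A by metis
    interpret group_hom "fst q" "fst U" "\<lambda>x. x"
      using extends_group_hom U q normed by blast
    have "inj_on (\<lambda>x. x) (carrier (fst q))" by simp
    then show "\<exists>P. A \<subseteq> P \<and> finite P \<and> subgroup P (fst U) \<and> (fst U)\<lparr>carrier := P\<rparr> \<in> alternating_products"
      using alternating_subgroup_image[OF G.is_group H.is_group homh _ q(4,5)] q by (intro exI[of _ P]) simp
  qed
  show "norm_controlled (fst U) (snd U)"
    unfolding norm_controlled_def
  proof (intro ballI impI)
    fix x y z assume xyz: "x \<in> carrier (fst U)" "y \<in> carrier (fst U)" "z \<in> carrier (fst U)"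
      "snd U z \<sqsubseteq> snd U x \<squnion> snd U y"
    then obtain p where p: "p \<in> C" "{x, y, z} \<subseteq> carrier (fst p)"
      using finite_subset_chain_union[OF ne chain, of "{x, y, z}"] U(2) by auto
    then have "snd p z \<sqsubseteq> snd p x \<squnion> snd p y"
      using xyz(4) U(3)[OF p(1)] by (auto simp: extends_iff)
    then obtain q where q: "q \<in> C" "extends p q" "z \<in> normal_closure (fst q) {x, y}"
      using ctrl[OF p(1), of x y z] p(2) by blast
    interpret group_hom "fst q" "fst U" "\<lambda>x. x"
      using extends_group_hom U q normed by blast
    have "{x, y} \<subseteq> carrier (fst q)" using p q by (auto simp: extends_iff)
    then show "z \<in> normal_closure (fst U) {x, y}"
      using normal_closure_hom_image[OF G.is_group H.is_group homh _ q(3)] by simp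
  qed
qed

lemma normed_iso:
  assumes "normed K \<mu>" "e \<in> iso K K'" "group K'" "\<And>x. x \<in> carrier K \<Longrightarrow> \<mu>' (e x) = \<mu> x"
  shows "normed K' \<mu>'"
proof -
  note n = normedD[OF assms(1)]
  interpret e: group_hom K K' e
    using n(1) assms by (simp add: group_hom_def group_hom_axioms_def iso_def)
  have im: "carrier K' = e ` carrier K" and inj: "inj_on e (carrier K)"
    using assms(2) by (auto simp: iso_def bij_betw_def)
  show ?thesis
    unfolding normed_def im
  proof (intro conjI ballI; (elim imageE; simp only:)?)
    show "group K'" by fact
    fix x assume x: "x \<in> carrier K"
    show "\<mu>' (e x) \<in> carrier S" using n(2)[OF x] assms(4)[OF x] by simp
    show "\<mu>' (e x) = \<bottom> \<longleftrightarrow> e x = \<one>\<^bsub>K'\<^esub>"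
      using n(3)[OF x] assms(4)[OF x] inj_on_eq_iff[OF inj x e.G.one_closed] by simp
    show "\<mu>' (inv\<^bsub>K'\<^esub> e x) \<sqsubseteq> \<mu>' (e x)"
      using n(5)[OF x] assms(4)[OF x] assms(4)[OF e.G.inv_closed[OF x]] e.hom_inv[OF x] by simp
    fix y assume y: "y \<in> carrier K"
    show "\<mu>' (e x \<otimes>\<^bsub>K'\<^esub> e y) \<sqsubseteq> \<mu>' (e x) \<squnion> \<mu>' (e y)"
      using n(4)[OF x y] assms(4)[OF x] assms(4)[OF y] assms(4)[OF e.G.m_closed[OF x y]] e.hom_mult[OF x y] by simp
    have "e (y \<otimes>\<^bsub>K\<^esub> x \<otimes>\<^bsub>K\<^esub> inv\<^bsub>K\<^esub> y) = e y \<otimes>\<^bsub>K'\<^esub> e x \<otimes>\<^bsub>K'\<^esub> inv\<^bsub>K'\<^esub> e y"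
      using x y by simp
    then show "\<mu>' (e y \<otimes>\<^bsub>K'\<^esub> e x \<otimes>\<^bsub>K'\<^esub> inv\<^bsub>K'\<^esub> e y) \<sqsubseteq> \<mu>' (e x)"
      using n(6)[OF x y] assms(4)[OF x] assms(4)[of "y \<otimes>\<^bsub>K\<^esub> x \<otimes>\<^bsub>K\<^esub> inv\<^bsub>K\<^esub> y"] x y by simp
  qed
qed

lemma saturated_iso:
  assumes K: "saturated K \<mu>" and e: "e \<in> iso K K'" "group K'"
    and \<mu>': "\<And>x. x \<in> carrier K \<Longrightarrow> \<mu>' (e x) = \<mu> x"
  shows "saturated K' \<mu>'"
proof -
  have n: "normed K \<mu>" "locally_alternating K" "norm_controlled K \<mu>" using K by (auto simp: saturated_def)
  interpret e: group_hom K K' e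
    using normedD(1)[OF n(1)] e by (simp add: group_hom_def group_hom_axioms_def iso_def)
  have im: "carrier K' = e ` carrier K" and inj: "inj_on e (carrier K)"
    using e(1) by (auto simp: iso_def bij_betw_def)
  have "locally_alternating K'"
    unfolding locally_alternating_def
  proof (intro allI impI)
    fix A assume "finite A \<and> A \<subseteq> carrier K'"
    then obtain B where B: "B \<subseteq> carrier K" "finite B" "A = e ` B"
      unfolding im by (meson finite_subset_image)
    then obtain P where P: "B \<subseteq> P" "finite P" "subgroup P K" "K\<lparr>carrier := P\<rparr> \<in> alternating_products"
      using n(2) unfolding locally_alternating_def by blast
    show "\<exists>P. A \<subseteq> P \<and> finite P \<and> subgroup P K' \<and> K'\<lparr>carrier := P\<rparr> \<in> alternating_products"
      using alternating_subgroup_image[OF e.G.is_group e.H.is_group e.homh inj P(3,4)] B P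
      by (intro exI[of _ "e ` P"]) auto
  qed
  moreover have "norm_controlled K' \<mu>'"
    unfolding norm_controlled_def im
  proof (intro ballI impI, elim imageE, simp only:)
    fix x y z assume xyz: "x \<in> carrier K" "y \<in> carrier K" "z \<in> carrier K" "\<mu>' (e z) \<sqsubseteq> \<mu>' (e x) \<squnion> \<mu>' (e y)"
    then have "z \<in> normal_closure K {x, y}"
      using n(3) \<mu>' unfolding norm_controlled_def by simp
    then show "e z \<in> normal_closure K' {e x, e y}"
      using normal_closure_hom_image[OF e.G.is_group e.H.is_group e.homh, of "{x, y}" z] xyz by simp
  qed
  ultimately show ?thesis
    using normed_iso[OF n(1) e \<mu>'] by (simp add: saturated_def)
qed

text \<open>The elements in the image of \<open>f\<close> get their names from \<open>G\<close>, all the others unused names from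
  \<open>N\<close>. This turns an embedding into an inclusion, which allows unions instead of direct limits.\<close>

lemma rename_to_extension:
  fixes G :: "'g monoid" and K :: "'k monoid"
  assumes G: "normed G \<nu>" and K: "normed K \<mu>" and f: "f \<in> norm_hom G \<nu> K \<mu>"
    and count: "countable (carrier K)" and N: "infinite N" "N \<inter> carrier G = {}"
  obtains K' \<mu>' e where "extends (G, \<nu>) (K', \<mu>')" "normed K' \<mu>'" "e \<in> iso K K'"
    "\<forall>x\<in>carrier K. \<mu>' (e x) = \<mu> x" "\<forall>x\<in>carrier G. e (f x) = x"
    "carrier K' \<subseteq> carrier G \<union> N"
proof -
  interpret K: group K by (rule normedD(1)[OF K])
  have f': "f \<in> hom G K" "\<And>x. x \<in> carrier G \<Longrightarrow> \<mu> (f x) = \<nu> x" "inj_on f (carrier G)"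
    using f norm_hom_inj[OF G K f] by (auto simp: norm_hom_def)
  obtain s :: "nat \<Rightarrow> 'g" where s: "inj s" "range s \<subseteq> N"
    using infinite_countable_subset[OF N(1)] by blast
  define e where "e x = (if x \<in> f ` carrier G then inv_into (carrier G) f x
    else s (to_nat_on (carrier K) x))" for x
  have e1: "e (f x) = x" if "x \<in> carrier G" for x
    using that f'(3) by (simp add: e_def)
  have e1': "e x \<in> carrier G" if "x \<in> f ` carrier G" for x
    using that e1 by auto
  have e2: "e x \<in> N" if "x \<notin> f ` carrier G" for x
    using that s by (auto simp: e_def)
  have inj: "inj_on e (carrier K)"
  proof (rule inj_onI)
    fix x y assume xy: "x \<in> carrier K" "y \<in> carrier K" "e x = e y"
    show "x = y"
    proof (cases "x \<in> f ` carrier G \<or> y \<in> f ` carrier G")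
      case True
      then have "x \<in> f ` carrier G \<and> y \<in> f ` carrier G"
        using e1' e2 N(2) xy(3) by (metis disjoint_iff)
      then show ?thesis using e1 xy by auto
    next
      case False
      then show ?thesis using xy s(1) inj_on_to_nat_on[OF count] by (auto simp: e_def dest: injD inj_onD)
    qed
  qed
  define K' where "K' = image_group e K"
  define \<mu>' where "\<mu>' y = \<mu> (inv_into (carrier K) e y)" for y
  have iso: "e \<in> iso K K'" unfolding K'_def by (rule inj_imp_image_group_iso[OF inj])
  have gK': "group K'" unfolding K'_def by (rule K.inj_imp_image_group_is_group[OF inj])
  have \<mu>': "\<mu>' (e x) = \<mu> x" if "x \<in> carrier K" for x
    using inj that by (simp add: \<mu>'_def)
  have fK: "f x \<in> carrier K" if "x \<in> carrier G" for x using f' that by (auto simp: hom_def)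
  have im: "carrier K' = e ` carrier K" by (simp add: K'_def image_group_carrier)
  have "carrier G \<subseteq> carrier K'"
    unfolding im using e1 fK by (metis imageI subsetI)
  moreover have "x \<otimes>\<^bsub>G\<^esub> y = x \<otimes>\<^bsub>K'\<^esub> y" if "x \<in> carrier G" "y \<in> carrier G" for x y
  proof -
    have "x \<otimes>\<^bsub>K'\<^esub> y = e (f x) \<otimes>\<^bsub>K'\<^esub> e (f y)" using e1 that by simp
    also have "\<dots> = e (f x \<otimes>\<^bsub>K\<^esub> f y)" using iso fK that by (simp add: iso_def hom_def)
    also have "\<dots> = e (f (x \<otimes>\<^bsub>G\<^esub> y))" using f'(1) that by (simp add: hom_def)
    also have "\<dots> = x \<otimes>\<^bsub>G\<^esub> y"
      using e1 that group.is_monoid[OF normedD(1)[OF G]] monoid.m_closed by metis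
    finally show ?thesis ..
  qed
  moreover have "\<mu>' x = \<nu> x" if "x \<in> carrier G" for x
    using \<mu>'[OF fK[OF that]] e1[OF that] f'(2)[OF that] by simp
  ultimately have "extends (G, \<nu>) (K', \<mu>')" by (simp add: extends_iff)
  moreover have "normed K' \<mu>'" by (rule normed_iso[OF K iso gK' \<mu>'])
  moreover have "carrier K' \<subseteq> carrier G \<union> N"
    unfolding im using e1' e2 by blast
  ultimately show ?thesis using that iso \<mu>' e1 by blast
qed

end

section \<open>Constructing a saturated group with prescribed norms\<close>

context distributive_semilattice0
begin

lemma exhaustion_by_finite_subgroups:
  fixes G :: "'g monoid"
  assumes "group G" "locally_alternating G" "countable (carrier G)"
  obtains P :: "nat \<Rightarrow> 'g set" where "P 0 = {\<one>\<^bsub>G\<^esub>}" "\<And>n. P n \<subseteq> P (Suc n)" "(\<Union>n. P n) = carrier G"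
    "\<And>n. finite (P n)" "\<And>n. subgroup (P n) G"
proof -
  interpret group G by fact
  obtain g :: "nat \<Rightarrow> 'g" where g: "range g = carrier G"
    using assms(3) one_closed uncountable_def by (metis empty_iff)
  have g': "g n \<in> carrier G" for n using g by blast
  have "\<exists>P. \<forall>n. (finite (P n) \<and> subgroup (P n) G \<and> (n = 0 \<longrightarrow> P n = {\<one>\<^bsub>G\<^esub>})) \<and> insert (g n) (P n) \<subseteq> P (Suc n)"
  proof (rule dependent_nat_choice)
    show "\<exists>P. finite P \<and> subgroup P G \<and> (0 = (0::nat) \<longrightarrow> P = {\<one>\<^bsub>G\<^esub>})"
      using triv_subgroup by blast
    fix P n assume P: "finite P \<and> subgroup P G \<and> (n = (0::nat) \<longrightarrow> P = {\<one>\<^bsub>G\<^esub>})"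
    then have "finite (insert (g n) P)" "insert (g n) P \<subseteq> carrier G"
      using g' subgroup.subset by auto
    then obtain Q where "insert (g n) P \<subseteq> Q" "finite Q" "subgroup Q G"
      using assms(2) unfolding locally_alternating_def by meson
    then show "\<exists>Q. (finite Q \<and> subgroup Q G \<and> (Suc n = 0 \<longrightarrow> Q = {\<one>\<^bsub>G\<^esub>})) \<and> insert (g n) P \<subseteq> Q"
      by auto
  qed
  then obtain P where P: "\<And>n. finite (P n)" "\<And>n. subgroup (P n) G" "P 0 = {\<one>\<^bsub>G\<^esub>}"
    "\<And>n. insert (g n) (P n) \<subseteq> P (Suc n)" by (metis (lifting))
  have "(\<Union>n. P n) = carrier G"
  proof
    show "(\<Union>n. P n) \<subseteq> carrier G" using P(2) subgroup.subset by blast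
    show "carrier G \<subseteq> (\<Union>n. P n)" using P(4) unfolding g[symmetric] by blast
  qed
  then show ?thesis using that P by blast
qed

text \<open>One step of the construction in \<open>saturated_extension_of_countable\<close>: the amalgam of \<open>Q\<close> and
  \<open>P'\<close> over \<open>P\<close>, renamed so that it contains \<open>Q\<close>.\<close>

lemma extension_over_larger_subgroup:
  fixes G :: "'g monoid" and Q :: "nat monoid"
  assumes G: "normed G \<nu>" and P: "subgroup P G" "subgroup P' G" "P \<subseteq> P'" "finite P'"
    and Q: "normed Q \<mu>" "finite (carrier Q)" and e: "e \<in> norm_hom (G\<lparr>carrier := P\<rparr>) \<nu> Q \<mu>"
    and a: "a \<in> carrier S"
  obtains Q' \<mu>' e' where "extends (Q, \<mu>) (Q', \<mu>')" "normed Q' \<mu>'" "finite (carrier Q')"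
    "Q' \<in> alternating_products" "e' \<in> norm_hom (G\<lparr>carrier := P'\<rparr>) \<nu> Q' \<mu>'"
    "\<And>x. x \<in> P \<Longrightarrow> e' x = e x" "a \<in> \<mu>' ` carrier Q'"
    "\<And>x y z. x \<in> carrier Q \<Longrightarrow> y \<in> carrier Q \<Longrightarrow> z \<in> carrier Q \<Longrightarrow> \<mu> z \<sqsubseteq> \<mu> x \<squnion> \<mu> y \<Longrightarrow>
      z \<in> normal_closure Q' {x, y}"
proof -
  note nP = normed_subgroup[OF G P(1)] and nP' = normed_subgroup[OF G P(2)]
  have fin: "finite (carrier (G\<lparr>carrier := P\<rparr>))" "finite (carrier (G\<lparr>carrier := P'\<rparr>))"
    using P finite_subset by auto
  have incl: "(\<lambda>x. x) \<in> hom (G\<lparr>carrier := P\<rparr>) (G\<lparr>carrier := P'\<rparr>)"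
    using P by (auto simp: hom_def)
  have e': "e \<in> hom (G\<lparr>carrier := P\<rparr>) Q" "\<And>x. x \<in> carrier (G\<lparr>carrier := P\<rparr>) \<Longrightarrow> \<mu> (e x) = \<nu> x"
    using e by (auto simp: norm_hom_def)
  obtain R :: "(nat \<Rightarrow> nat \<Rightarrow> nat) monoid" and \<rho> g1 g2 where R:
    "R \<in> alternating_products" "finite (carrier R)" "normed R \<rho>"
    "g1 \<in> hom (G\<lparr>carrier := P'\<rparr>) R" "\<And>x. x \<in> carrier (G\<lparr>carrier := P'\<rparr>) \<Longrightarrow> \<rho> (g1 x) = \<nu> x"
    "g2 \<in> hom Q R" "\<And>x. x \<in> carrier Q \<Longrightarrow> \<rho> (g2 x) = \<mu> x"
    "\<And>x. x \<in> carrier (G\<lparr>carrier := P\<rparr>) \<Longrightarrow> g1 x = g2 (e x)"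
    "a \<in> \<rho> ` carrier R"
    "\<And>x y z. x \<in> carrier Q \<Longrightarrow> y \<in> carrier Q \<Longrightarrow> z \<in> carrier Q \<Longrightarrow> \<mu> z \<sqsubseteq> \<mu> x \<squnion> \<mu> y \<Longrightarrow>
      g2 z \<in> normal_closure R {g2 x, g2 y}"
    using normed_amalgamation[OF nP fin(1) nP' fin(2) Q incl HOL.refl e' a] by blast
  have N: "infinite (UNIV - carrier Q)" "(UNIV - carrier Q) \<inter> carrier Q = {}"
    using Q(2) by auto
  have g2': "g2 \<in> norm_hom Q \<mu> R \<rho>" using R by (simp add: norm_hom_def)
  obtain Q' \<mu>' i where Q': "extends (Q, \<mu>) (Q', \<mu>')" "normed Q' \<mu>'" "i \<in> iso R Q'"
    "\<forall>x\<in>carrier R. \<mu>' (i x) = \<rho> x" "\<forall>x\<in>carrier Q. i (g2 x) = x" "carrier Q' \<subseteq> carrier Q \<union> (UNIV - carrier Q)"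
    using rename_to_extension[OF Q(1) R(3) g2' countable_finite[OF R(2)] N] .
  have i: "i \<in> hom R Q'" "carrier Q' = i ` carrier R"
    using Q'(3) by (auto simp: iso_def bij_betw_def)
  have gQ': "group Q'" and gR: "group R" using normedD(1) Q'(2) R(3) by auto
  have g1: "g1 x \<in> carrier R" if "x \<in> P'" for x using R(4) that by (auto simp: hom_def)
  have g2: "g2 x \<in> carrier R" if "x \<in> carrier Q" for x using R(6) that by (auto simp: hom_def)
  show ?thesis
  proof (rule that[OF Q'(1,2)])
    show "finite (carrier Q')" using i R by simp
    show "Q' \<in> alternating_products" using alternating_products_iso R(1) Q'(3) gQ' by blast
    show "i \<circ> g1 \<in> norm_hom (G\<lparr>carrier := P'\<rparr>) \<nu> Q' \<mu>'"
      using hom_compose[OF R(4) i(1)] Q'(4) g1 R(5) by (simp add: norm_hom_def)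
    show "(i \<circ> g1) x = e x" if "x \<in> P" for x
      using R(8)[of x] that e Q'(5) by (auto simp: norm_hom_def hom_def)
    show "a \<in> \<mu>' ` carrier Q'"
      using R(9) Q'(4) i(2) by (auto simp: image_iff)
    show "z \<in> normal_closure Q' {x, y}"
      if "x \<in> carrier Q" "y \<in> carrier Q" "z \<in> carrier Q" "\<mu> z \<sqsubseteq> \<mu> x \<squnion> \<mu> y" for x y z
      using normal_closure_hom_image[OF gR gQ' i(1) _ R(10)[OF that]] g2 that Q'(5) by simp
  qed
qed

text \<open>The norms of \<open>Q n\<close> are controlled in \<open>Q (Suc n)\<close>, so the union of all \<open>Q n\<close> is saturated even
  though none of them need be. The embeddings of the \<open>P n\<close> extend each other and unite to one of
  \<open>G\<close>.\<close>

lemma saturated_extension_of_countable: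
  fixes G :: "'g monoid"
  assumes G: "saturated G \<nu>" "countable (carrier G)" and a: "a \<in> carrier S"
  obtains K :: "nat monoid" and \<mu> f where "saturated K \<mu>" "f \<in> norm_hom G \<nu> K \<mu>" "a \<in> \<mu> ` carrier K"
proof -
  have nG: "normed G \<nu>" and laG: "locally_alternating G" using G by (auto simp: saturated_def)
  interpret G: group G by (rule normedD(1)[OF nG])
  obtain P :: "nat \<Rightarrow> 'g set" where P: "P 0 = {\<one>\<^bsub>G\<^esub>}" "\<And>n. P n \<subseteq> P (Suc n)" "(\<Union>n. P n) = carrier G"
    "\<And>n. finite (P n)" "\<And>n. subgroup (P n) G"
    using exhaustion_by_finite_subgroups[OF G.is_group laG G(2)] by metis
  define state where "state n q \<longleftrightarrow> (case q of (Q, \<mu>, e) \<Rightarrow> normed Q \<mu> \<and> finite (carrier Q) \<and>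
    e \<in> norm_hom (G\<lparr>carrier := P n\<rparr>) \<nu> Q \<mu>)" for n and q :: "nat monoid \<times> (nat \<Rightarrow> 'a) \<times> ('g \<Rightarrow> nat)"
  define next_state where "next_state n q q' \<longleftrightarrow> (case q of (Q, \<mu>, e) \<Rightarrow> case q' of (Q', \<mu>', e') \<Rightarrow>
    extends (Q, \<mu>) (Q', \<mu>') \<and> Q' \<in> alternating_products \<and> (\<forall>x\<in>P n. e' x = e x) \<and> a \<in> \<mu>' ` carrier Q' \<and>
    (\<forall>x\<in>carrier Q. \<forall>y\<in>carrier Q. \<forall>z\<in>carrier Q. \<mu> z \<sqsubseteq> \<mu> x \<squnion> \<mu> y \<longrightarrow> z \<in> normal_closure Q' {x, y}))"
    for n :: nat and q q' :: "nat monoid \<times> (nat \<Rightarrow> 'a) \<times> ('g \<Rightarrow> nat)"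
  have "\<exists>q. \<forall>n. state n (q n) \<and> next_state n (q n) (q (Suc n))"
  proof (rule dependent_nat_choice)
    define T where "T = (\<lparr>carrier = {0}, monoid.mult = (\<lambda>x y. 0), one = 0\<rparr> :: nat monoid)"
    have gT: "group T" by (rule groupI) (auto simp: T_def)
    have "inv\<^bsub>T\<^esub> 0 = 0" using group.inv_closed[OF gT, of 0] by (simp add: T_def)
    then have "normed T (\<lambda>x. \<bottom>)"
      using gT by (auto simp: normed_def T_def join_left)
    moreover have "(\<lambda>x. 0) \<in> norm_hom (G\<lparr>carrier := P 0\<rparr>) \<nu> T (\<lambda>x. \<bottom>)"
      using P(1) normed_one[OF nG] by (auto simp: norm_hom_def hom_def T_def)
    ultimately have "state 0 (T, \<lambda>x. \<bottom>, \<lambda>x. 0)" by (simp add: state_def) (simp add: T_def)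
    then show "\<exists>q. state 0 q" by blast
  next
    fix q n assume "state n q"
    then obtain Q \<mu> e where q: "q = (Q, \<mu>, e)" "normed Q \<mu>" "finite (carrier Q)"
      "e \<in> norm_hom (G\<lparr>carrier := P n\<rparr>) \<nu> Q \<mu>"
      by (cases q) (auto simp: state_def)
    obtain Q' \<mu>' e' where q': "extends (Q, \<mu>) (Q', \<mu>')" "normed Q' \<mu>'" "finite (carrier Q')"
      "Q' \<in> alternating_products" "e' \<in> norm_hom (G\<lparr>carrier := P (Suc n)\<rparr>) \<nu> Q' \<mu>'"
      "\<And>x. x \<in> P n \<Longrightarrow> e' x = e x" "a \<in> \<mu>' ` carrier Q'"
      "\<And>x y z. x \<in> carrier Q \<Longrightarrow> y \<in> carrier Q \<Longrightarrow> z \<in> carrier Q \<Longrightarrow> \<mu> z \<sqsubseteq> \<mu> x \<squnion> \<mu> y \<Longrightarrow>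
        z \<in> normal_closure Q' {x, y}"
      by (rule extension_over_larger_subgroup[OF nG P(5)[of n] P(5)[of "Suc n"] P(2)[of n] P(4)[of "Suc n"] q(2,3,4) a]) blast
    then show "\<exists>q'. state (Suc n) q' \<and> next_state n q q'"
      unfolding q(1) by (intro exI[of _ "(Q', \<mu>', e')"]) (simp add: state_def next_state_def)
  qed
  then obtain q where q: "\<And>n. state n (q n)" "\<And>n. next_state n (q n) (q (Suc n))" by blast
  define Q where "Q n = fst (q n)" for n
  define \<mu> where "\<mu> n = fst (snd (q n))" for n
  define e where "e n = snd (snd (q n))" for n
  have Q: "normed (Q n) (\<mu> n)" "finite (carrier (Q n))" "e n \<in> norm_hom (G\<lparr>carrier := P n\<rparr>) \<nu> (Q n) (\<mu> n)" for n
    using q(1)[of n] by (auto simp: state_def Q_def \<mu>_def e_def split: prod.splits)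
  have step: "extends (Q n, \<mu> n) (Q (Suc n), \<mu> (Suc n))" "Q (Suc n) \<in> alternating_products"
    "\<And>x. x \<in> P n \<Longrightarrow> e (Suc n) x = e n x" "a \<in> \<mu> (Suc n) ` carrier (Q (Suc n))" for n
    using q(2)[of n] by (auto simp: next_state_def Q_def \<mu>_def e_def split: prod.splits)
  have ctrl: "z \<in> normal_closure (Q (Suc n)) {x, y}"
    if "x \<in> carrier (Q n)" "y \<in> carrier (Q n)" "z \<in> carrier (Q n)" "\<mu> n z \<sqsubseteq> \<mu> n x \<squnion> \<mu> n y" for n x y z
    using q(2)[of n] that by (auto simp: next_state_def Q_def \<mu>_def e_def split: prod.splits)
  have mono: "extends (Q m, \<mu> m) (Q n, \<mu> n)" if "m \<le> n" for m n
    using that by (induction rule: dec_induct) (blast intro: extends_refl extends_trans step(1))+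
  have comparable: "extends (Q m, \<mu> m) (Q n, \<mu> n) \<or> extends (Q n, \<mu> n) (Q m, \<mu> m)" for m n
    using mono[of m n] mono[of n m] by (cases "m \<le> n") auto
  have Pmono: "P m \<subseteq> P n" if "m \<le> n" for m n
    using that P(2) by (rule lift_Suc_mono_le[rotated])
  have emono: "e n x = e m x" if "m \<le> n" "x \<in> P m" for m n x
    using that
  proof (induction rule: dec_induct)
    case (step n)
    then show ?case using Pmono[of m n] \<open>\<And>n x. x \<in> P n \<Longrightarrow> e (Suc n) x = e n x\<close>[of x n] by auto
  qed simp
  define C where "C = range (\<lambda>n. (Q n, \<mu> n))"
  have C: "C \<noteq> {}" "\<And>p. p \<in> C \<Longrightarrow> normed (fst p) (snd p)"
    "\<And>p q. p \<in> C \<Longrightarrow> q \<in> C \<Longrightarrow> extends p q \<or> extends q p"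
    using Q(1) comparable by (auto simp: C_def)
  obtain U where U: "normed (fst U) (snd U)" "carrier (fst U) = (\<Union>p\<in>C. carrier (fst p))"
    "\<And>p. p \<in> C \<Longrightarrow> extends p U"
    using normed_chain_union[OF C] by blast
  have ext: "extends (Q n, \<mu> n) U" for n using U(3) by (simp add: C_def)
  have "saturated (fst U) (snd U)"
  proof (rule saturated_chain_union[OF C(1) C(3) U C(2)])
    fix p A assume "p \<in> C" "finite A" "A \<subseteq> carrier (fst p)"
    then obtain n where n: "A \<subseteq> carrier (Q n)" by (auto simp: C_def)
    interpret Qn: group "Q (Suc n)" using normedD(1) Q(1) by blast
    have "A \<subseteq> carrier (Q (Suc n))" using n step(1)[of n] by (auto simp: extends_iff)
    moreover have "(Q (Suc n))\<lparr>carrier := carrier (Q (Suc n))\<rparr> = Q (Suc n)" by simp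
    ultimately show "\<exists>q\<in>C. \<exists>P. A \<subseteq> P \<and> finite P \<and> subgroup P (fst q) \<and>
        (fst q)\<lparr>carrier := P\<rparr> \<in> alternating_products"
      using step(2)[of n] Q(2)[of "Suc n"] Qn.subgroup_self
      by (intro bexI[of _ "(Q (Suc n), \<mu> (Suc n))"] exI[of _ "carrier (Q (Suc n))"]) (auto simp: C_def)
  next
    fix p x y z assume p: "p \<in> C" "x \<in> carrier (fst p)" "y \<in> carrier (fst p)" "z \<in> carrier (fst p)"
      "snd p z \<sqsubseteq> snd p x \<squnion> snd p y"
    then obtain n where "p = (Q n, \<mu> n)" by (auto simp: C_def)
    then show "\<exists>q\<in>C. extends p q \<and> z \<in> normal_closure (fst q) {x, y}"
      using p ctrl[of x n y z] step(1)[of n]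
      by (intro bexI[of _ "(Q (Suc n), \<mu> (Suc n))"]) (auto simp: C_def)
  qed
  moreover define f where "f x = e (LEAST n. x \<in> P n) x" for x
  have f: "f x = e n x" if "x \<in> P n" for x n
    unfolding f_def using that emono[OF Least_le[of "\<lambda>n. x \<in> P n" n]] LeastI[of "\<lambda>n. x \<in> P n" n] by simp
  have "f \<in> norm_hom G \<nu> (fst U) (snd U)"
  proof -
    have eQ: "e n x \<in> carrier (Q n)" "\<mu> n (e n x) = \<nu> x" if "x \<in> P n" for n x
      using that Q(3)[of n] by (auto simp: norm_hom_def hom_def)
    have eU: "e n x \<in> carrier (Q n)" "snd U (e n x) = \<nu> x" if "x \<in> P n" for n x
      using eQ[OF that] ext[of n] by (auto simp: extends_iff)
    have "f (x \<otimes>\<^bsub>G\<^esub> y) = f x \<otimes>\<^bsub>fst U\<^esub> f y" if xyG: "x \<in> carrier G" "y \<in> carrier G" for x y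
    proof -
      obtain m n where "x \<in> P m" "y \<in> P n" using xyG P(3) by blast
      then have xy: "x \<in> P (max m n)" "y \<in> P (max m n)"
        using Pmono[of m "max m n"] Pmono[of n "max m n"] by auto
      then have "x \<otimes>\<^bsub>G\<^esub> y \<in> P (max m n)" using P(5) subgroup.m_closed by metis
      then show ?thesis
        using xy Q(3)[of "max m n"] eU ext[of "max m n"] by (simp add: f norm_hom_def hom_def extends_iff)
    qed
    moreover have "f x \<in> carrier (fst U)" "snd U (f x) = \<nu> x" if x: "x \<in> carrier G" for x
    proof -
      obtain n where "x \<in> P n" using x P(3) by blast
      then show "f x \<in> carrier (fst U)" "snd U (f x) = \<nu> x"
        using eU[of x n] ext[of n] by (auto simp: f extends_iff)
    qed
    ultimately show ?thesis by (auto simp: norm_hom_def hom_def)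
  qed
  moreover have "a \<in> snd U ` carrier (fst U)"
    using step(4)[of 0] extends_image[OF ext[of 1]] by auto
  ultimately show ?thesis using that by blast
qed

lemma saturated_extension:
  fixes G :: "'g monoid"
  assumes G: "saturated G \<nu>" "countable (carrier G)" and a: "a \<in> carrier S"
    and N: "infinite N" "N \<inter> carrier G = {}"
  obtains K \<mu> where "extends (G, \<nu>) (K, \<mu>)" "saturated K \<mu>" "a \<in> \<mu> ` carrier K"
    "carrier K \<subseteq> carrier G \<union> N"
proof -
  obtain K :: "nat monoid" and \<mu> f where K: "saturated K \<mu>" "f \<in> norm_hom G \<nu> K \<mu>" "a \<in> \<mu> ` carrier K"
    using saturated_extension_of_countable[OF G a] .
  have n: "normed G \<nu>" "normed K \<mu>" using G K by (auto simp: saturated_def)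
  obtain K' \<mu>' e where K': "extends (G, \<nu>) (K', \<mu>')" "normed K' \<mu>'" "e \<in> iso K K'"
    "\<forall>x\<in>carrier K. \<mu>' (e x) = \<mu> x" "\<forall>x\<in>carrier G. e (f x) = x"
    "carrier K' \<subseteq> carrier G \<union> N"
    using rename_to_extension[OF n K(2) countableI_type N] .
  have "saturated K' \<mu>'"
    by (rule saturated_iso[OF K(1) K'(3) normedD(1)[OF K'(2)] K'(4)[rule_format]])
  moreover have "a \<in> \<mu>' ` carrier K'"
  proof -
    obtain k where k: "k \<in> carrier K" "a = \<mu> k" using K(3) by blast
    then have "e k \<in> carrier K'" using K'(3) by (auto simp: iso_def hom_def)
    then show ?thesis using K'(4) k by (intro image_eqI[of _ _ "e k"]) simp_all
  qed
  ultimately show ?thesis using that K' by blast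
qed

lemma trivial_saturated:
  "saturated \<lparr>carrier = {u}, monoid.mult = (\<lambda>x y. u), one = u\<rparr> (\<lambda>x. \<bottom>)"
proof -
  let ?T = "\<lparr>carrier = {u}, monoid.mult = (\<lambda>x y. u), one = u\<rparr>"
  interpret T: group ?T by (rule groupI) auto
  have "inv\<^bsub>?T\<^esub> u = u" using T.inv_closed[of u] by simp
  then have "normed ?T (\<lambda>x. \<bottom>)"
    using T.is_group by (auto simp: normed_def join_left)
  moreover have "?T \<in> alternating_products"
  proof -
    have "(\<lambda>x. \<lambda>i. undefined) \<in> iso ?T (product_group {..<0 :: nat} (\<lambda>j. alt_group 5))"
      unfolding lessThan_0 iso_def hom_def bij_betw_def carrier_product_group by (simp add: PiE_empty_domain restrict_def)
    from is_isoI[OF this] have "?T \<cong> product_group {..<0 :: nat} (\<lambda>j. alt_group 5)" .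
    then show ?thesis
      using T.is_group unfolding alternating_products_def
      by (intro CollectI conjI exI[of _ 0] exI[of _ "\<lambda>j. 5"]) auto
  qed
  then have "locally_alternating ?T"
    unfolding locally_alternating_def using T.subgroup_self by (intro allI impI exI[of _ "{u}"]) auto
  moreover have "norm_controlled ?T (\<lambda>x. \<bottom>)"
    unfolding norm_controlled_def using T.subset_normal_closure by auto
  ultimately show ?thesis by (simp add: saturated_def)
qed

lemma well_order_with_countable_segments:
  assumes "|A| \<le>o cardSuc natLeq"
  obtains r where "well_order_on A r" "\<And>a. a \<in> A \<Longrightarrow> countable (underS r a)"
proof (rule that[of "|A|"])
  show "well_order_on A |A|" by (rule card_of_well_order_on)
  fix a assume "a \<in> A"
  then have "|underS |A| a| <o |A|"
    by (intro card_of_underS) (auto simp: card_of_card_order_on Field_card_of)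
  then have "|underS |A| a| <o cardSuc natLeq" using assms ordLess_ordLeq_trans by blast
  then have "|underS |A| a| \<le>o natLeq"
    by (simp add: cardSuc_ordLeq_ordLess card_of_Card_order natLeq_Card_order)
  then show "countable (underS |A| a)"
    by (simp add: countable_card_le_natLeq)
qed

text \<open>The elements of the group are named by pairs, so that names remain available at each stage:
  the members of the chain contain a pair \<open>(b, k)\<close>, apart from the neutral element, only if they
  have \<open>b\<close> and all its predecessors among their norms. Hence a group that omits the value \<open>a\<close>
  and has all values before \<open>a\<close> lives on countably many names and uses no name \<open>(a, Suc k)\<close>.\<close>

lemma saturated_onto:
  assumes "|carrier S| \<le>o cardSuc natLeq"
  obtains G :: "('a \<times> nat) monoid" and \<nu> where "saturated G \<nu>" "\<nu> ` carrier G = carrier S"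
    "carrier G \<subseteq> carrier S \<times> UNIV"
proof -
  obtain r where r: "well_order_on (carrier S) r" "\<And>a. a \<in> carrier S \<Longrightarrow> countable (underS r a)"
    using well_order_with_countable_segments[OF assms] by blast
  let ?u = "(\<bottom>, 0 :: nat)"
  define stage :: "(('a \<times> nat) monoid \<times> ('a \<times> nat \<Rightarrow> 'a)) \<Rightarrow> bool" where
    "stage p \<longleftrightarrow> saturated (fst p) (snd p) \<and> \<one>\<^bsub>fst p\<^esub> = ?u \<and>
      (\<forall>x\<in>carrier (fst p) - {?u}. fst x \<in> carrier S \<and>
        insert (fst x) (underS r (fst x)) \<subseteq> snd p ` carrier (fst p))" for p
  obtain C where max: "pred_on.maxchain (Collect stage) extends C"
    using pred_on.Hausdorff by blast
  then have C: "pred_on.chain (Collect stage) extends C" by (simp add: pred_on.maxchain_def)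
  then have chain1: "C \<subseteq> Collect stage" by (simp add: pred_on.chain_def)
  have chain: "extends p q \<or> extends q p" if "p \<in> C" "q \<in> C" for p q
    using pred_on.chain_total[OF C that] extends_refl by blast
  have maximal: "p \<in> C" if "stage p" "\<And>q. q \<in> C \<Longrightarrow> extends q p" for p
  proof (rule ccontr)
    assume "p \<notin> C"
    then have "C \<subset> insert p C" by blast
    moreover have "pred_on.chain (Collect stage) extends (insert p C)"
      using C that by (auto simp: pred_on.chain_def)
    ultimately show False using max by (auto simp: pred_on.maxchain_def)
  qed
  have "stage (\<lparr>carrier = {?u}, monoid.mult = (\<lambda>x y. ?u), one = ?u\<rparr>, \<lambda>x. \<bottom>)"
    using trivial_saturated by (simp add: stage_def)
  then have ne: "C \<noteq> {}" using maximal by blast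
  have normed: "normed (fst p) (snd p)" and sat: "saturated (fst p) (snd p)" if "p \<in> C" for p
    using chain1 that by (auto simp: stage_def saturated_def)
  obtain U where U: "normed (fst U) (snd U)" "carrier (fst U) = (\<Union>p\<in>C. carrier (fst p))"
    "\<And>p. p \<in> C \<Longrightarrow> extends p U"
    using normed_chain_union[OF ne normed chain] by blast
  have satU: "saturated (fst U) (snd U)"
  proof (rule saturated_chain_union[OF ne chain U normed])
    show "\<exists>q\<in>C. \<exists>P. A \<subseteq> P \<and> finite P \<and> subgroup P (fst q) \<and> (fst q)\<lparr>carrier := P\<rparr> \<in> alternating_products"
      if "p \<in> C" "finite A" "A \<subseteq> carrier (fst p)" for p A
      using sat[OF that(1)] that unfolding saturated_def locally_alternating_def by blast
    show "\<exists>q\<in>C. extends p q \<and> z \<in> normal_closure (fst q) {x, y}"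
      if "p \<in> C" "x \<in> carrier (fst p)" "y \<in> carrier (fst p)" "z \<in> carrier (fst p)"
        "snd p z \<sqsubseteq> snd p x \<squnion> snd p y" for p x y z
      using sat[OF that(1)] that extends_refl unfolding saturated_def norm_controlled_def by blast
  qed
  have imU: "snd p ` carrier (fst p) \<subseteq> snd U ` carrier (fst U)" if "p \<in> C" for p
    by (rule extends_image[OF U(3)[OF that]])
  have stageU: "stage U"
  proof -
    obtain p where p: "p \<in> C" using ne by blast
    have "\<one>\<^bsub>fst U\<^esub> = \<one>\<^bsub>fst p\<^esub>"
      using group_hom.hom_one[OF extends_group_hom[OF U(3)[OF p] normed[OF p] U(1)]] by simp
    moreover have "\<one>\<^bsub>fst p\<^esub> = ?u" using chain1 p by (auto simp: stage_def)
    moreover have "fst x \<in> carrier S \<and> insert (fst x) (underS r (fst x)) \<subseteq> snd U ` carrier (fst U)"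
      if x: "x \<in> carrier (fst U) - {?u}" for x
    proof -
      obtain q where q: "q \<in> C" "x \<in> carrier (fst q)" using x U(2) by blast
      then have "stage q" using chain1 by blast
      then have "fst x \<in> carrier S \<and> insert (fst x) (underS r (fst x)) \<subseteq> snd q ` carrier (fst q)"
        using q(2) x unfolding stage_def by blast
      then show ?thesis using imU[OF q(1)] by blast
    qed
    ultimately show ?thesis using satU by (simp add: stage_def)
  qed
  have sub: "snd U ` carrier (fst U) \<subseteq> carrier S"
    using normedD(2)[OF U(1)] by auto
  have "snd U ` carrier (fst U) = carrier S"
  proof (rule ccontr)
    assume "snd U ` carrier (fst U) \<noteq> carrier S"
    then have "carrier S - snd U ` carrier (fst U) \<noteq> {}" using sub by blast
    moreover have wf: "wf (r - Id)" and lin: "linear_order_on (carrier S) r"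
      using r(1) by (auto simp: well_order_on_def)
    ultimately obtain a where a': "a \<in> carrier S - snd U ` carrier (fst U)"
      "\<And>b. (b, a) \<in> r - Id \<Longrightarrow> b \<notin> carrier S - snd U ` carrier (fst U)"
      using wfE_min' by metis
    then have a: "a \<in> carrier S" "a \<notin> snd U ` carrier (fst U)"
      "\<And>b. b \<in> underS r a \<Longrightarrow> b \<notin> carrier S - snd U ` carrier (fst U)"
      by (auto simp: underS_def)
    have r_sub: "r \<subseteq> carrier S \<times> carrier S"
      using lin by (auto simp: order_on_defs refl_on_def)
    have seg: "underS r a \<subseteq> snd U ` carrier (fst U)"
      using a(3) r_sub unfolding underS_def by blast
    have below: "fst x \<in> underS r a" if x: "x \<in> carrier (fst U)" "x \<noteq> ?u" for x
    proof -
      have fx: "fst x \<in> carrier S" "insert (fst x) (underS r (fst x)) \<subseteq> snd U ` carrier (fst U)"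
        using stageU x unfolding stage_def by blast+
      then have "a \<noteq> fst x" "a \<notin> underS r (fst x)" using a(2) by auto
      then show ?thesis
        using lin fx(1) a(1) unfolding order_on_defs total_on_def underS_def by blast
    qed
    have "carrier (fst U) \<subseteq> insert ?u (underS r a \<times> UNIV)"
      using below by (force simp: mem_Times_iff)
    moreover have "countable (insert ?u (underS r a \<times> (UNIV :: nat set)))"
      using r(2)[OF a(1)] by auto
    ultimately have count: "countable (carrier (fst U))" by (rule countable_subset)
    \<comment> \<open>Positive indices keep the new names different from that of the neutral element.\<close>
    define N where "N = {a} \<times> {0 :: nat <..}"
    have N1: "infinite N" by (simp add: N_def finite_cartesian_product_iff infinite_Ioi)
    have N2: "N \<inter> carrier (fst U) = {}"
    proof (rule ccontr)
      assume "N \<inter> carrier (fst U) \<noteq> {}"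
      then obtain x where x: "x \<in> N" "x \<in> carrier (fst U)" by blast
      then have "fst x \<in> underS r a" by (intro below) (auto simp: N_def)
      then show False using x by (auto simp: N_def underS_def)
    qed
    obtain K \<mu> where K: "extends U (K, \<mu>)" "saturated K \<mu>" "a \<in> \<mu> ` carrier K"
      "carrier K \<subseteq> carrier (fst U) \<union> N"
      using saturated_extension[OF satU count a(1) N1 N2] by auto
    have im: "snd U ` carrier (fst U) \<subseteq> \<mu> ` carrier K"
      using extends_image[OF K(1)] by simp
    have nK: "normed K \<mu>" using K(2) by (simp add: saturated_def)
    have "stage (K, \<mu>)"
    proof -
      have "\<one>\<^bsub>K\<^esub> = ?u"
        using group_hom.hom_one[OF extends_group_hom[OF K(1) U(1)]] nK stageU by (simp add: stage_def)
      moreover have "fst x \<in> carrier S \<and> insert (fst x) (underS r (fst x)) \<subseteq> \<mu> ` carrier K"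
        if x: "x \<in> carrier K - {?u}" for x
      proof (cases "x \<in> carrier (fst U)")
        case True
        then show ?thesis using stageU x im unfolding stage_def by blast
      next
        case False
        then have "fst x = a" using x K(4) by (auto simp: N_def)
        then show ?thesis using a(1) K(3) seg im by auto
      qed
      ultimately show ?thesis using K(2) by (simp add: stage_def)
    qed
    then have "(K, \<mu>) \<in> C"
      using maximal extends_trans[OF U(3) K(1)] by blast
    then have "\<mu> ` carrier K \<subseteq> snd U ` carrier (fst U)" using imU by force
    then show False using K(3) a(2) by blast
  qed
  moreover have "carrier (fst U) \<subseteq> carrier S \<times> UNIV"
  proof
    fix x assume x: "x \<in> carrier (fst U)"
    show "x \<in> carrier S \<times> UNIV"
    proof (cases "x = ?u")
      case False
      then have "fst x \<in> carrier S" using stageU x unfolding stage_def by blast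
      then show ?thesis by (simp add: mem_Times_iff)
    qed simp
  qed
  ultimately show ?thesis using that satU by blast
qed

end

section \<open>Saturated groups as direct limits\<close>

context distributive_semilattice0
begin

text \<open>By control of norms the normal closure of \<open>{x, y}\<close> is \<open>{z. \<nu> z \<sqsubseteq> \<nu> x \<squnion> \<nu> y}\<close>. As \<open>\<nu>\<close> is
  surjective, a finite set of generators can be replaced by a single one, step by step.\<close>

lemma NSubc_iso_of_saturated:
  assumes sat: "saturated G \<nu>" and onto: "\<nu> ` carrier G = carrier S"
  shows "(\<lambda>a. {x \<in> carrier G. \<nu> x \<sqsubseteq> a}) \<in> semilattice0_iso S (NSubc G)"
proof -
  have n: "normed G \<nu>" and ctrl: "norm_controlled G \<nu>" using sat by (auto simp: saturated_def)
  note nD = normedD[OF n]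
  interpret G: group G by (rule nD(1))
  define h where "h a = {x \<in> carrier G. \<nu> x \<sqsubseteq> a}" for a
  have normal: "h a \<lhd> G" if a: "a \<in> carrier S" for a
  proof -
    have le: "\<nu> x \<sqsubseteq> a" if "\<nu> x \<sqsubseteq> b" "b \<sqsubseteq> a" "x \<in> carrier G" "b \<in> carrier S" for x b
      using le_trans[OF that(1,2)] nD(2) that a by blast
    have "subgroup (h a) G"
    proof (rule G.subgroupI)
      show "h a \<noteq> {}" using normed_one[OF n] bottom_lower a G.one_closed by (force simp: h_def)
      show "inv\<^bsub>G\<^esub> x \<in> h a" if "x \<in> h a" for x
        using that le[OF nD(5)] nD(2) by (simp add: h_def)
      show "x \<otimes>\<^bsub>G\<^esub> y \<in> h a" if "x \<in> h a" "y \<in> h a" for x y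
        using that le[OF nD(4)] nD(2) a by (simp add: h_def join_le_iff)
    qed (auto simp: h_def)
    moreover have "y \<otimes>\<^bsub>G\<^esub> x \<otimes>\<^bsub>G\<^esub> inv\<^bsub>G\<^esub> y \<in> h a" if "y \<in> carrier G" "x \<in> h a" for x y
      using that le[OF nD(6)] nD(2) by (simp add: h_def)
    ultimately show ?thesis by (simp add: G.normal_inv_iff)
  qed
  have closure2: "normal_closure G {x, y} = h (\<nu> x \<squnion> \<nu> y)" if xy: "x \<in> carrier G" "y \<in> carrier G" for x y
  proof
    have S: "\<nu> x \<squnion> \<nu> y \<in> carrier S" using nD(2) xy by simp
    show "normal_closure G {x, y} \<subseteq> h (\<nu> x \<squnion> \<nu> y)"
      by (rule G.normal_closure_least[OF normal[OF S]])
        (use xy nD(2) in \<open>auto simp: h_def join_left join_right\<close>)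
    show "h (\<nu> x \<squnion> \<nu> y) \<subseteq> normal_closure G {x, y}"
      using ctrl xy unfolding norm_controlled_def h_def by blast
  qed
  have join_idem: "a \<squnion> a = a" if "a \<in> carrier S" for a
    using that by (intro eq_if_same_upper_bounds) (auto simp: join_le_iff)
  have closure1: "normal_closure G {x} = h (\<nu> x)" if "x \<in> carrier G" for x
    using closure2[OF that that] join_idem nD(2)[OF that] by simp
  have gen: "\<exists>x\<in>carrier G. \<nu> x = a" if "a \<in> carrier S" for a
    using that unfolding onto[symmetric] by (auto simp: image_iff)
  have "\<nu> x \<sqsubseteq> \<bottom> \<longleftrightarrow> x = \<one>\<^bsub>G\<^esub>" if "x \<in> carrier G" for x
    using nD(3)[OF that] le_bottom_iff[OF nD(2)[OF that]] by simp
  then have h_bottom: "h \<bottom> = {\<one>\<^bsub>G\<^esub>}"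
    using G.one_closed by (auto simp: h_def)
  have fin: "\<exists>a\<in>carrier S. normal_closure G A = h a" if "finite A" "A \<subseteq> carrier G" for A
    using that
  proof (induction rule: finite_induct)
    case empty
    note h_bottom
    moreover have "normal_closure G {} = {\<one>\<^bsub>G\<^esub>}"
      using closure1[OF G.one_closed] normed_one[OF n] calculation
        G.normal_closure_least[OF G.one_is_normal, of "{}"]
        subgroup.one_closed[OF normal_imp_subgroup[OF G.normal_normal_closure[of "{}"]]] by auto
    ultimately show ?case by auto
  next
    case (insert x A)
    then obtain a where a: "a \<in> carrier S" "normal_closure G A = h a" by auto
    obtain y where y: "y \<in> carrier G" "\<nu> y = a" using gen[OF a(1)] by blast
    have eq: "normal_closure G (insert x A) = normal_closure G {x, y}"
    proof -
      have c: "insert x A \<subseteq> carrier G" "{x, y} \<subseteq> carrier G" using insert y by auto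
      have "y \<in> normal_closure G A" using a y by (simp add: h_def)
      also have "\<dots> \<subseteq> normal_closure G (insert x A)"
        using G.normal_closure_least[OF G.normal_normal_closure[OF c(1)]] G.subset_normal_closure[of "insert x A"] by blast
      finally have "{x, y} \<subseteq> normal_closure G (insert x A)"
        using G.subset_normal_closure[of "insert x A"] by auto
      then have le: "normal_closure G {x, y} \<subseteq> normal_closure G (insert x A)"
        by (rule G.normal_closure_least[OF G.normal_normal_closure[OF c(1)]])
      have "A \<subseteq> normal_closure G {y}"
        using G.subset_normal_closure[of A] a closure1 y by simp
      moreover have "normal_closure G {y} \<subseteq> normal_closure G {x, y}"
        using G.normal_closure_least[OF G.normal_normal_closure[OF c(2)]] G.subset_normal_closure[of "{x, y}"] by blast
      ultimately have "insert x A \<subseteq> normal_closure G {x, y}"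
        using G.subset_normal_closure[of "{x, y}"] by auto
      then have "normal_closure G (insert x A) \<subseteq> normal_closure G {x, y}"
        by (rule G.normal_closure_least[OF G.normal_normal_closure[OF c(2)]])
      then show ?thesis using le by (rule equalityI)
    qed
    have "\<nu> x \<squnion> \<nu> y \<in> carrier S" using insert.prems y(1) nD(2) by simp
    then show ?case using eq closure2[OF _ y(1), of x] insert.prems by auto
  qed
  have "bij_betw h (carrier S) (carrier (NSubc G))"
  proof (rule bij_betw_imageI)
    show "inj_on h (carrier S)"
    proof (rule inj_onI)
      fix a b assume ab: "a \<in> carrier S" "b \<in> carrier S" "h a = h b"
      have "c \<sqsubseteq> d" if cd: "c \<in> carrier S" "h c = h d" for c d
      proof -
        obtain x where "x \<in> carrier G" "\<nu> x = c" using gen[OF cd(1)] by blast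
        then have "x \<in> h d" using cd by (auto simp: h_def)
        then show ?thesis using \<open>\<nu> x = c\<close> by (simp add: h_def)
      qed
      then show "a = b" using ab le_antisym by metis
    qed
    show "h ` carrier S = carrier (NSubc G)"
    proof
      show "h ` carrier S \<subseteq> carrier (NSubc G)"
      proof clarify
        fix a assume "a \<in> carrier S"
        then obtain x where "x \<in> carrier G" "\<nu> x = a" using gen by blast
        then show "h a \<in> carrier (NSubc G)"
          using closure1[of x] by (auto simp: NSubc_def intro!: exI[of _ "{x}"])
      qed
      show "carrier (NSubc G) \<subseteq> h ` carrier S"
        using fin by (auto simp: NSubc_def image_iff)
    qed
  qed
  moreover have "h (a \<squnion> b) = h a \<squnion>\<^bsub>NSubc G\<^esub> h b" if ab: "a \<in> carrier S" "b \<in> carrier S" for a b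
  proof -
    obtain x y where xy: "x \<in> carrier G" "\<nu> x = a" "y \<in> carrier G" "\<nu> y = b"
      using gen[OF ab(1)] gen[OF ab(2)] by blast
    then show ?thesis
      using G.join_NSubc[of "{x}" "{y}"] closure1[of x] closure1[of y] closure2[of x y]
      by (simp add: insert_commute)
  qed
  moreover have "h \<bottom> = \<bottom>\<^bsub>NSubc G\<^esub>"
    using h_bottom by (simp add: G.bottom_NSubc)
  ultimately show ?thesis
    unfolding semilattice0_iso_def h_def[symmetric] by simp
qed

end

lemma iso_direct_limit_of_subgroups:
  fixes G :: "'g monoid"
  assumes G: "group G" and sys: "directed_group_system I H \<phi>"
    and D: "\<And>i. i \<in> carrier I \<Longrightarrow> subgroup (D i) G"
    and \<psi>: "\<And>i. i \<in> carrier I \<Longrightarrow> \<psi> i \<in> iso (G\<lparr>carrier := D i\<rparr>) (H i)"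
    and mono: "\<And>i j. i \<in> carrier I \<Longrightarrow> j \<in> carrier I \<Longrightarrow> i \<sqsubseteq>\<^bsub>I\<^esub> j \<Longrightarrow> D i \<subseteq> D j"
    and \<phi>: "\<And>i j x. i \<in> carrier I \<Longrightarrow> j \<in> carrier I \<Longrightarrow> i \<sqsubseteq>\<^bsub>I\<^esub> j \<Longrightarrow> x \<in> D i \<Longrightarrow> \<phi> i j (\<psi> i x) = \<psi> j x"
    and cover: "\<And>x. x \<in> carrier G \<Longrightarrow> \<exists>i\<in>carrier I. x \<in> D i"
  shows "G \<cong> direct_limit I H \<phi>"
proof -
  interpret G: group G by fact
  interpret sys: directed_group_system I H \<phi> by fact
  let ?L = "direct_limit I H \<phi>"
  have \<psi>_closed: "\<psi> i x \<in> carrier (H i)" if "i \<in> carrier I" "x \<in> D i" for i x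
    using \<psi>[OF that(1)] that(2) by (auto simp: iso_def hom_def)
  have \<psi>_inj: "x = y" if "i \<in> carrier I" "x \<in> D i" "y \<in> D i" "\<psi> i x = \<psi> i y" for i x y
    using \<psi>[OF that(1)] that(2-4) by (auto simp: iso_def bij_betw_def dest: inj_onD)
  have cls_eq: "sys.cls i (\<psi> i x) = sys.cls j (\<psi> j y) \<longleftrightarrow> x = y"
    if i: "i \<in> carrier I" "x \<in> D i" and j: "j \<in> carrier I" "y \<in> D j" for i j x y
  proof -
    have "sys.cls i (\<psi> i x) = sys.cls j (\<psi> j y) \<longleftrightarrow>
        (\<exists>k\<in>carrier I. i \<sqsubseteq>\<^bsub>I\<^esub> k \<and> j \<sqsubseteq>\<^bsub>I\<^esub> k \<and> \<phi> i k (\<psi> i x) = \<phi> j k (\<psi> j y))"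
      by (rule sys.cls_eq_iff) (use i j \<psi>_closed in auto)
    also have "\<dots> \<longleftrightarrow> (\<exists>k\<in>carrier I. i \<sqsubseteq>\<^bsub>I\<^esub> k \<and> j \<sqsubseteq>\<^bsub>I\<^esub> k \<and> \<psi> k x = \<psi> k y)"
      using \<phi> i j by auto
    also have "\<dots> \<longleftrightarrow> x = y"
    proof
      assume "\<exists>k\<in>carrier I. i \<sqsubseteq>\<^bsub>I\<^esub> k \<and> j \<sqsubseteq>\<^bsub>I\<^esub> k \<and> \<psi> k x = \<psi> k y"
      then obtain k where k: "k \<in> carrier I" "i \<sqsubseteq>\<^bsub>I\<^esub> k" "j \<sqsubseteq>\<^bsub>I\<^esub> k" "\<psi> k x = \<psi> k y" by blast
      then have "x \<in> D k" "y \<in> D k" using mono i j by blast+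
      then show "x = y" using \<psi>_inj k by blast
    next
      assume "x = y"
      then show "\<exists>k\<in>carrier I. i \<sqsubseteq>\<^bsub>I\<^esub> k \<and> j \<sqsubseteq>\<^bsub>I\<^esub> k \<and> \<psi> k x = \<psi> k y"
        using sys.directed[OF i(1) j(1)] by blast
    qed
    finally show ?thesis .
  qed
  \<comment> \<open>Any index of a subgroup containing \<open>x\<close> would do.\<close>
  define ix where "ix x = (SOME i. i \<in> carrier I \<and> x \<in> D i)" for x
  have ix: "ix x \<in> carrier I" "x \<in> D (ix x)" if "x \<in> carrier G" for x
    using someI_ex[of "\<lambda>i. i \<in> carrier I \<and> x \<in> D i"] cover[OF that] unfolding ix_def by blast+
  define F where "F x = sys.cls (ix x) (\<psi> (ix x) x)" for x
  have F: "F x = sys.cls i (\<psi> i x)" if "i \<in> carrier I" "x \<in> D i" for i x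
  proof -
    have "x \<in> carrier G" using D[OF that(1)] that(2) by (rule subgroup.mem_carrier)
    then show ?thesis unfolding F_def using cls_eq ix that by blast
  qed
  have "F \<in> iso G ?L"
    unfolding iso_def
  proof (intro CollectI conjI)
    show "F \<in> hom G ?L"
    proof (rule homI)
      show "F x \<in> carrier ?L" if "x \<in> carrier G" for x
        unfolding F_def using ix[OF that] \<psi>_closed by (intro sys.cls_closed) auto
      fix x y assume xy: "x \<in> carrier G" "y \<in> carrier G"
      obtain k where k: "k \<in> carrier I" "ix x \<sqsubseteq>\<^bsub>I\<^esub> k" "ix y \<sqsubseteq>\<^bsub>I\<^esub> k"
        using sys.directed[OF ix(1)[OF xy(1)] ix(1)[OF xy(2)]] by blast
      then have m: "x \<in> D k" "y \<in> D k" using mono ix xy by blast+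
      then have "x \<otimes>\<^bsub>G\<^esub> y \<in> D k" using D[OF k(1)] by (simp add: subgroup.m_closed)
      moreover have "\<psi> k (x \<otimes>\<^bsub>G\<^esub> y) = \<psi> k x \<otimes>\<^bsub>H k\<^esub> \<psi> k y"
        using \<psi>[OF k(1)] m by (auto simp: iso_def hom_def)
      ultimately show "F (x \<otimes>\<^bsub>G\<^esub> y) = F x \<otimes>\<^bsub>?L\<^esub> F y"
        using sys.mult_direct_limit[OF k(1) \<psi>_closed[OF k(1) m(1)] \<psi>_closed[OF k(1) m(2)]]
        by (simp add: F[OF k(1)] m)
    qed
    show "bij_betw F (carrier G) (carrier ?L)"
    proof (rule bij_betw_imageI)
      show "inj_on F (carrier G)"
        using cls_eq ix by (intro inj_onI) (auto simp: F_def)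
      show "F ` carrier G = carrier ?L"
      proof
        show "F ` carrier G \<subseteq> carrier ?L" using \<open>F \<in> hom G ?L\<close> by (auto simp: hom_def)
        show "carrier ?L \<subseteq> F ` carrier G"
        proof
          fix P assume "P \<in> carrier ?L"
          then obtain i u where i: "i \<in> carrier I" "u \<in> carrier (H i)" "P = sys.cls i u"
            by (rule sys.carrier_direct_limitE)
          then obtain x where x: "x \<in> D i" "u = \<psi> i x"
            using \<psi>[OF i(1)] by (auto simp: iso_def bij_betw_def)
          then show "P \<in> F ` carrier G"
            using F[OF i(1) x(1)] i subgroup.mem_carrier[OF D[OF i(1)] x(1)] by auto
        qed
      qed
    qed
  qed
  then show ?thesis by (rule is_isoI)
qed

text \<open>This provides indices for a directed system of finite subgroups. A list of sets is coded by
  the pairs of an index and an element. The extra element 0 in each entry records which indices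
  occur, so that the length can be recovered even if there are empty entries.\<close>

lemma finite_set_encoding:
  obtains code :: "nat set set \<Rightarrow> nat set" where "inj_on code {A. finite A}"
proof -
  define enc where "enc l = {prod_encode (i, x) | i x. i < length l \<and> x \<in> insert 0 (Suc ` (l ! i))}"
    for l :: "nat set list"
  have len: "prod_encode (i, 0) \<in> enc l \<longleftrightarrow> i < length l" for i l
    by (auto simp: enc_def)
  have nth: "prod_encode (i, Suc x) \<in> enc l \<longleftrightarrow> i < length l \<and> x \<in> l ! i" for i l x
    by (auto simp: enc_def)
  have "inj enc"
  proof (rule injI)
    fix l l' assume e: "enc l = enc l'"
    have "i < length l \<longleftrightarrow> i < length l'" for i using len e by metis
    then have "length l = length l'" by (metis linorder_neqE_nat less_irrefl)
    moreover have "l ! i = l' ! i" if "i < length l" for i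
      using nth[of i _ l] nth[of i _ l'] e that calculation by auto
    ultimately show "l = l'" by (rule nth_equalityI)
  qed
  define list_of where "list_of A = (SOME l. set l = A)" for A :: "nat set set"
  have "set (list_of A) = A" if "finite A" for A
    unfolding list_of_def using someI_ex[OF finite_list[OF that]] .
  then have "inj_on (enc \<circ> list_of) {A. finite A}"
    using \<open>inj enc\<close> by (intro inj_onI) (metis comp_apply injD mem_Collect_eq)
  then show ?thesis using that by blast
qed

text \<open>The system consists of the finite subgroups from the class, ordered by inclusion; each of them
  is represented by an isomorphic product, and the index is a code of the subgroup.\<close>

lemma direct_limit_of_locally_alternating:
  fixes G :: "nat set monoid"
  assumes G: "group G" and la: "locally_alternating G"
  shows "direct_limit_of_alternating_products G"
proof -
  interpret G: group G by fact
  define \<P> where "\<P> = {P. finite P \<and> subgroup P G \<and> G\<lparr>carrier := P\<rparr> \<in> alternating_products}"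
  have above: "\<exists>P\<in>\<P>. A \<subseteq> P" if "finite A" "A \<subseteq> carrier G" for A
  proof -
    from la[unfolded locally_alternating_def, rule_format, OF conjI[OF that]]
    obtain P where "A \<subseteq> P" "finite P" "subgroup P G" "G\<lparr>carrier := P\<rparr> \<in> alternating_products"
      by blast
    then show ?thesis by (auto simp: \<P>_def)
  qed
  have P: "finite P" "subgroup P G" "P \<subseteq> carrier G" if "P \<in> \<P>" for P
    using that subgroup.subset by (auto simp: \<P>_def)
  have "\<exists>k n f. (\<forall>j<k. 5 \<le> n j) \<and> f \<in> iso (G\<lparr>carrier := P\<rparr>) (alt_product k n)" if P: "P \<in> \<P>" for P
  proof -
    obtain k and n :: "nat \<Rightarrow> nat" where "\<forall>j<k. 5 \<le> n j" "G\<lparr>carrier := P\<rparr> \<cong> alt_product k n"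
      using P unfolding \<P>_def alternating_products_def by blast
    then show ?thesis unfolding is_iso_def by blast
  qed
  then obtain k n f where f: "\<And>P j. P \<in> \<P> \<Longrightarrow> j < k P \<Longrightarrow> 5 \<le> n P j"
    "\<And>P. P \<in> \<P> \<Longrightarrow> f P \<in> iso (G\<lparr>carrier := P\<rparr>) (alt_product (k P) (n P))"
    by metis
  obtain code :: "nat set set \<Rightarrow> nat set" where code: "inj_on code {A. finite A}"
    using finite_set_encoding .
  have code_inj: "inj_on code \<P>" using code by (rule inj_on_subset) (auto simp: \<P>_def)
  define D where "D = inv_into \<P> code"
  have D: "D (code P) = P" if "P \<in> \<P>" for P using code_inj that by (simp add: D_def)
  define I where "I = (\<lparr>carrier = code ` \<P>, eq = (=), le = (\<lambda>i j. D i \<subseteq> D j)\<rparr> :: nat set gorder)"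
  define H where "H i = alt_product (k (D i)) (n (D i))" for i
  define \<psi> where "\<psi> i = f (D i)" for i
  define \<phi> where "\<phi> i j u = \<psi> j (inv_into (D i) (\<psi> i) u)" for i j u
  have I: "D i \<in> \<P>" "code (D i) = i" if "i \<in> carrier I" for i
    using that D by (auto simp: I_def)
  have \<psi>: "\<psi> i \<in> iso (G\<lparr>carrier := D i\<rparr>) (H i)" if "i \<in> carrier I" for i
    using f(2)[OF I(1)[OF that]] by (simp add: \<psi>_def H_def)
  have \<psi>b: "bij_betw (\<psi> i) (D i) (carrier (H i))" if "i \<in> carrier I" for i
    using \<psi>[OF that] by (simp add: iso_def)
  have \<phi>_\<psi>: "\<phi> i j (\<psi> i x) = \<psi> j x" if "i \<in> carrier I" "x \<in> D i" for i j x
    using bij_betw_inv_into_left[OF \<psi>b] that by (simp add: \<phi>_def)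
  have surj: "\<exists>x\<in>D i. u = \<psi> i x" if "i \<in> carrier I" "u \<in> carrier (H i)" for i u
    using \<psi>b[OF that(1)] that(2) by (auto simp: bij_betw_def)
  have mult: "\<psi> i (x \<otimes>\<^bsub>G\<^esub> y) = \<psi> i x \<otimes>\<^bsub>H i\<^esub> \<psi> i y" "\<psi> i x \<in> carrier (H i)"
    if "i \<in> carrier I" "x \<in> D i" "y \<in> D i" for i x y
    using \<psi>[OF that(1)] that by (auto simp: iso_def hom_def)
  have po: "partial_order I"
  proof
    show "x .=\<^bsub>I\<^esub> y" if "x \<sqsubseteq>\<^bsub>I\<^esub> y" "y \<sqsubseteq>\<^bsub>I\<^esub> x" "x \<in> carrier I" "y \<in> carrier I" for x y
    proof -
      have "D x = D y" using that(1,2) by (simp add: I_def)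
      then have "x = y" using I(2)[OF that(3)] I(2)[OF that(4)] by metis
      then show ?thesis by (simp add: I_def)
    qed
  qed (auto simp: I_def)
  have sys: "directed_group_system I H \<phi>"
  proof (intro directed_group_system.intro directed_group_system_axioms.intro po)
    show "carrier I \<noteq> {}" using above[of "{}"] by (auto simp: I_def)
    show "\<exists>k\<in>carrier I. i \<sqsubseteq>\<^bsub>I\<^esub> k \<and> j \<sqsubseteq>\<^bsub>I\<^esub> k" if ij: "i \<in> carrier I" "j \<in> carrier I" for i j
    proof -
      obtain R where "R \<in> \<P>" "D i \<union> D j \<subseteq> R"
        using above[of "D i \<union> D j"] P[OF I(1)[OF ij(1)]] P[OF I(1)[OF ij(2)]] by auto
      then show ?thesis using D by (intro bexI[of _ "code R"]) (auto simp: I_def)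
    qed
    show "group (H i)" if "i \<in> carrier I" for i unfolding H_def by (rule group_alt_product)
    show "\<phi> i j \<in> hom (H i) (H j)" if ij: "i \<in> carrier I" "j \<in> carrier I" "i \<sqsubseteq>\<^bsub>I\<^esub> j" for i j
    proof (rule homI)
      have sub: "D i \<subseteq> D j" using ij by (simp add: I_def)
      show "\<phi> i j u \<in> carrier (H j)" if u: "u \<in> carrier (H i)" for u
        using surj[OF ij(1) u] \<phi>_\<psi>[OF ij(1)] mult(2)[OF ij(2)] sub by auto
      show "\<phi> i j (u \<otimes>\<^bsub>H i\<^esub> v) = \<phi> i j u \<otimes>\<^bsub>H j\<^esub> \<phi> i j v"
        if uv: "u \<in> carrier (H i)" "v \<in> carrier (H i)" for u v
      proof -
        obtain x y where xy: "x \<in> D i" "u = \<psi> i x" "y \<in> D i" "v = \<psi> i y"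
          using surj[OF ij(1) uv(1)] surj[OF ij(1) uv(2)] by blast
        then have "x \<otimes>\<^bsub>G\<^esub> y \<in> D i" using P(2)[OF I(1)[OF ij(1)]] by (simp add: subgroup.m_closed)
        moreover have "x \<in> D j" "y \<in> D j" using xy sub by auto
        ultimately show ?thesis
          unfolding xy(2,4) mult(1)[OF ij(1) xy(1,3), symmetric]
          by (simp only: \<phi>_\<psi>[OF ij(1)] xy mult(1)[OF ij(2)])
      qed
    qed
    show "\<phi> i i u = u" if "i \<in> carrier I" "u \<in> carrier (H i)" for i u
      using surj[OF that] \<phi>_\<psi>[OF that(1)] by auto
    show "\<phi> j k (\<phi> i j u) = \<phi> i k u"
      if ijk: "i \<in> carrier I" "j \<in> carrier I" "k \<in> carrier I" "i \<sqsubseteq>\<^bsub>I\<^esub> j" "j \<sqsubseteq>\<^bsub>I\<^esub> k" "u \<in> carrier (H i)"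
      for i j k u
    proof -
      obtain x where x: "x \<in> D i" "u = \<psi> i x" using surj ijk by blast
      then have "x \<in> D j" using ijk by (auto simp: I_def)
      then show ?thesis using x \<phi>_\<psi> ijk by simp
    qed
  qed
  have "G \<cong> direct_limit I H \<phi>"
  proof (rule iso_direct_limit_of_subgroups[OF G sys, of D \<psi>])
    show "\<exists>i\<in>carrier I. x \<in> D i" if "x \<in> carrier G" for x
      using above[of "{x}"] that D by (auto simp: I_def)
  qed (use \<psi> \<phi>_\<psi> P(2) I(1) in \<open>auto simp: I_def\<close>)
  moreover have "H i \<in> alternating_products" if "i \<in> carrier I" for i
    unfolding H_def using f(1)[OF I(1)[OF that]] by (rule alt_product_in_alternating_products)
  ultimately show ?thesis
    unfolding direct_limit_of_alternating_products_def using sys G by blast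
qed

lemma ordLeq_aleph1_embeds_in_continuum:
  assumes "|A| \<le>o cardSuc natLeq"
  obtains e :: "'a \<times> nat \<Rightarrow> nat set" where "inj_on e (A \<times> UNIV)"
proof -
  have "natLeq =o |UNIV :: nat set|" by (rule ordIso_symmetric[OF card_of_nat])
  moreover have "|UNIV :: nat set| <o |UNIV :: nat set set|"
    using card_of_Pow[of "UNIV :: nat set"] by simp
  ultimately have "natLeq <o |UNIV :: nat set set|" by (rule ordIso_ordLess_trans)
  then have "cardSuc natLeq \<le>o |UNIV :: nat set set|"
    by (intro cardSuc_least natLeq_Card_order card_of_Card_order)
  then have "|A| \<le>o |UNIV :: nat set set|" using assms ordLeq_transitive by blast
  moreover have "|UNIV :: nat set| \<le>o |UNIV :: nat set set|"
    by (rule card_of_ordLeqI[of "\<lambda>x. {x}"]) auto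
  moreover have "infinite (UNIV :: nat set set)" by (simp add: Finite_Set.finite_set)
  ultimately have "|A \<times> (UNIV :: nat set)| \<le>o |UNIV :: nat set set|"
    by (intro card_of_Times_ordLeq_infinite_Field) (auto simp: Field_card_of card_of_card_order_on)
  then show ?thesis using that unfolding card_of_ordLeq[symmetric] by blast
qed

theorem theorem5p3:
  fixes S :: "('a, 'b) gorder_scheme"
  assumes "distributive_semilattice0 S"
    and "|carrier S| \<le>o cardSuc natLeq"
  shows "\<exists>G :: nat set monoid. direct_limit_of_alternating_products G \<and>
           semilattice0_iso S (NSubc G) \<noteq> {}"
proof -
  interpret distributive_semilattice0 S by fact
  obtain K :: "('a \<times> nat) monoid" and \<mu> where K: "saturated K \<mu>" "\<mu> ` carrier K = carrier S"
    "carrier K \<subseteq> carrier S \<times> UNIV"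
    using saturated_onto[OF assms(2)] by blast
  obtain e :: "'a \<times> nat \<Rightarrow> nat set" where "inj_on e (carrier S \<times> UNIV)"
    using ordLeq_aleph1_embeds_in_continuum[OF assms(2)] by blast
  then have e: "inj_on e (carrier K)" using K(3) by (rule inj_on_subset)
  define G where "G = image_group e K"
  define \<nu> where "\<nu> = \<mu> \<circ> inv_into (carrier K) e"
  have iso: "e \<in> iso K G" unfolding G_def by (rule inj_imp_image_group_iso[OF e])
  have "group K" using K(1) normedD(1) by (auto simp: saturated_def)
  then have G: "group G" unfolding G_def by (rule group.inj_imp_image_group_is_group[OF _ e])
  have \<nu>: "\<nu> (e x) = \<mu> x" if "x \<in> carrier K" for x using e that by (simp add: \<nu>_def)
  have sat: "saturated G \<nu>" by (rule saturated_iso[OF K(1) iso G \<nu>])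
  have "\<nu> ` carrier G = carrier S"
    using K(2) \<nu> by (simp add: G_def image_group_carrier image_image)
  then have "semilattice0_iso S (NSubc G) \<noteq> {}"
    using NSubc_iso_of_saturated[OF sat] by blast
  moreover have "direct_limit_of_alternating_products G"
    using direct_limit_of_locally_alternating[OF G] sat by (simp add: saturated_def)
  ultimately show ?thesis by blast
qed

end
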